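(* If $\mathfrak{a}$ is a finite-dimensional Lie algebra over a field of prime characteristic, then $H^n(\mathfrak{a}, U(\mathfrak{a})^\circ) = 0$ for every positive integer $n$.
   Context: Let $\mathbb{F}$ be the ground field and $U(\mathfrak{a})$ the universal enveloping algebra. The linear dual $U(\mathfrak{a})^* = \mathrm{Hom}_{\mathbb{F}}(U(\mathfrak{a}),\mathbb{F})$ is a left and a right $U(\mathfrak{a})$-module (the coregular module) via $(u\cdot f)(v) = f(vu)$ and $(f\cdot u)(v) = f(uv)$ for $u,v\in U(\mathfrak{a})$, $f \in U(\mathfrak{a})^*$. A module is locally finite if every finitely generated submodule is finite-dimensional over $\mathbb{F}$. The continuous dual $U(\mathfrak{a})^\circ$ is the largest locally finite submodule of the left and right $U(\mathfrak{a})$-module $U(\mathfrak{a})^*$; equivalently, it consists of all linear forms on $U(\mathfrak{a})$ that vanish on some two-sided ideal of finite codimension in $U(\mathfrak{a})$. $H^n(\mathfrak{a},M)$ denotes the ordinary (Chevalley–Eilenberg) Lie algebra cohomology with coefficients in $M$, i.e. $H^n(\mathfrak{a},M) \cong \mathrm{Ext}^n_{U(\mathfrak{a})}(\mathbb{F},M)$ with $\mathbb{F}$ the one-dimensional trivial module. *)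

theory Defs
  imports
    "HOL-Algebra.Algebra"
    "HOL-Library.Poly_Mapping"
    "HOL-Library.Function_Algebras"
begin

section \<open>Finite-dimensional Lie algebras\<close>

locale lie_algebra = vector_space scale
  for scale :: "'f::field \<Rightarrow> 'a::ab_group_add \<Rightarrow> 'a" +
  fixes bracket :: "'a \<Rightarrow> 'a \<Rightarrow> 'a"
  assumes linear_left: "Vector_Spaces.linear scale scale (\<lambda>x. bracket x y)"
    and linear_right: "Vector_Spaces.linear scale scale (bracket x)"
    and bracket_self: "bracket x x = 0"
    and jacobi: "bracket x (bracket y z) + bracket y (bracket z x) + bracket z (bracket x y) = 0"

text \<open>Vector subspaces \<open>V\<close> (the whole type included) that are spanned by finitely many vectors.\<close>

definition finite_dim :: "('f::field \<Rightarrow> 'b::ab_group_add \<Rightarrow> 'b) \<Rightarrow> 'b set \<Rightarrow> bool" where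
  "finite_dim s V \<longleftrightarrow> (\<exists>B. finite B \<and> V = Modules.module.span s B)"

locale finite_dimensional_lie_algebra = lie_algebra +
  assumes finite_dim_UNIV: "finite_dim scale UNIV"


section \<open>The universal enveloping algebra\<close>

text \<open>
  Words under concatenation are the free monoid on \<open>'a\<close>, so that the convolution ring
  \<open>'a word \<Rightarrow>\<^sub>0 'f\<close> is the free associative unital algebra on the underlying set of \<open>'a\<close>.
\<close>

datatype 'a word = Word (letters: "'a list")

instantiation word :: (type) monoid_add
begin

definition zero_word :: "'a word" where
  "zero_word = Word []"

definition plus_word :: "'a word \<Rightarrow> 'a word \<Rightarrow> 'a word" where
  "plus_word v w = Word (letters v @ letters w)"

instance
  by standard (simp_all add: zero_word_def plus_word_def)

end

type_synonym ('a, 'f) free_alg = "'a word \<Rightarrow>\<^sub>0 'f"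

definition gen :: "'a \<Rightarrow> ('a, 'f::field) free_alg" where
  "gen x = Poly_Mapping.single (Word [x]) 1"

definition alg_const :: "'f::field \<Rightarrow> ('a, 'f) free_alg" where
  "alg_const c = Poly_Mapping.single 0 c"

definition free_alg_ring :: "('a, 'f::field) free_alg ring" where
  "free_alg_ring = \<lparr>carrier = UNIV, monoid.mult = (*), one = 1, ring.zero = 0, add = (+)\<rparr>"

text \<open>
  Dividing the free algebra by the first two families of relations gives the tensor algebra of
  the vector space; the third family then gives its enveloping algebra.
\<close>

definition ue_relations ::
  "('f::field \<Rightarrow> 'a::ab_group_add \<Rightarrow> 'a) \<Rightarrow> ('a \<Rightarrow> 'a \<Rightarrow> 'a) \<Rightarrow> ('a, 'f) free_alg set" where
  "ue_relations scale bracket =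
     {gen (x + y) - gen x - gen y | x y. True} \<union>
     {gen (scale c x) - alg_const c * gen x | c x. True} \<union>
     {gen x * gen y - gen y * gen x - gen (bracket x y) | x y. True}"

definition ue_ideal ::
  "('f::field \<Rightarrow> 'a::ab_group_add \<Rightarrow> 'a) \<Rightarrow> ('a \<Rightarrow> 'a \<Rightarrow> 'a) \<Rightarrow> ('a, 'f) free_alg set" where
  "ue_ideal scale bracket = Idl\<^bsub>free_alg_ring\<^esub> (ue_relations scale bracket)"

definition ue_ring ::
  "('f::field \<Rightarrow> 'a::ab_group_add \<Rightarrow> 'a) \<Rightarrow> ('a \<Rightarrow> 'a \<Rightarrow> 'a) \<Rightarrow> ('a, 'f) free_alg set ring" where
  "ue_ring scale bracket = free_alg_ring Quot ue_ideal scale bracket"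

definition ue_gen ::
  "('f::field \<Rightarrow> 'a::ab_group_add \<Rightarrow> 'a) \<Rightarrow> ('a \<Rightarrow> 'a \<Rightarrow> 'a) \<Rightarrow> 'a \<Rightarrow> ('a, 'f) free_alg set" where
  "ue_gen scale bracket x = ue_ideal scale bracket +>\<^bsub>free_alg_ring\<^esub> gen x"

definition ue_const ::
  "('f::field \<Rightarrow> 'a::ab_group_add \<Rightarrow> 'a) \<Rightarrow> ('a \<Rightarrow> 'a \<Rightarrow> 'a) \<Rightarrow> 'f \<Rightarrow> ('a, 'f) free_alg set" where
  "ue_const scale bracket c = ue_ideal scale bracket +>\<^bsub>free_alg_ring\<^esub> alg_const c"


section \<open>The linear dual as a bimodule, and the continuous dual\<close>

text \<open>
  Linear forms on the enveloping algebra are represented by functions that vanish outside its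
  carrier, so that distinct functions are distinct forms.
\<close>

definition ue_dual ::
  "('f::field \<Rightarrow> 'a::ab_group_add \<Rightarrow> 'a) \<Rightarrow> ('a \<Rightarrow> 'a \<Rightarrow> 'a) \<Rightarrow> (('a, 'f) free_alg set \<Rightarrow> 'f) set"
  where
  "ue_dual scale bracket = (let U = ue_ring scale bracket in
     {f. (\<forall>u\<in>carrier U. \<forall>v\<in>carrier U. f (u \<oplus>\<^bsub>U\<^esub> v) = f u + f v) \<and>
         (\<forall>c. \<forall>u\<in>carrier U. f (ue_const scale bracket c \<otimes>\<^bsub>U\<^esub> u) = c * f u) \<and>
         (\<forall>u. u \<notin> carrier U \<longrightarrow> f u = 0)})"

definition fun_scale :: "'f::field \<Rightarrow> ('u \<Rightarrow> 'f) \<Rightarrow> 'u \<Rightarrow> 'f" where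
  "fun_scale c f = (\<lambda>u. c * f u)"

definition left_act ::
  "('f::field \<Rightarrow> 'a::ab_group_add \<Rightarrow> 'a) \<Rightarrow> ('a \<Rightarrow> 'a \<Rightarrow> 'a) \<Rightarrow> ('a, 'f) free_alg set \<Rightarrow>
   (('a, 'f) free_alg set \<Rightarrow> 'f) \<Rightarrow> ('a, 'f) free_alg set \<Rightarrow> 'f" where
  "left_act scale bracket u f = (let U = ue_ring scale bracket in
     (\<lambda>v. if v \<in> carrier U then f (v \<otimes>\<^bsub>U\<^esub> u) else 0))"

definition right_act ::
  "('f::field \<Rightarrow> 'a::ab_group_add \<Rightarrow> 'a) \<Rightarrow> ('a \<Rightarrow> 'a \<Rightarrow> 'a) \<Rightarrow>
   (('a, 'f) free_alg set \<Rightarrow> 'f) \<Rightarrow> ('a, 'f) free_alg set \<Rightarrow> ('a, 'f) free_alg set \<Rightarrow> 'f" where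
  "right_act scale bracket f u = (let U = ue_ring scale bracket in
     (\<lambda>v. if v \<in> carrier U then f (u \<otimes>\<^bsub>U\<^esub> v) else 0))"

definition sub_bimodule ::
  "('f::field \<Rightarrow> 'a::ab_group_add \<Rightarrow> 'a) \<Rightarrow> ('a \<Rightarrow> 'a \<Rightarrow> 'a) \<Rightarrow>
   (('a, 'f) free_alg set \<Rightarrow> 'f) set \<Rightarrow> bool" where
  "sub_bimodule scale bracket N \<longleftrightarrow>
     N \<subseteq> ue_dual scale bracket \<and> Modules.module.subspace fun_scale N \<and>
     (\<forall>u\<in>carrier (ue_ring scale bracket). \<forall>f\<in>N.
        left_act scale bracket u f \<in> N \<and> right_act scale bracket f u \<in> N)"

definition locally_finite ::
  "('f::field \<Rightarrow> 'a::ab_group_add \<Rightarrow> 'a) \<Rightarrow> ('a \<Rightarrow> 'a \<Rightarrow> 'a) \<Rightarrow>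
   (('a, 'f) free_alg set \<Rightarrow> 'f) set \<Rightarrow> bool" where
  "locally_finite scale bracket N \<longleftrightarrow>
     (\<forall>S. finite S \<and> S \<subseteq> N \<longrightarrow> finite_dim fun_scale (sub_bimodule scale bracket hull S))"

definition continuous_dual ::
  "('f::field \<Rightarrow> 'a::ab_group_add \<Rightarrow> 'a) \<Rightarrow> ('a \<Rightarrow> 'a \<Rightarrow> 'a) \<Rightarrow> (('a, 'f) free_alg set \<Rightarrow> 'f) set"
  where
  "continuous_dual scale bracket =
     \<Union>{N. sub_bimodule scale bracket N \<and> locally_finite scale bracket N}"


text \<open>
  The union in the definition of \<open>continuous_dual\<close> is the largest locally finite sub-bimodule
  (\<open>continuous_dual_greatest\<close> below).
\<close>

lemma ring_free_alg_ring: "ring (free_alg_ring :: ('a, 'f::field) free_alg ring)"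
proof -
  have "\<exists>y. x + y = 0" for x :: "('a, 'f) free_alg"
    using add.right_inverse by blast
  moreover have "\<exists>y. y + x = 0" for x :: "('a, 'f) free_alg"
    using add.left_inverse by blast
  ultimately show ?thesis
    unfolding free_alg_ring_def
    by unfold_locales (auto simp: algebra_simps Units_def)
qed

lemma ideal_ue_ideal: "ideal (ue_ideal scale bracket) free_alg_ring"
  unfolding ue_ideal_def
  by (rule ring.genideal_ideal[OF ring_free_alg_ring]) (simp add: free_alg_ring_def)

lemma ring_ue_ring: "ring (ue_ring scale bracket)"
  unfolding ue_ring_def by (rule ideal.quotient_is_ring[OF ideal_ue_ideal])

lemma ue_const_closed: "ue_const scale bracket c \<in> carrier (ue_ring scale bracket)"
  unfolding ue_const_def ue_ring_def FactRing_def A_RCOSETS_def' by (auto simp: free_alg_ring_def)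

lemma ue_const_commute:
  assumes "u \<in> carrier (ue_ring scale bracket)"
  shows "ue_const scale bracket c \<otimes>\<^bsub>ue_ring scale bracket\<^esub> u = u \<otimes>\<^bsub>ue_ring scale bracket\<^esub> ue_const scale bracket c"
proof -
  interpret I: ideal "ue_ideal scale bracket" free_alg_ring by (rule ideal_ue_ideal)
  obtain a where a: "u = ue_ideal scale bracket +>\<^bsub>free_alg_ring\<^esub> a"
    using assms unfolding ue_ring_def FactRing_def A_RCOSETS_def' by auto
  have keys: "alg_const c * a = a * alg_const c" for a :: "('c,'d::field) free_alg" and c
  proof (induction a rule: Poly_Mapping.update_induct)
    case const then show ?case by simp
  next
    case (update f k v)
    have "Poly_Mapping.update k v f = f + Poly_Mapping.single k v"
      using update by (intro poly_mapping_eqI)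
        (auto simp: lookup_update lookup_add lookup_single in_keys_iff when_def)
    then show ?case using update by (simp add: algebra_simps alg_const_def mult_single)
  qed
  have [simp]: "carrier (free_alg_ring :: ('a, 'b) free_alg ring) = UNIV"
    "monoid.mult (free_alg_ring :: ('a, 'b) free_alg ring) = (*)"
    by (simp_all add: free_alg_ring_def)
  show ?thesis unfolding a ue_ring_def FactRing_def ue_const_def
    by (simp add: I.rcoset_mult_add keys)
qed

interpretation fun_vs: vector_space "fun_scale :: 'f::field \<Rightarrow> ('u \<Rightarrow> 'f) \<Rightarrow> _"
  by unfold_locales (auto simp: fun_scale_def algebra_simps fun_eq_iff)

lemma ue_dual_sub_bimodule: "sub_bimodule scale bracket (ue_dual scale bracket)"
proof -
  interpret ring "ue_ring scale bracket" by (rule ring_ue_ring)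
  show ?thesis
    unfolding sub_bimodule_def
  proof (intro conjI ballI)
    show "fun_vs.subspace (ue_dual scale bracket)"
      by (rule fun_vs.subspaceI)
        (simp_all add: ue_dual_def Let_def fun_scale_def distrib_left add_ac mult.left_commute)
    fix u f assume u: "u \<in> carrier (ue_ring scale bracket)" and f: "f \<in> ue_dual scale bracket"
    show "left_act scale bracket u f \<in> ue_dual scale bracket"
      using u f ue_const_closed[of scale bracket]
      by (simp add: ue_dual_def left_act_def Let_def l_distr m_assoc)
    have "u \<otimes>\<^bsub>ue_ring scale bracket\<^esub> (ue_const scale bracket c \<otimes>\<^bsub>ue_ring scale bracket\<^esub> v) =
       ue_const scale bracket c \<otimes>\<^bsub>ue_ring scale bracket\<^esub> (u \<otimes>\<^bsub>ue_ring scale bracket\<^esub> v)"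
      if "v \<in> carrier (ue_ring scale bracket)" for c v
      using that u ue_const_closed[of scale bracket c] ue_const_commute[OF u, of c]
      by (metis m_assoc)
    then show "right_act scale bracket f u \<in> ue_dual scale bracket"
      using u f ue_const_closed[of scale bracket]
      by (simp add: ue_dual_def right_act_def Let_def r_distr)
  qed simp
qed

lemma sub_bimodule_Inter:
  "(\<And>N. N \<in> T \<Longrightarrow> sub_bimodule scale bracket N) \<Longrightarrow> T \<noteq> {} \<Longrightarrow> sub_bimodule scale bracket (\<Inter>T)"
  unfolding sub_bimodule_def fun_vs.subspace_def by blast

lemma sub_bimodule_hull:
  assumes "S \<subseteq> ue_dual scale bracket"
  shows "sub_bimodule scale bracket (sub_bimodule scale bracket hull S)"
  unfolding hull_def by (rule sub_bimodule_Inter) (use assms ue_dual_sub_bimodule in auto)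

lemma finite_dim_subset:
  assumes "finite_dim fun_scale W" "fun_vs.subspace V" "V \<subseteq> W"
  shows "finite_dim fun_scale V"
proof -
  obtain B where B: "finite B" "W = fun_vs.span B" using assms(1) by (auto simp: finite_dim_def)
  obtain C where C: "C \<subseteq> V" "fun_vs.independent C" "V \<subseteq> fun_vs.span C" using fun_vs.maximal_independent_subset by blast
  have "finite C" using fun_vs.independent_span_bound[OF B(1) C(2)] C B assms by auto
  moreover have "V = fun_vs.span C" using C fun_vs.span_minimal[OF C(1) assms(2)] by auto
  ultimately show ?thesis by (auto simp: finite_dim_def)
qed

lemma act_add:
  "left_act scale bracket u (f + g) = left_act scale bracket u f + left_act scale bracket u g"
  "right_act scale bracket (f + g) u = right_act scale bracket f u + right_act scale bracket g u"
  by (auto simp: left_act_def right_act_def Let_def fun_eq_iff)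

lemma sub_bimodule_sum:
  assumes "sub_bimodule scale bracket M" "sub_bimodule scale bracket N"
  shows "sub_bimodule scale bracket {f + g | f g. f \<in> M \<and> g \<in> N}"
proof -
  have "fun_vs.subspace {f + g | f g. f \<in> M \<and> g \<in> N}"
    using fun_vs.subspace_sums assms by (auto simp: sub_bimodule_def)
  moreover have "{f + g | f g. f \<in> M \<and> g \<in> N} \<subseteq> ue_dual scale bracket"
    using assms ue_dual_sub_bimodule[of scale bracket] by (auto simp: sub_bimodule_def fun_vs.subspace_def)
  moreover have "left_act scale bracket u h \<in> {f + g | f g. f \<in> M \<and> g \<in> N} \<and> right_act scale bracket h u \<in> {f + g | f g. f \<in> M \<and> g \<in> N}"
    if "u \<in> carrier (ue_ring scale bracket)" "h \<in> {f + g | f g. f \<in> M \<and> g \<in> N}" for u h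
  proof -
    obtain f g where "h = f + g" "f \<in> M" "g \<in> N" using \<open>h \<in> {f + g | f g. f \<in> M \<and> g \<in> N}\<close> by blast
    moreover have "left_act scale bracket u f \<in> M" "right_act scale bracket f u \<in> M"
      using assms(1) that(1) \<open>f \<in> M\<close> by (simp_all add: sub_bimodule_def)
    moreover have "left_act scale bracket u g \<in> N" "right_act scale bracket g u \<in> N"
      using assms(2) that(1) \<open>g \<in> N\<close> by (simp_all add: sub_bimodule_def)
    ultimately show ?thesis unfolding \<open>h = f + g\<close> act_add by blast
  qed
  ultimately show ?thesis unfolding sub_bimodule_def by (intro conjI ballI) auto
qed

lemma finite_dim_sum:
  assumes "finite_dim fun_scale V" "finite_dim fun_scale W"
  shows "finite_dim fun_scale {f + g | f g. f \<in> V \<and> g \<in> W}"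
proof -
  obtain B C where "finite B" "V = fun_vs.span B" "finite C" "W = fun_vs.span C"
    using assms by (auto simp: finite_dim_def)
  then show ?thesis unfolding finite_dim_def
    by (intro exI[of _ "B \<union> C"]) (simp add: fun_vs.span_Un)
qed

lemma hull_finite_dim:
  assumes "finite S" "S \<subseteq> continuous_dual scale bracket"
  shows "finite_dim fun_scale (sub_bimodule scale bracket hull S)"
  using assms
proof (induction S)
  case empty
  have z: "sub_bimodule scale bracket {0}"
    using ue_dual_sub_bimodule[of scale bracket]
    by (auto simp: sub_bimodule_def fun_vs.subspace_def left_act_def right_act_def fun_eq_iff Let_def)
  have "sub_bimodule scale bracket hull {} \<subseteq> {0}" by (rule hull_minimal) (use z in auto)
  moreover have "finite_dim fun_scale {0}"
    unfolding finite_dim_def by (rule exI[of _ "{}"]) (auto simp: fun_vs.span_empty)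
  moreover have "sub_bimodule scale bracket (sub_bimodule scale bracket hull {})"
    by (rule sub_bimodule_hull) simp
  ultimately show ?case
    by (meson finite_dim_subset sub_bimodule_def)
next
  case (insert f S)
  let ?h = "\<lambda>S. sub_bimodule scale bracket hull S"
  let ?W = "{a + b | a b. a \<in> ?h {f} \<and> b \<in> ?h S}"
  have D: "continuous_dual scale bracket \<subseteq> ue_dual scale bracket"
    by (auto simp: continuous_dual_def sub_bimodule_def)
  obtain N where N: "f \<in> N" "sub_bimodule scale bracket N" "locally_finite scale bracket N"
    using insert.prems by (auto simp: continuous_dual_def)
  have f: "finite_dim fun_scale (?h {f})" using N by (auto simp: locally_finite_def)
  have S: "finite_dim fun_scale (?h S)" using insert by auto
  have b1: "sub_bimodule scale bracket (?h {f})" and b2: "sub_bimodule scale bracket (?h S)"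
    and b3: "sub_bimodule scale bracket (?h (insert f S))"
    by (rule sub_bimodule_hull; use insert.prems D in auto)+
  have W: "sub_bimodule scale bracket ?W" by (rule sub_bimodule_sum[OF b1 b2])
  have i1: "a \<in> ?W" if "a \<in> ?h {f}" for a
  proof -
    have "0 \<in> ?h S" using b2 by (auto simp: sub_bimodule_def fun_vs.subspace_def)
    then have "a = a + 0 \<and> a \<in> ?h {f} \<and> 0 \<in> ?h S" using that by simp
    then show ?thesis by blast
  qed
  have i2: "a \<in> ?W" if "a \<in> ?h S" for a
  proof -
    have "0 \<in> ?h {f}" using b1 by (auto simp: sub_bimodule_def fun_vs.subspace_def)
    then have "a = 0 + a \<and> 0 \<in> ?h {f} \<and> a \<in> ?h S" using that by simp
    then show ?thesis by blast
  qed
  have "insert f S \<subseteq> ?W"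
    using i1[of f] i2 hull_subset[of "{f}" "sub_bimodule scale bracket"]
      hull_subset[of S "sub_bimodule scale bracket"] by blast
  then have "?h (insert f S) \<subseteq> ?W" by (rule hull_minimal) (rule W)
  moreover have "fun_vs.subspace (?h (insert f S))" using b3 unfolding sub_bimodule_def by blast
  ultimately show ?case using finite_dim_subset[OF finite_dim_sum[OF f S]] by blast
qed

theorem continuous_dual_greatest:
  "sub_bimodule scale bracket (continuous_dual scale bracket)"
  "locally_finite scale bracket (continuous_dual scale bracket)"
  "\<lbrakk>sub_bimodule scale bracket N; locally_finite scale bracket N\<rbrakk> \<Longrightarrow> N \<subseteq> continuous_dual scale bracket"
proof -
  show lf: "locally_finite scale bracket (continuous_dual scale bracket)"
    using hull_finite_dim by (auto simp: locally_finite_def)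
  have D: "continuous_dual scale bracket \<subseteq> ue_dual scale bracket"
    by (auto simp: continuous_dual_def sub_bimodule_def)
  have H: "sub_bimodule scale bracket hull S \<subseteq> continuous_dual scale bracket"
    if "finite S" "S \<subseteq> continuous_dual scale bracket" for S
  proof -
    let ?H = "sub_bimodule scale bracket hull S"
    have b: "sub_bimodule scale bracket ?H" by (rule sub_bimodule_hull) (use that D in auto)
    have "finite_dim fun_scale (sub_bimodule scale bracket hull T)" if "T \<subseteq> ?H" for T
    proof (rule finite_dim_subset[OF hull_finite_dim[OF \<open>finite S\<close> \<open>S \<subseteq> _\<close>]])
      show "sub_bimodule scale bracket hull T \<subseteq> ?H" using hull_minimal[of T ?H] that b by blast
      have "sub_bimodule scale bracket (sub_bimodule scale bracket hull T)"
        by (rule sub_bimodule_hull) (use that b in \<open>auto simp: sub_bimodule_def\<close>)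
      then show "fun_vs.subspace (sub_bimodule scale bracket hull T)" by (simp add: sub_bimodule_def)
    qed
    then have "locally_finite scale bracket ?H" by (auto simp: locally_finite_def)
    with b show ?thesis by (auto simp: continuous_dual_def)
  qed
  show "sub_bimodule scale bracket (continuous_dual scale bracket)"
    unfolding sub_bimodule_def
  proof (intro conjI ballI D)
    have add: "f + g \<in> continuous_dual scale bracket"
      if "f \<in> continuous_dual scale bracket" "g \<in> continuous_dual scale bracket" for f g
    proof -
      have "sub_bimodule scale bracket (sub_bimodule scale bracket hull {f,g})"
        by (rule sub_bimodule_hull) (use that D in auto)
      then have "f + g \<in> sub_bimodule scale bracket hull {f,g}"
        using hull_subset[of "{f,g}" "sub_bimodule scale bracket"]
        by (auto simp: sub_bimodule_def fun_vs.subspace_def)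
      then show ?thesis using H[of "{f,g}"] that by auto
    qed
    have "0 \<in> sub_bimodule scale bracket hull {}"
      using sub_bimodule_hull[of "{}" scale bracket] by (auto simp: sub_bimodule_def fun_vs.subspace_def)
    then have z: "0 \<in> continuous_dual scale bracket" using H[of "{}"] by auto
    show "fun_vs.subspace (continuous_dual scale bracket)"
    proof (rule fun_vs.subspaceI[OF z add])
      fix c f assume "f \<in> continuous_dual scale bracket"
      then obtain N where N: "f \<in> N" "sub_bimodule scale bracket N" "locally_finite scale bracket N"
        unfolding continuous_dual_def by blast
      then have "fun_scale c f \<in> N" by (simp add: sub_bimodule_def fun_vs.subspace_scale)
      with N show "fun_scale c f \<in> continuous_dual scale bracket"
        unfolding continuous_dual_def by blast
    qed
    fix u f assume u: "u \<in> carrier (ue_ring scale bracket)" and "f \<in> continuous_dual scale bracket"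
    then obtain N where N: "f \<in> N" "sub_bimodule scale bracket N" "locally_finite scale bracket N"
      unfolding continuous_dual_def by blast
    with u have "left_act scale bracket u f \<in> N" "right_act scale bracket f u \<in> N"
      by (simp_all add: sub_bimodule_def)
    with N show "left_act scale bracket u f \<in> continuous_dual scale bracket"
      "right_act scale bracket f u \<in> continuous_dual scale bracket"
      unfolding continuous_dual_def by blast+
  qed
  show "\<lbrakk>sub_bimodule scale bracket N; locally_finite scale bracket N\<rbrakk> \<Longrightarrow> N \<subseteq> continuous_dual scale bracket"
    by (auto simp: continuous_dual_def)
qed


section \<open>Chevalley--Eilenberg cohomology\<close>

text \<open>
  An \<open>n\<close>-cochain is an alternating \<open>n\<close>-linear map with values in \<open>M\<close>, given as a function on
  lists of length \<open>n\<close> that is extended by zero to all other lists.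
\<close>

definition cochains ::
  "('f::field \<Rightarrow> 'a::ab_group_add \<Rightarrow> 'a) \<Rightarrow> ('f \<Rightarrow> 'm::ab_group_add \<Rightarrow> 'm) \<Rightarrow> 'm set \<Rightarrow>
   nat \<Rightarrow> ('a list \<Rightarrow> 'm) set" where
  "cochains scale scaleM M n =
     {c. (\<forall>xs. length xs = n \<longrightarrow> c xs \<in> M) \<and>
         (\<forall>xs. length xs \<noteq> n \<longrightarrow> c xs = 0) \<and>
         (\<forall>xs i. length xs = n \<and> i < n \<longrightarrow>
            (\<forall>x y. c (xs[i := x + y]) = c (xs[i := x]) + c (xs[i := y])) \<and>
            (\<forall>a x. c (xs[i := scale a x]) = scaleM a (c (xs[i := x])))) \<and>
         (\<forall>xs i j. length xs = n \<and> i < j \<and> j < n \<and> xs ! i = xs ! j \<longrightarrow> c xs = 0)}"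

text \<open>
  \<open>nths xs (- {i})\<close> and \<open>nths xs (- {i, j})\<close> are \<open>xs\<close> with the entries at the (zero-based) positions
  \<open>i\<close>, respectively \<open>i\<close> and \<open>j\<close>, omitted.
\<close>

definition ce_diff ::
  "('a \<Rightarrow> 'a \<Rightarrow> 'a) \<Rightarrow> ('f::field \<Rightarrow> 'm::ab_group_add \<Rightarrow> 'm) \<Rightarrow> ('a \<Rightarrow> 'm \<Rightarrow> 'm) \<Rightarrow>
   ('a list \<Rightarrow> 'm) \<Rightarrow> 'a list \<Rightarrow> 'm" where
  "ce_diff bracket scaleM act c xs =
     (\<Sum>i<length xs. scaleM ((-1) ^ i) (act (xs ! i) (c (nths xs (- {i}))))) +
     (\<Sum>j<length xs. \<Sum>i<j.
        scaleM ((-1) ^ (i + j)) (c (bracket (xs ! i) (xs ! j) # nths xs (- {i, j}))))"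

definition cocycle_group ::
  "('f::field \<Rightarrow> 'a::ab_group_add \<Rightarrow> 'a) \<Rightarrow> ('a \<Rightarrow> 'a \<Rightarrow> 'a) \<Rightarrow> ('f \<Rightarrow> 'm::ab_group_add \<Rightarrow> 'm) \<Rightarrow>
   ('a \<Rightarrow> 'm \<Rightarrow> 'm) \<Rightarrow> 'm set \<Rightarrow> nat \<Rightarrow> ('a list \<Rightarrow> 'm) monoid" where
  "cocycle_group scale bracket scaleM act M n =
     \<lparr>carrier = {c \<in> cochains scale scaleM M n. ce_diff bracket scaleM act c = 0},
      monoid.mult = (+), one = 0\<rparr>"

fun coboundaries ::
  "('f::field \<Rightarrow> 'a::ab_group_add \<Rightarrow> 'a) \<Rightarrow> ('a \<Rightarrow> 'a \<Rightarrow> 'a) \<Rightarrow> ('f \<Rightarrow> 'm::ab_group_add \<Rightarrow> 'm) \<Rightarrow>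
   ('a \<Rightarrow> 'm \<Rightarrow> 'm) \<Rightarrow> 'm set \<Rightarrow> nat \<Rightarrow> ('a list \<Rightarrow> 'm) set" where
  "coboundaries scale bracket scaleM act M 0 = {0}"
| "coboundaries scale bracket scaleM act M (Suc n) =
     ce_diff bracket scaleM act ` cochains scale scaleM M n"

definition lie_cohomology ::
  "('f::field \<Rightarrow> 'a::ab_group_add \<Rightarrow> 'a) \<Rightarrow> ('a \<Rightarrow> 'a \<Rightarrow> 'a) \<Rightarrow> ('f \<Rightarrow> 'm::ab_group_add \<Rightarrow> 'm) \<Rightarrow>
   ('a \<Rightarrow> 'm \<Rightarrow> 'm) \<Rightarrow> 'm set \<Rightarrow> nat \<Rightarrow> ('a list \<Rightarrow> 'm) set monoid" where
  "lie_cohomology scale bracket scaleM act M n =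
     cocycle_group scale bracket scaleM act M n Mod coboundaries scale bracket scaleM act M n"

text \<open>The left coregular action of the Lie algebra, through its canonical map to the enveloping algebra.\<close>

definition coregular ::
  "('f::field \<Rightarrow> 'a::ab_group_add \<Rightarrow> 'a) \<Rightarrow> ('a \<Rightarrow> 'a \<Rightarrow> 'a) \<Rightarrow> 'a \<Rightarrow>
   (('a, 'f) free_alg set \<Rightarrow> 'f) \<Rightarrow> ('a, 'f) free_alg set \<Rightarrow> 'f" where
  "coregular scale bracket x = left_act scale bracket (ue_gen scale bracket x)"

end

theory Submission
  imports Defs "HOL-Computational_Algebra.Polynomial"
begin

text \<open>
  Let \<open>e\<^sub>0, \<dots>, e\<^sub>m\<^sub>-\<^sub>1\<close> be a basis of the Lie algebra. In characteristic \<open>p\<close> there is for every \<open>k\<close> a monic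
  linear combination \<open>P\<^sub>k\<close> of the monomials \<open>X^(p^j)\<close> with \<open>P\<^sub>k(ad e\<^sub>k) = 0\<close>; then \<open>z\<^sub>k = P\<^sub>k(e\<^sub>k)\<close> is
  central in the enveloping algebra. On cochains the action of \<open>z\<^sub>k\<close> on the values equals
  \<open>P\<^sub>k(L)\<close> for the Lie derivative \<open>L\<close> along \<open>e\<^sub>k\<close>, because \<open>P\<^sub>k\<close> is additive on commuting operators. As
  \<open>L = [d, \<iota>]\<close> and \<open>P\<^sub>k\<close> has no constant term, \<open>z\<^sub>k\<close> acts null-homotopically, hence by zero on cohomology.

  Let \<open>K\<^sub>k\<close> be the subspace of the continuous dual that is annihilated by all \<open>z\<^sub>j\<close> with \<open>j < k\<close>. By the
  Poincare--Birkhoff--Witt theorem \<open>z\<^sub>k\<close> maps \<open>K\<^sub>k\<close> onto itself: a form is determined by arbitrary values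
  on the ordered monomials, and a preimage is found by solving a linear recurrence in the exponent
  of \<open>e\<^sub>k\<close>. The long exact sequence of \<open>0 \<rightarrow> K\<^sub>k\<^sub>+\<^sub>1 \<rightarrow> K\<^sub>k \<rightarrow> K\<^sub>k \<rightarrow> 0\<close> therefore embeds \<open>H\<^sup>n(K\<^sub>k)\<close>
  into \<open>H\<^sup>n\<^sup>+\<^sup>1(K\<^sub>k\<^sub>+\<^sub>1)\<close>, and after \<open>m\<close> steps one arrives in degree \<open>n + m > m\<close>, where there are no
  non-zero cochains.
\<close>

section \<open>Polynomials in a linear operator\<close>

text \<open>The obstacle is that a preimage under z_k has to stay in K_k and in the continuous dual
  at the same time. In the full dual preimages are easy to find, but nothing makes them locally
  finite. Two facts settle this. First, the continuous dual has a workable criterion: a form belongs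
  to it as soon as each basis vector has a monic polynomial with central value that kills the form.
  Conversely, every form of the continuous dual is killed by some monic polynomial in each z_j,
  because z_j acts on the finite-dimensional sub-bimodule that the form generates. Second, the
  preimage is normalised to vanish on all ordered monomials whose exponent of e_k is below the
  degree of P_k. A central polynomial in another basis vector respects this normalisation and
  commutes with z_k, so if it kills the given form, it kills the preimage too; for e_k itself one
  additional factor z_k is enough. Throughout, linear forms are handled as functions on words in the
  Lie algebra, so that no basis of the enveloping algebra has to be constructed.\<close>

lemma linearD:
  assumes "Vector_Spaces.linear s t f"
  shows linear_addD: "f (x + y) = f x + f y" and linear_scaleD: "f (s c x) = t c (f x)"
    and linear_zeroD: "f 0 = 0" and linear_diffD: "f (x - y) = f x - f y"
    and linear_sumD: "f (sum g A) = (\<Sum>a\<in>A. f (g a))"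
proof -
  interpret Vector_Spaces.linear s t f by fact
  show "f (x + y) = f x + f y" "f (s c x) = t c (f x)" "f 0 = 0" "f (x - y) = f x - f y"
    "f (sum g A) = (\<Sum>a\<in>A. f (g a))"
    by (simp_all add: add scale zero diff sum)
qed

definition opoly :: "('f::field \<Rightarrow> 'm::ab_group_add \<Rightarrow> 'm) \<Rightarrow> 'f poly \<Rightarrow> ('m \<Rightarrow> 'm) \<Rightarrow> 'm \<Rightarrow> 'm" where
  "opoly s P T v = (\<Sum>i\<le>degree P. s (coeff P i) ((T ^^ i) v))"

text \<open>The relation is asked for only on an invariant set \<open>V\<close>, because the
  commutation rules for differentials and for central elements hold only on cochains and on
  forms.\<close>

lemma opoly_intertwine:
  assumes G: "Vector_Spaces.linear s t G"
    and step: "\<And>v. v \<in> V \<Longrightarrow> T v \<in> V \<and> G (T v) = T' (G v)" and v: "v \<in> V"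
  shows "G (opoly s P T v) = opoly t P T' (G v)"
proof -
  have "(T ^^ i) v \<in> V \<and> G ((T ^^ i) v) = (T' ^^ i) (G v)" for i
    by (induction i) (use v step in auto)
  then show ?thesis
    by (simp add: opoly_def linear_sumD[OF G] linear_scaleD[OF G])
qed

context vector_space
begin

lemma linearI':
  assumes "\<And>x y. f (x + y) = f x + f y" "\<And>c x. f (scale c x) = scale c (f x)"
  shows "Vector_Spaces.linear scale scale f"
  by (simp add: Vector_Spaces.linear_iff assms vector_space_axioms)

lemma opoly_eq_sum:
  assumes "degree P \<le> n"
  shows "opoly scale P T v = (\<Sum>i\<le>n. scale (coeff P i) ((T ^^ i) v))"
  unfolding opoly_def
  by (rule sum.mono_neutral_left) (use assms in \<open>auto simp: coeff_eq_0\<close>)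

lemma opoly_closed:
  assumes "subspace V" "\<And>v. v \<in> V \<Longrightarrow> T v \<in> V" "v \<in> V"
  shows "opoly scale P T v \<in> V"
proof -
  have "(T ^^ i) v \<in> V" for i by (induction i) (use assms in auto)
  then show ?thesis unfolding opoly_def
    by (intro subspace_sum subspace_scale assms)
qed

lemma funpow_linear:
  assumes "Vector_Spaces.linear scale scale T"
  shows "Vector_Spaces.linear scale scale (T ^^ i)"
  by (induction i) (auto intro!: linearI' simp: linearD[OF assms] linearD)

lemma opoly_linear:
  assumes "Vector_Spaces.linear scale scale T"
  shows "Vector_Spaces.linear scale scale (opoly scale P T)"
  by (rule linearI')
    (simp_all add: opoly_def linearD[OF funpow_linear[OF assms]] scale_right_distrib sum.distrib
      scale_sum_right mult.commute)

lemma opoly_0 [simp]: "opoly scale 0 T v = 0"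
  by (simp add: opoly_def)

lemma opoly_pCons:
  assumes "Vector_Spaces.linear scale scale T"
  shows "opoly scale (pCons a P) T v = scale a v + T (opoly scale P T v)"
proof -
  have "opoly scale (pCons a P) T v = (\<Sum>i\<le>Suc (degree P). scale (coeff (pCons a P) i) ((T ^^ i) v))"
    by (rule opoly_eq_sum) (simp add: degree_pCons_le)
  also have "\<dots> = scale a v + (\<Sum>i\<le>degree P. scale (coeff P i) (T ((T ^^ i) v)))"
    by (subst sum.atMost_Suc_shift) simp
  finally show ?thesis
    by (simp add: opoly_def linearD[OF assms])
qed

lemma opoly_add: "opoly scale (P + Q) T v = opoly scale P T v + opoly scale Q T v"
  using degree_add_le_max[of P Q]
  by (simp add: opoly_eq_sum[of _ "max (degree P) (degree Q)"] scale_left_distrib sum.distrib)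

lemma opoly_smult: "opoly scale (smult a P) T v = scale a (opoly scale P T v)"
  using degree_smult_le[of a P]
  by (simp add: opoly_eq_sum[of _ "degree P"] scale_sum_right)

lemma opoly_diff: "opoly scale (P - Q) T v = opoly scale P T v - opoly scale Q T v"
  using opoly_add[of P "- Q" T v] opoly_smult[of "- 1" Q T v] by simp

lemma opoly_sum: "opoly scale (\<Sum>i\<in>I. P i) T v = (\<Sum>i\<in>I. opoly scale (P i) T v)"
  by (induction I rule: infinite_finite_induct) (simp_all add: opoly_add)

lemma opoly_monom: "opoly scale (Polynomial.monom a n) T v = scale a ((T ^^ n) v)"
proof -
  have "opoly scale (Polynomial.monom a n) T v = (\<Sum>i\<le>n. scale (if n = i then a else 0) ((T ^^ i) v))"
    using opoly_eq_sum[OF degree_monom_le, of a n T v] by simp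
  also have "\<dots> = (\<Sum>i\<le>n. if i = n then scale a ((T ^^ i) v) else 0)"
    by (rule sum.cong) auto
  finally show ?thesis by simp
qed

lemma opoly_const: "opoly scale [:a:] T v = scale a v"
  by (simp add: opoly_def)

lemma opoly_mult:
  assumes "Vector_Spaces.linear scale scale T"
  shows "opoly scale (P * Q) T v = opoly scale P T (opoly scale Q T v)"
  by (induction P) (simp_all add: opoly_add opoly_smult opoly_pCons[OF assms])

lemma opoly_pcompose:
  assumes T: "Vector_Spaces.linear scale scale T"
  shows "opoly scale (pcompose H P) T v = opoly scale H (opoly scale P T) v"
  by (induction H)
    (simp_all add: pcompose_pCons opoly_add opoly_const opoly_mult[OF T] opoly_pCons[OF T]
      opoly_pCons[OF opoly_linear[OF T]] linear_zeroD[OF T])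

text \<open>Coefficients are indexed by \<open>A\<close> and not by the image, since iterates of an
  operator may repeat.\<close>

lemma span_image_finiteD:
  assumes "finite A" "x \<in> span (v ` A)"
  shows "\<exists>c. x = (\<Sum>j\<in>A. scale (c j) (v j))"
  using assms(2)
proof (induction rule: span_induct_alt)
  case base
  then show ?case by (intro exI[of _ "\<lambda>_. 0"]) simp
next
  case (step a b y)
  then obtain c k where c: "y = (\<Sum>j\<in>A. scale (c j) (v j))" and k: "k \<in> A" "b = v k" by auto
  have "(\<Sum>j\<in>A. scale (if j = k then a else 0) (v j)) = (\<Sum>j\<in>A. if j = k then scale a (v j) else 0)"
    by (rule sum.cong) auto
  also have "\<dots> = scale a b" using assms(1) k by simp
  finally have "scale a b + y = (\<Sum>j\<in>A. scale ((if j = k then a else 0) + c j) (v j))"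
    by (simp only: c scale_left_distrib sum.distrib)
  then show ?case by (rule exI[of _ "\<lambda>j. (if j = k then a else 0) + c j"])
qed

text \<open>If no term were a combination of its predecessors, the first \<open>Suc (card B)\<close>
  terms would be independent inside \<open>span B\<close>. Solving for the last term is what later
  makes the relations monic.\<close>

lemma finite_dim_sequence_dependent:
  assumes "finite_dim scale V" "\<And>j::nat. v j \<in> V"
  shows "\<exists>J c. v J = (\<Sum>j<J. scale (c j) (v j))"
proof -
  obtain B where B: "finite B" "V = span B" using assms(1) by (auto simp: finite_dim_def)
  have "\<exists>J. v J \<in> span (v ` {..<J})"
  proof (rule ccontr)
    assume "\<not> ?thesis"
    then have neg: "v J \<notin> span (v ` {..<J})" for J by simp
    have ind: "independent (v ` {..<J}) \<and> card (v ` {..<J}) = J" for J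
    proof (induction J)
      case (Suc J)
      have "v J \<notin> v ` {..<J}" using neg[of J] span_base[of "v J"] by metis
      then have "card (v ` {..<Suc J}) = Suc J" using Suc by (simp add: lessThan_Suc)
      moreover have "independent (insert (v J) (v ` {..<J}))"
        using Suc neg by (intro independent_insertI) simp_all
      ultimately show ?case by (simp add: lessThan_Suc)
    qed (simp add: independent_empty)
    have "v ` {..<Suc (card B)} \<subseteq> span B" using assms(2) B by auto
    from independent_span_bound[OF B(1) conjunct1[OF ind] this] conjunct2[OF ind[of "Suc (card B)"]]
    show False by simp
  qed
  then obtain J where "v J \<in> span (v ` {..<J})" ..
  from span_image_finiteD[OF finite_lessThan this] show ?thesis by blast
qed

lemma finite_dim_annihilator:
  assumes "finite_dim scale V" "\<And>v. v \<in> V \<Longrightarrow> T v \<in> V" "v \<in> V"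
  shows "\<exists>H. lead_coeff H = 1 \<and> opoly scale H T v = 0"
proof -
  have "(T ^^ j) v \<in> V" for j by (induction j) (use assms in auto)
  from finite_dim_sequence_dependent[OF assms(1), of "\<lambda>j. (T ^^ j) v", OF this]
  obtain J c where c: "(T ^^ J) v = (\<Sum>j<J. scale (c j) ((T ^^ j) v))" by blast
  define H where "H = Polynomial.monom 1 J - (\<Sum>j<J. Polynomial.monom (c j) j)"
  have H: "coeff H i = (if i = J then 1 else if i < J then - c i else 0)" for i
    by (auto simp: H_def coeff_sum)
  have deg: "degree H = J"
    by (rule antisym) (auto intro!: degree_le le_degree simp: H)
  have "opoly scale H T v = (T ^^ J) v + (\<Sum>j<J. scale (- c j) ((T ^^ j) v))"
    unfolding opoly_def deg lessThan_Suc_atMost[symmetric] by (simp add: H)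
  also have "\<dots> = 0" by (simp add: c sum_negf)
  finally have "opoly scale H T v = 0" .
  moreover have "lead_coeff H = 1" using deg H[of J] by simp
  ultimately show ?thesis by blast
qed

end

section \<open>Additive polynomials in prime characteristic\<close>

text \<open>Such polynomials are known as p-polynomials or linearised polynomials. In prime
  characteristic 0 is not a power of p, so there is no constant term.\<close>

definition additive_poly :: "'f::field poly \<Rightarrow> bool" where
  "additive_poly P \<longleftrightarrow> (\<forall>k. coeff P k \<noteq> 0 \<longrightarrow> (\<exists>j. k = CHAR('f) ^ j))"

text \<open>Since k times the binomial coefficient is a multiple of p^j, a binomial coefficient
  prime to p would force p^j to divide \<open>k\<close>.\<close>

lemma of_nat_choose_prime_power_char:
  assumes "Factorial_Ring.prime CHAR('f::field)" "0 < k" "k < CHAR('f) ^ j"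
  shows "of_nat (CHAR('f) ^ j choose k) = (0 :: 'f)"
proof (rule ccontr)
  let ?p = "CHAR('f)"
  assume "of_nat (?p ^ j choose k) \<noteq> (0 :: 'f)"
  then have "coprime (?p ^ j) (?p ^ j choose k)"
    using assms(1) by (simp add: of_nat_eq_0_iff_char_dvd prime_imp_coprime)
  moreover have "k * (?p ^ j choose k) = ?p ^ j * (?p ^ j - 1 choose (k - 1))"
    using times_binomial_minus1_eq[OF assms(2)] by auto
  then have "?p ^ j dvd k * (?p ^ j choose k)" by simp
  ultimately have "?p ^ j dvd k" by (simp add: coprime_dvd_mult_left_iff)
  then show False using assms(2,3) by (auto dest: dvd_imp_le)
qed

text \<open>Brings additivity into the form in which it is used, one coefficient at a time; the case
  \<open>i = 0\<close> shows that the constant term vanishes.\<close>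

lemma additive_poly_cases:
  assumes "additive_poly P" "Factorial_Ring.prime CHAR('f::field)"
  obtains "coeff P i = (0::'f)" | "i > 0" "\<And>k. 0 < k \<Longrightarrow> k < i \<Longrightarrow> of_nat (i choose k) = (0 :: 'f)"
proof (cases "coeff P i = 0")
  case False
  then obtain j where "i = CHAR('f) ^ j" using assms(1) by (auto simp: additive_poly_def)
  then show ?thesis using that(2) of_nat_choose_prime_power_char[OF assms(2)] assms(2)
    by (simp add: prime_gt_0_nat)
qed

context vector_space
begin

lemma sum_choose_additive:
  assumes "i > 0" "\<And>k. 0 < k \<Longrightarrow> k < i \<Longrightarrow> of_nat (i choose k) = (0 :: 'a)"
  shows "(\<Sum>k\<le>i. scale (of_nat (i choose k)) (f k)) = f 0 + f i"
proof -
  have "(\<Sum>k\<le>i. scale (of_nat (i choose k)) (f k)) = (\<Sum>k\<in>{0, i}. scale (of_nat (i choose k)) (f k))"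
    by (rule sum.mono_neutral_right) (use assms in auto)
  then show ?thesis using assms(1) by simp
qed

text \<open>Pascal's rule for vector-valued sums; it serves both the binomial theorem for commuting
  operators and the Leibniz formula in \<open>opoly_act_commute\<close>.\<close>

lemma sum_choose_Suc:
  "(\<Sum>k\<le>Suc n. scale (of_nat (Suc n choose k)) (f k)) =
   (\<Sum>k\<le>n. scale (of_nat (n choose k)) (f k)) + (\<Sum>k\<le>n. scale (of_nat (n choose k)) (f (Suc k)))"
proof -
  have "(\<Sum>k\<le>Suc n. scale (of_nat (Suc n choose k)) (f k))
      = f 0 + (\<Sum>k\<le>n. scale (of_nat (Suc n choose Suc k)) (f (Suc k)))"
    by (subst sum.atMost_Suc_shift) simp
  also have "\<dots> = (f 0 + (\<Sum>k\<le>n. scale (of_nat (n choose Suc k)) (f (Suc k))))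
      + (\<Sum>k\<le>n. scale (of_nat (n choose k)) (f (Suc k)))"
    by (simp add: scale_left_distrib sum.distrib algebra_simps)
  also have "f 0 + (\<Sum>k\<le>n. scale (of_nat (n choose Suc k)) (f (Suc k))) =
     (\<Sum>k\<le>Suc n. scale (of_nat (n choose k)) (f k))"
    by (subst sum.atMost_Suc_shift) simp
  also have "\<dots> = (\<Sum>k\<le>n. scale (of_nat (n choose k)) (f k))"
    by (simp add: binomial_eq_0)
  finally show ?thesis .
qed

lemma funpow_add_binomial:
  assumes A: "Vector_Spaces.linear scale scale A" and B: "Vector_Spaces.linear scale scale B"
    and AB: "\<And>v. A (B v) = B (A v)"
  shows "((\<lambda>v. A v + B v) ^^ n) v = (\<Sum>k\<le>n. scale (of_nat (n choose k)) ((A ^^ k) ((B ^^ (n - k)) v)))"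
proof (induction n)
  case (Suc n)
  have BA: "B ((A ^^ k) w) = (A ^^ k) (B w)" for k w by (induction k) (simp_all add: AB[symmetric])
  have "((\<lambda>v. A v + B v) ^^ Suc n) v =
      (\<Sum>k\<le>n. scale (of_nat (n choose k)) (A ((A ^^ k) ((B ^^ (n - k)) v))))
    + (\<Sum>k\<le>n. scale (of_nat (n choose k)) (B ((A ^^ k) ((B ^^ (n - k)) v))))"
    by (simp add: Suc linearD[OF A] linearD[OF B])
  also have "(\<Sum>k\<le>n. scale (of_nat (n choose k)) (B ((A ^^ k) ((B ^^ (n - k)) v)))) =
     (\<Sum>k\<le>n. scale (of_nat (n choose k)) ((A ^^ k) ((B ^^ (Suc n - k)) v)))"
    by (intro sum.cong refl) (simp add: BA Suc_diff_le)
  finally show ?case unfolding sum_choose_Suc by (simp add: add.commute)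
qed simp

lemma opoly_additive:
  assumes A: "Vector_Spaces.linear scale scale A" and B: "Vector_Spaces.linear scale scale B"
    and AB: "\<And>v. A (B v) = B (A v)"
    and P: "additive_poly P" and p: "Factorial_Ring.prime CHAR('a)"
  shows "opoly scale P (\<lambda>v. A v + B v) v = opoly scale P A v + opoly scale P B v"
proof -
  have "scale (coeff P i) (((\<lambda>v. A v + B v) ^^ i) v) =
     scale (coeff P i) ((A ^^ i) v) + scale (coeff P i) ((B ^^ i) v)" for i
  proof (rule additive_poly_cases[OF P p, of i])
    assume i: "i > 0" "\<And>k. 0 < k \<Longrightarrow> k < i \<Longrightarrow> of_nat (i choose k) = (0 :: 'a)"
    show ?thesis
      using sum_choose_additive[OF i, of "\<lambda>k. (A ^^ k) ((B ^^ (i - k)) v)"]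
      by (simp add: funpow_add_binomial[OF A B AB] scale_right_distrib add.commute)
  qed simp
  then show ?thesis by (simp add: opoly_def sum.distrib)
qed

end

definition pointwise :: "('f \<Rightarrow> 'm \<Rightarrow> 'm) \<Rightarrow> 'f \<Rightarrow> ('x \<Rightarrow> 'm) \<Rightarrow> 'x \<Rightarrow> 'm" where
  "pointwise s c f = (\<lambda>x. s c (f x))"

lemma pointwise_apply: "pointwise s a f x = s a (f x)"
  by (simp add: pointwise_def)

lemma vector_space_pointwise:
  assumes "vector_space s"
  shows "vector_space (pointwise s)"
proof -
  interpret vector_space s by fact
  show ?thesis by unfold_locales (simp_all add: pointwise_def fun_eq_iff scale_right_distrib scale_left_distrib)
qed

section \<open>The Chevalley--Eilenberg complex\<close>

text \<open>This rule and the next three split off the first argument, so that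
  \<open>ce_diff\<close> can be compared with a recursion over the argument list.\<close>

lemma nths_Cons_compl_0: "nths (x # xs) (- {0}) = xs"
proof -
  have "{j. Suc j \<in> - {0}} = (UNIV :: nat set)" by auto
  then show ?thesis by (simp add: nths_Cons nths_all)
qed

lemma nths_Cons_compl_Suc: "nths (x # xs) (- {Suc i}) = x # nths xs (- {i})"
proof -
  have "{j. Suc j \<in> - {Suc i}} = - {i}" by auto
  then show ?thesis by (simp add: nths_Cons)
qed

lemma nths_Cons_compl_0_Suc: "nths (x # xs) (- {0, Suc j}) = nths xs (- {j})"
proof -
  have "{k. Suc k \<in> - {0, Suc j}} = - {j}" by auto
  then show ?thesis by (simp add: nths_Cons)
qed

lemma nths_Cons_compl_Suc_Suc: "nths (x # xs) (- {Suc i, Suc j}) = x # nths xs (- {i, j})"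
proof -
  have "{k. Suc k \<in> - {Suc i, Suc j}} = - {i, j}" by auto
  then show ?thesis by (simp add: nths_Cons)
qed

text \<open>The interior product with \<open>x\<close>. Identities between cochains are proved by
  contracting with an arbitrary vector and inducting on the degree, which avoids most work with
  argument positions.\<close>

definition contract :: "'a \<Rightarrow> ('a list \<Rightarrow> 'm) \<Rightarrow> 'a list \<Rightarrow> 'm" where
  "contract x c = (\<lambda>xs. c (x # xs))"

lemma contract_simps [simp]:
  "contract x 0 = 0" "contract x (c + d) = contract x c + contract x d"
  "contract x (- e) = - contract x e"
  "contract x (e - f) = contract x e - contract x f"
  for c d :: "'a list \<Rightarrow> 'm::monoid_add" and e f :: "'a list \<Rightarrow> 'n::ab_group_add"
  by (simp_all add: contract_def fun_eq_iff)

lemma contract_pointwise [simp]: "contract x (pointwise s a c) = pointwise s a (contract x c)"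
  by (simp add: contract_def pointwise_def)

lemma sum_apply: "(\<Sum>i\<in>I. f i) x = (\<Sum>i\<in>I. f i x)"
  by (induction I rule: infinite_finite_induct) simp_all

lemma list_fun_eqI: "c [] = d [] \<Longrightarrow> (\<And>x. contract x c = contract x d) \<Longrightarrow> c = d"
  unfolding contract_def fun_eq_iff by (metis list.exhaust)

context lie_algebra
begin

lemmas bracket_simps = linear_addD[OF linear_left] linear_addD[OF linear_right]
  linear_scaleD[OF linear_left] linear_scaleD[OF linear_right]
  linear_zeroD[OF linear_left] linear_zeroD[OF linear_right]

lemma bracket_antisym: "bracket x y = - bracket y x"
proof -
  have "bracket (x + y) (x + y) = bracket x y + bracket y x"
    unfolding linear_addD[OF linear_left] linear_addD[OF linear_right] by (simp add: bracket_self)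
  then have "bracket x y + bracket y x = 0" using bracket_self[of "x + y"] by metis
  then show ?thesis by (simp add: eq_neg_iff_add_eq_0)
qed

lemma bracket_bracket: "bracket (bracket x y) z = bracket x (bracket y z) - bracket y (bracket x z)"
proof -
  have "bracket y (bracket z x) = - bracket y (bracket x z)"
    using bracket_antisym[of z x] linear_diffD[OF linear_right, of y 0] by (simp add: bracket_simps)
  then show ?thesis using jacobi[of x y z] bracket_antisym[of z "bracket x y"]
    by (simp add: algebra_simps)
qed

end

text \<open>The coefficients are a subset \<open>M\<close> of an ambient vector space, so that the
  members of a chain of submodules share one action and one differential. The operators are linear
  on the ambient space, while the module laws are required on \<open>M\<close>.\<close>

locale lie_module = lie_algebra scale bracket + M: vector_space scaleM
  for scale :: "'f::field \<Rightarrow> 'a::ab_group_add \<Rightarrow> 'a" and bracket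
    and scaleM :: "'f \<Rightarrow> 'm::ab_group_add \<Rightarrow> 'm" +
  fixes M :: "'m set" and act :: "'a \<Rightarrow> 'm \<Rightarrow> 'm"
  assumes subspace_M: "M.subspace M"
    and act_linear: "Vector_Spaces.linear scaleM scaleM (act x)"
    and act_closed: "f \<in> M \<Longrightarrow> act x f \<in> M"
    and act_add_left: "f \<in> M \<Longrightarrow> act (x + y) f = act x f + act y f"
    and act_scale_left: "f \<in> M \<Longrightarrow> act (scale a x) f = scaleM a (act x f)"
    and act_bracket: "f \<in> M \<Longrightarrow> act (bracket x y) f = act x (act y f) - act y (act x f)"
begin

lemmas act_simps = linear_addD[OF act_linear] linear_diffD[OF act_linear]
  linear_scaleD[OF act_linear] linear_zeroD[OF act_linear]

lemmas M_simps = M.subspace_0[OF subspace_M] M.subspace_add[OF subspace_M]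
  M.subspace_scale[OF subspace_M] M.subspace_diff[OF subspace_M] M.subspace_neg[OF subspace_M]
  M.subspace_sum[OF subspace_M]

sublocale F: vector_space "pointwise scaleM :: 'f \<Rightarrow> ('a list \<Rightarrow> 'm) \<Rightarrow> 'a list \<Rightarrow> 'm"
  by (rule vector_space_pointwise) (rule M.vector_space_axioms)

abbreviation C :: "nat \<Rightarrow> ('a list \<Rightarrow> 'm) set" where
  "C n \<equiv> cochains scale scaleM M n"

section \<open>Inductive description of cochains\<close>

lemma cochains_0: "c \<in> C 0 \<longleftrightarrow> c [] \<in> M \<and> (\<forall>x. contract x c = 0)"
  unfolding cochains_def contract_def fun_eq_iff
  by simp (metis length_0_conv list.exhaust neq_Nil_conv)

text \<open>Together with \<open>cochains_SucI\<close> this turns a cochain of degree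
  \<open>Suc n\<close> into a linear family of cochains of degree \<open>n\<close> in which only two
  equal leading arguments have to be tested.\<close>

lemma cochains_SucD:
  assumes "c \<in> C (Suc n)"
  shows "c [] = 0" "contract x c \<in> C n" "contract (x + y) c = contract x c + contract y c"
    "contract (scale a x) c = pointwise scaleM a (contract x c)" "contract x (contract x c) = 0"
proof -
  have len: "\<And>xs. length xs = Suc n \<Longrightarrow> c xs \<in> M" "\<And>xs. length xs \<noteq> Suc n \<Longrightarrow> c xs = 0"
    and add: "\<And>xs i x y. length xs = Suc n \<Longrightarrow> i < Suc n \<Longrightarrow>
        c (xs[i := x + y]) = c (xs[i := x]) + c (xs[i := y])"
    and scl: "\<And>xs i a x. length xs = Suc n \<Longrightarrow> i < Suc n \<Longrightarrow>
        c (xs[i := scale a x]) = scaleM a (c (xs[i := x]))"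
    and alt: "\<And>xs i j. length xs = Suc n \<Longrightarrow> i < j \<Longrightarrow> j < Suc n \<Longrightarrow> xs ! i = xs ! j \<Longrightarrow> c xs = 0"
    using assms unfolding cochains_def by blast+
  show "c [] = 0" by (simp add: len)
  show "contract x c \<in> C n"
    unfolding cochains_def contract_def mem_Collect_eq
  proof (intro conjI allI impI)
    fix xs :: "'a list" and i y z a assume "length xs = n \<and> i < n"
    then show "c (x # xs[i := y + z]) = c (x # xs[i := y]) + c (x # xs[i := z])"
      "c (x # xs[i := scale a z]) = scaleM a (c (x # xs[i := z]))"
      using add[of "x # xs" "Suc i"] scl[of "x # xs" "Suc i"] by simp_all
  next
    fix xs :: "'a list" and i j assume "length xs = n \<and> i < j \<and> j < n \<and> xs ! i = xs ! j"
    then show "c (x # xs) = 0" using alt[of "x # xs" "Suc i" "Suc j"] by simp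
  qed (use len in auto)
  show "contract (x + y) c = contract x c + contract y c"
  proof
    fix xs show "contract (x + y) c xs = (contract x c + contract y c) xs"
      using add[of "x # xs" 0] len(2) by (cases "length xs = n") (simp_all add: contract_def)
  qed
  show "contract (scale a x) c = pointwise scaleM a (contract x c)"
  proof
    fix xs show "contract (scale a x) c xs = pointwise scaleM a (contract x c) xs"
      using scl[of "x # xs" 0] len(2)
      by (cases "length xs = n") (simp_all add: contract_def pointwise_def)
  qed
  show "contract x (contract x c) = 0"
  proof
    fix xs show "contract x (contract x c) xs = 0 xs"
      using alt[of "x # x # xs" 0 1] len(2)[of "x # x # xs"]
      by (cases "length (x # x # xs) = Suc n") (auto simp: contract_def)
  qed
qed

lemma contract_add_left:
  assumes "c \<in> C n"
  shows "contract (x + y) c = contract x c + contract y c"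
  using assms by (cases n) (simp_all add: cochains_0 cochains_SucD(3))

lemma contract_scale_left:
  assumes "c \<in> C n"
  shows "contract (scale a x) c = pointwise scaleM a (contract x c)"
  using assms by (cases n) (simp_all add: cochains_0 cochains_SucD(4))

lemma contract_zero_left:
  assumes "c \<in> C n"
  shows "contract 0 c = 0"
  using contract_add_left[OF assms, of 0 0] by simp

lemma contract_neg_left:
  assumes "c \<in> C n"
  shows "contract (- x) c = - contract x c"
  using contract_add_left[OF assms, of x "- x"] contract_zero_left[OF assms]
  by (simp add: add_eq_0_iff)

lemma contract_diff_left:
  assumes "c \<in> C n"
  shows "contract (x - y) c = contract x c - contract y c"
  using contract_add_left[OF assms, of x "- y"] contract_neg_left[OF assms] by simp

text \<open>Polarisation of the alternating law. The properties of \<open>c\<close> are separate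
  hypotheses because membership in the cochain space is what \<open>cochains_SucI\<close> is still
  proving when it applies this.\<close>

lemma contract_antisymI:
  assumes add: "\<And>x y. contract (x + y) c = contract x c + contract y c"
    and alt: "\<And>x. contract x (contract x c) = 0" and c: "\<And>x. contract x c \<in> C n"
  shows "contract x (contract y c) = - contract y (contract x c)"
proof -
  have "contract (x + y) (contract (x + y) c) = 0" by (rule alt)
  then have "contract x (contract y c) + contract y (contract x c) = 0"
    by (simp add: add contract_add_left[OF c] alt add.commute)
  then show ?thesis by (simp add: eq_neg_iff_add_eq_0)
qed

lemma cochains_SucI:
  assumes nil: "c [] = 0" and c: "\<And>x. contract x c \<in> C n"
    and add: "\<And>x y. contract (x + y) c = contract x c + contract y c"
    and scl: "\<And>a x. contract (scale a x) c = pointwise scaleM a (contract x c)"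
    and alt: "\<And>x. contract x (contract x c) = 0"
  shows "c \<in> C (Suc n)"
  unfolding cochains_def mem_Collect_eq
proof (intro conjI allI impI)
  fix xs :: "'a list"
  show "c xs \<in> M" if "length xs = Suc n"
    using c[of "hd xs"] that by (cases xs) (auto simp: cochains_def contract_def)
  show "c xs = 0" if "length xs \<noteq> Suc n"
    using c[of "hd xs"] that nil by (cases xs) (auto simp: cochains_def contract_def)
  show "c (xs[i := x + y]) = c (xs[i := x]) + c (xs[i := y])" if len: "length xs = Suc n \<and> i < Suc n" for i x y
  proof -
    obtain z zs where xs: "xs = z # zs" using len by (cases xs) auto
    show ?thesis
      using that c[of z] fun_cong[OF add[of x y], of zs]
      by (cases i) (auto simp: xs cochains_def contract_def)
  qed
  show "c (xs[i := scale a x]) = scaleM a (c (xs[i := x]))" if len: "length xs = Suc n \<and> i < Suc n" for i x a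
  proof -
    obtain z zs where xs: "xs = z # zs" using len by (cases xs) auto
    show ?thesis
      using that c[of z] fun_cong[OF scl[of a x], of zs]
      by (cases i) (auto simp: xs cochains_def contract_def pointwise_def)
  qed
  fix i j assume ij: "length xs = Suc n \<and> i < j \<and> j < Suc n \<and> xs ! i = xs ! j"
  then have "2 \<le> length xs" by linarith
  then obtain x y ys where xs: "xs = x # y # ys"
    by (metis Suc_le_length_iff numeral_2_eq_2)
  have tails: "\<And>z zs i j. length zs = n \<and> i < j \<and> j < n \<and> zs ! i = zs ! j \<Longrightarrow> c (z # zs) = 0"
    using c unfolding cochains_def contract_def by blast
  consider "i > 0" | "i = 0" "j = 1" | "i = 0" "j > 1" using ij by linarith
  then show "c xs = 0"
  proof cases
    case 1
    then obtain i' j' where "i = Suc i'" "j = Suc j'" using ij by (cases i; cases j) auto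
    then show ?thesis using tails[of "y # ys" i' j' x] ij by (simp add: xs)
  next
    case 2
    then have "y = x" using ij by (auto simp: xs)
    then show ?thesis using fun_cong[OF alt[of x], of ys] by (simp add: xs contract_def)
  next
    case 3
    then obtain j' where "j = Suc (Suc j')" using ij by (cases j; cases "j - 1") auto
    \<comment> \<open>The equal pair consists of the head and a later entry. Exchanging the first
      two arguments moves both into the tail, where the law is known.\<close>
    then have "c (y # x # ys) = 0" using tails[of "x # ys" 0 "Suc j'" y] ij 3 by (simp add: xs)
    then show ?thesis
      using fun_cong[OF contract_antisymI[OF add alt c], of y x ys] by (simp add: xs contract_def)
  qed
qed

lemma cochains_antisym:
  assumes "c \<in> C n"
  shows "contract x (contract y c) = - contract y (contract x c)"
proof (cases n)
  case (Suc k)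
  then show ?thesis
    using assms by (intro contract_antisymI[where n = k]) (auto intro: cochains_SucD)
qed (use assms in \<open>simp add: cochains_0\<close>)

lemma subspace_C: "F.subspace (C n)"
proof (induction n)
  case 0
  then show ?case
    by (intro F.subspaceI) (auto simp: cochains_0 M_simps pointwise_apply)
next
  case (Suc n)
  note S = F.subspace_0[OF Suc] F.subspace_add[OF Suc] F.subspace_scale[OF Suc]
  show ?case
  proof (rule F.subspaceI)
    show "0 \<in> C (Suc n)" by (rule cochains_SucI) (simp_all add: S)
    fix c d assume c: "c \<in> C (Suc n)" and d: "d \<in> C (Suc n)"
    show "c + d \<in> C (Suc n)"
      by (rule cochains_SucI)
        (simp_all add: S cochains_SucD[OF c] cochains_SucD[OF d] F.scale_right_distrib)
  next
    fix a c assume c: "c \<in> C (Suc n)"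
    have "pointwise scaleM a (c) [] = 0" using cochains_SucD(1)[OF c] by (simp add: pointwise_def)
    then show "pointwise scaleM a c \<in> C (Suc n)"
      by (intro cochains_SucI)
        (simp_all add: S cochains_SucD(2-)[OF c] F.scale_right_distrib mult.commute)
  qed
qed

lemmas C_simps = F.subspace_0[OF subspace_C] F.subspace_add[OF subspace_C]
  F.subspace_scale[OF subspace_C] F.subspace_diff[OF subspace_C] F.subspace_neg[OF subspace_C]

text \<open>In degree 0 the truncated difference \<open>0 - 1 = 0\<close> is harmless: the
  contraction is then the zero cochain.\<close>

lemma contract_closed:
  assumes "c \<in> C n"
  shows "contract x c \<in> C (n - 1)"
  using assms by (cases n) (simp_all add: cochains_0 cochains_SucD C_simps M_simps)

end

section \<open>Lie derivatives and Cartan's formula\<close>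

text \<open>The extension of \<open>T\<close> to a derivation: \<open>T\<close> is applied to one
  argument at a time and the results are added.\<close>

fun slot_sum :: "('a \<Rightarrow> 'a) \<Rightarrow> ('a list \<Rightarrow> 'm::ab_group_add) \<Rightarrow> 'a list \<Rightarrow> 'm" where
  "slot_sum T c [] = 0"
| "slot_sum T c (y # ys) = c (T y # ys) + slot_sum T (contract y c) ys"

lemma contract_slot_sum: "contract y (slot_sum T c) = contract (T y) c + slot_sum T (contract y c)"
  by (simp add: contract_def fun_eq_iff)

lemma slot_sum_add: "slot_sum T (c + d) = slot_sum T c + slot_sum T d"
proof
  fix xs show "slot_sum T (c + d) xs = (slot_sum T c + slot_sum T d) xs"
    by (induction xs arbitrary: c d) (simp_all add: algebra_simps)
qed

context lie_module
begin

lemma slot_sum_linear: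
  "Vector_Spaces.linear (pointwise scaleM) (pointwise scaleM) (slot_sum T :: ('a list \<Rightarrow> 'm) \<Rightarrow> _)"
proof (rule F.linearI'[OF slot_sum_add])
  fix a and c :: "'a list \<Rightarrow> 'm"
  have "slot_sum T (pointwise scaleM a c) xs = scaleM a (slot_sum T c xs)" for xs
    by (induction xs arbitrary: c)
      (simp_all add: M.scale_right_distrib, simp add: pointwise_def)
  then show "slot_sum T (pointwise scaleM a c) = pointwise scaleM a (slot_sum T c)"
    by (simp add: fun_eq_iff pointwise_apply)
qed

definition post :: "'a \<Rightarrow> ('a list \<Rightarrow> 'm) \<Rightarrow> 'a list \<Rightarrow> 'm" where
  "post x c = (\<lambda>xs. act x (c xs))"

lemma post_linear: "Vector_Spaces.linear (pointwise scaleM) (pointwise scaleM) (post x)"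
  by (rule F.linearI') (simp_all add: post_def pointwise_def fun_eq_iff act_simps)

lemma contract_post: "contract y (post x c) = post x (contract y c)"
  by (simp add: contract_def post_def)

definition lie_deriv :: "'a \<Rightarrow> ('a list \<Rightarrow> 'm) \<Rightarrow> 'a list \<Rightarrow> 'm" where
  "lie_deriv x c = post x c - slot_sum (bracket x) c"

lemma lie_deriv_linear: "Vector_Spaces.linear (pointwise scaleM) (pointwise scaleM) (lie_deriv x)"
  by (rule F.linearI')
    (simp_all add: lie_deriv_def linearD[OF post_linear] linearD[OF slot_sum_linear]
      F.scale_right_diff_distrib)

lemmas lie_deriv_simps = linear_addD[OF lie_deriv_linear] linear_diffD[OF lie_deriv_linear]
  linear_scaleD[OF lie_deriv_linear] linear_zeroD[OF lie_deriv_linear]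

text \<open>The Cartan relation [L_x, \<iota>_y] = \<iota>_[x,y]. It holds for every function on
  lists and drives the inductions below.\<close>

lemma contract_lie_deriv:
  "contract y (lie_deriv x c) = lie_deriv x (contract y c) - contract (bracket x y) c"
  by (simp add: lie_deriv_def contract_post contract_slot_sum)

lemma lie_deriv_Nil: "lie_deriv x c [] = act x (c [])"
  by (simp add: lie_deriv_def post_def)

lemma lie_deriv_closed: "c \<in> C n \<Longrightarrow> lie_deriv x c \<in> C n"
proof (induction n arbitrary: c)
  case 0
  then show ?case
    by (simp add: cochains_0 lie_deriv_Nil act_closed contract_lie_deriv lie_deriv_simps)
next
  case (Suc n)
  note c = cochains_SucD[OF Suc.prems]
  \<comment> \<open>Contracting twice with \<open>y\<close> leaves two mixed terms, which cancel by
    this antisymmetry.\<close>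
  have "contract y (contract (bracket x y) c) = - contract (bracket x y) (contract y c)" for y
    by (rule cochains_antisym[OF Suc.prems])
  then show ?case
    by (intro cochains_SucI)
      (simp_all add: lie_deriv_Nil contract_lie_deriv lie_deriv_simps c act_simps Suc.IH C_simps
        bracket_simps F.scale_right_diff_distrib)
qed

lemma lie_deriv_add_left:
  "c \<in> C n \<Longrightarrow> lie_deriv (x + y) c = lie_deriv x c + lie_deriv y c"
proof (induction n arbitrary: c)
  case 0
  show "lie_deriv (x + y) c = lie_deriv x c + lie_deriv y c"
    by (rule list_fun_eqI)
      (use 0 in \<open>simp_all add: cochains_0 lie_deriv_Nil contract_lie_deriv lie_deriv_simps act_add_left\<close>)
next
  case (Suc n)
  have IH: "lie_deriv (x + y) (contract z c) = lie_deriv x (contract z c) + lie_deriv y (contract z c)" for z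
    by (rule Suc.IH) (rule cochains_SucD(2)[OF Suc.prems])
  show "lie_deriv (x + y) c = lie_deriv x c + lie_deriv y c"
    by (rule list_fun_eqI)
      (simp_all add: lie_deriv_Nil contract_lie_deriv cochains_SucD[OF Suc.prems] act_simps
        IH bracket_simps)
qed

lemma lie_deriv_scale_left:
  "c \<in> C n \<Longrightarrow> lie_deriv (scale a x) c = pointwise scaleM a (lie_deriv x c)"
proof (induction n arbitrary: c)
  case 0
  show "lie_deriv (scale a x) c = pointwise scaleM a (lie_deriv x c)"
    by (rule list_fun_eqI) (use 0 in \<open>simp_all add: cochains_0 lie_deriv_Nil contract_lie_deriv lie_deriv_simps act_scale_left
        pointwise_apply\<close>)
next
  case (Suc n)
  have IH: "lie_deriv (scale a x) (contract z c) = pointwise scaleM a (lie_deriv x (contract z c))" for z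
    by (rule Suc.IH) (rule cochains_SucD(2)[OF Suc.prems])
  show "lie_deriv (scale a x) c = pointwise scaleM a (lie_deriv x c)"
    by (rule list_fun_eqI)
      (simp_all add: lie_deriv_Nil contract_lie_deriv cochains_SucD[OF Suc.prems] act_simps
        IH bracket_simps F.scale_right_diff_distrib pointwise_apply)
qed

text \<open>After contraction with \<open>z\<close> the terms that mix a Lie derivative with a
  contraction cancel; the rest is the induction hypothesis for \<open>contract z c\<close> and an
  instance of \<open>bracket_bracket\<close>.\<close>

lemma lie_deriv_bracket:
  "c \<in> C n \<Longrightarrow>
   lie_deriv (bracket x y) c = lie_deriv x (lie_deriv y c) - lie_deriv y (lie_deriv x c)"
proof (induction n arbitrary: c)
  case 0
  show "lie_deriv (bracket x y) c = lie_deriv x (lie_deriv y c) - lie_deriv y (lie_deriv x c)"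
    by (rule list_fun_eqI) (use 0 in \<open>simp_all add: cochains_0 lie_deriv_Nil contract_lie_deriv lie_deriv_simps act_bracket\<close>)
next
  case (Suc n)
  have IH: "lie_deriv (bracket x y) (contract z c) = lie_deriv x (lie_deriv y (contract z c)) - lie_deriv y (lie_deriv x (contract z c))" for z
    by (rule Suc.IH) (rule cochains_SucD(2)[OF Suc.prems])
  show "lie_deriv (bracket x y) c = lie_deriv x (lie_deriv y c) - lie_deriv y (lie_deriv x c)"
  proof (rule list_fun_eqI)
    show "lie_deriv (bracket x y) c [] = (lie_deriv x (lie_deriv y c) - lie_deriv y (lie_deriv x c)) []"
      by (simp add: lie_deriv_Nil cochains_SucD[OF Suc.prems] act_simps)
    fix z
    show "contract z (lie_deriv (bracket x y) c) =
      contract z (lie_deriv x (lie_deriv y c) - lie_deriv y (lie_deriv x c))"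
      by (simp add: contract_lie_deriv lie_deriv_simps IH
          bracket_bracket contract_diff_left[OF Suc.prems])
  qed
qed

text \<open>
  Cartan's formula, read as a recursion for the differential. It agrees with \<^const>\<open>ce_diff\<close> on
  cochains, but spares all computations with omitted positions.
\<close>

fun dd :: "('a list \<Rightarrow> 'm) \<Rightarrow> 'a list \<Rightarrow> 'm" where
  "dd c [] = 0"
| "dd c (x # xs) = lie_deriv x c xs - dd (contract x c) xs"

lemma contract_dd: "contract x (dd c) = lie_deriv x c - dd (contract x c)"
  by (simp add: contract_def[of x "dd c"] fun_eq_iff)

lemma dd_linear: "Vector_Spaces.linear (pointwise scaleM) (pointwise scaleM) dd"
proof (rule F.linearI')
  fix c d :: "'a list \<Rightarrow> 'm" and a
  have "dd (c + d) xs = dd c xs + dd d xs" for xs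
    by (induction xs arbitrary: c d) (simp_all add: lie_deriv_simps)
  then show "dd (c + d) = dd c + dd d" by (simp add: fun_eq_iff)
  have "dd (pointwise scaleM a c) xs = scaleM a (dd c xs)" for xs
    by (induction xs arbitrary: c)
     (simp_all add: lie_deriv_simps M.scale_right_diff_distrib, simp add: pointwise_def)
  then show "dd (pointwise scaleM a c) = pointwise scaleM a (dd c)"
    by (simp add: fun_eq_iff pointwise_apply)
qed

lemmas dd_simps = linear_addD[OF dd_linear] linear_diffD[OF dd_linear]
  linear_scaleD[OF dd_linear] linear_zeroD[OF dd_linear]

lemma dd_closed: "c \<in> C n \<Longrightarrow> dd c \<in> C (Suc n)"
proof (induction n arbitrary: c)
  case (0 c)
  then have c: "contract x c = 0" for x by (simp add: cochains_0)
  have "contract x (dd c) = lie_deriv x c" for x by (simp add: contract_dd c dd_simps)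
  then show ?case
    by (intro cochains_SucI)
      (use 0 in \<open>simp_all add: c contract_lie_deriv lie_deriv_simps lie_deriv_closed
        lie_deriv_add_left lie_deriv_scale_left\<close>)
next
  case (Suc n)
  note c = cochains_SucD[OF Suc.prems]
  show ?case
  proof (rule cochains_SucI)
    fix x y a
    show "contract x (dd c) \<in> C (Suc n)"
      using Suc c by (simp add: contract_dd C_simps lie_deriv_closed)
    show "contract (x + y) (dd c) = contract x (dd c) + contract y (dd c)"
      "contract (scale a x) (dd c) = pointwise scaleM a (contract x (dd c))"
      using Suc.prems by (simp_all add: contract_dd lie_deriv_add_left lie_deriv_scale_left c dd_simps
          F.scale_right_diff_distrib)
    \<comment> \<open>The two Lie derivatives of \<open>contract x c\<close> cancel, leaving a
      contraction with \<open>bracket x x\<close> and a doubled contraction.\<close>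
    show "contract x (contract x (dd c)) = 0"
      by (simp add: contract_dd contract_lie_deriv bracket_self contract_zero_left[OF Suc.prems] c
          dd_simps)
  qed simp
qed

text \<open>Contracted with \<open>y\<close>, the two sides differ by the failure of L_[x,y] =
  [L_x, L_y], which is zero, and by the failure of the claim for
  \<open>contract y c\<close>.\<close>

lemma dd_lie_deriv: "c \<in> C n \<Longrightarrow> dd (lie_deriv x c) = lie_deriv x (dd c)"
proof (induction n arbitrary: c)
  case 0
  then have c: "contract y c = 0" for y by (simp add: cochains_0)
  show ?case
    by (rule list_fun_eqI) (simp_all add: lie_deriv_Nil act_simps contract_dd contract_lie_deriv lie_deriv_simps
        lie_deriv_bracket[OF 0] c dd_simps)
next
  case (Suc n)
  note c = cochains_SucD[OF Suc.prems]
  show ?case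
    by (rule list_fun_eqI) (simp_all add: lie_deriv_Nil act_simps contract_dd contract_lie_deriv lie_deriv_simps
        lie_deriv_bracket[OF Suc.prems] Suc.IH[OF c(2)] dd_simps)
qed

text \<open>Contraction with \<open>z\<close> leaves the commutator of \<open>dd\<close> with
  \<open>lie_deriv z\<close>, applied to \<open>c\<close>, and the claim for
  \<open>contract z c\<close>.\<close>

lemma dd_dd: "c \<in> C n \<Longrightarrow> dd (dd c) = 0"
proof (induction n arbitrary: c)
  case 0
  then have c: "contract y c = 0" for y by (simp add: cochains_0)
  show "dd (dd c) = 0"
    by (rule list_fun_eqI) (simp_all add: contract_dd dd_simps dd_lie_deriv[OF 0] c)
next
  case (Suc n)
  have IH: "dd (dd (contract z c)) = 0" for z
    by (rule Suc.IH) (rule cochains_SucD(2)[OF Suc.prems])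
  show "dd (dd c) = 0"
    by (rule list_fun_eqI) (simp_all add: contract_dd dd_simps dd_lie_deriv[OF Suc.prems]
        IH)
qed

text \<open>Moving \<open>T (xs ! j)\<close> from the front to its own slot takes \<open>j\<close>
  transpositions, which absorb the sign.\<close>

lemma slot_sum_alternating:
  "c \<in> C n \<Longrightarrow>
   (\<Sum>j<length xs. scaleM ((-1) ^ j) (c (T (xs ! j) # nths xs (- {j})))) = slot_sum T c xs"
proof (induction xs arbitrary: c n)
  case (Cons y ys)
  have "c (T z # y # zs) = - contract y c (T z # zs)" for z zs
    using fun_cong[OF cochains_antisym[OF Cons.prems, of "T z" y], of zs] by (simp add: contract_def)
  then have "(\<Sum>j<length ys. scaleM ((-1) ^ Suc j) (c (T (ys ! j) # y # nths ys (- {j}))))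
      = (\<Sum>j<length ys. scaleM ((-1) ^ j) (contract y c (T (ys ! j) # nths ys (- {j}))))"
    by simp
  also have "\<dots> = slot_sum T (contract y c) ys"
    by (rule Cons.IH) (rule contract_closed[OF Cons.prems])
  finally show ?case
    by (simp add: sum.lessThan_Suc_shift nths_Cons_compl_0 nths_Cons_compl_Suc del: sum.lessThan_Suc)
qed simp

lemma ce_diff_eq_dd: "c \<in> C n \<Longrightarrow> ce_diff bracket scaleM act c = dd c"
proof -
  have "ce_diff bracket scaleM act c xs = dd c xs" if "c \<in> C n" for xs
    using that
  proof (induction xs arbitrary: c n)
    case (Cons x xs)
    have swap: "c (z # x # zs) = - contract x c (z # zs)" for z zs
      using fun_cong[OF cochains_antisym[OF Cons.prems, of z x], of zs] by (simp add: contract_def)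
    \<comment> \<open>The terms are sorted by the role of \<open>x\<close>: it acts, enters the
      bracket, or stays an argument. Where it stays behind a bracket, it stands second, and
      \<open>swap\<close> brings it to the front at the cost of a sign.\<close>
    have "ce_diff bracket scaleM act c (x # xs) =
      (act x (c xs) +
        (\<Sum>i<length xs. scaleM ((-1) ^ Suc i) (act (xs ! i) (contract x c (nths xs (- {i})))))) +
      ((\<Sum>j<length xs. scaleM ((-1) ^ Suc j) (c (bracket x (xs ! j) # nths xs (- {j})))) +
       (\<Sum>j<length xs. \<Sum>i<j. scaleM ((-1) ^ Suc (i + j))
          (contract x c (bracket (xs ! i) (xs ! j) # nths xs (- {i, j})))))"
      by (simp add: ce_diff_def sum.lessThan_Suc_shift nths_Cons_compl_0 nths_Cons_compl_Suc
          nths_Cons_compl_0_Suc nths_Cons_compl_Suc_Suc contract_def sum.distrib sum_subtractf sum_negf swap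
          del: sum.lessThan_Suc)
    also have "\<dots> = (act x (c xs) -
        (\<Sum>j<length xs. scaleM ((-1) ^ j) (c (bracket x (xs ! j) # nths xs (- {j}))))) -
        ce_diff bracket scaleM act (contract x c) xs"
      by (simp add: ce_diff_def sum_negf)
    also have "\<dots> = dd c (x # xs)"
      using slot_sum_alternating[OF Cons.prems, of "bracket x" xs]
        Cons.IH[OF contract_closed[OF Cons.prems, of x]]
      by (simp add: lie_deriv_def post_def)
    finally show ?case .
  qed (simp add: ce_diff_def)
  then show "c \<in> C n \<Longrightarrow> ce_diff bracket scaleM act c = dd c" by auto
qed

text \<open>Multilinearity reduces the claim to arguments from the spanning set \<open>B\<close>; a
  list longer than \<open>card B\<close> then repeats an entry.\<close>

lemma cochains_eq_0I:
  assumes "finite B" "span B = UNIV" "card B < n" "c \<in> C n"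
  shows "c = 0"
proof -
  have *: "c = 0" if "c \<in> C k" "\<And>bs. set bs \<subseteq> B \<Longrightarrow> c bs = 0" for c k
    using that
  proof (induction k arbitrary: c)
    case 0
    then have "c [] = 0" "\<And>x. contract x c = 0" by (auto simp: cochains_0)
    then show "c = 0" by - (rule list_fun_eqI[of c 0]; simp)
  next
    case (Suc k)
    note c = cochains_SucD[OF Suc.prems(1)]
    have zero_on_B: "contract x c = 0" if "x \<in> B" for x
    proof (rule Suc.IH[OF c(2)])
      show "contract x c bs = 0" if "set bs \<subseteq> B" for bs
        using Suc.prems(2)[of "x # bs"] \<open>x \<in> B\<close> that by (simp add: contract_def)
    qed
    have "contract x c = 0" if "x \<in> span B" for x
      using that by (induction rule: span_induct_alt)
        (simp_all add: c zero_on_B contract_zero_left[OF Suc.prems(1)])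
    then have "contract x c = 0" for x using assms(2) by simp
    then show "c = 0" by - (rule list_fun_eqI[of c 0]; simp add: c(1))
  qed
  show ?thesis
  proof (rule *[OF assms(4)])
    fix bs assume bs: "set bs \<subseteq> B"
    show "c bs = 0"
    proof (cases "length bs = n")
      case True
      then have "\<not> distinct bs"
        using bs assms(1,3) card_mono[OF assms(1) bs] distinct_card[of bs] by auto
      then obtain i j where "i < j" "j < length bs" "bs ! i = bs ! j"
        by (metis distinct_conv_nth linorder_neqE_nat)
      then show ?thesis using assms(4) True unfolding cochains_def by blast
    qed (use assms(4) in \<open>simp add: cochains_def\<close>)
  qed
qed

section \<open>Additive polynomials annihilating the adjoint action\<close>

text \<open>The derivation is the sum of commuting operators \<open>A\<close> and \<open>B\<close>,
  acting in the first slot and in the others. Additivity separates them: \<open>P\<close> of the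
  first puts P(ad x) y = 0 into the first slot, and \<open>P\<close> of the second is the claim for
  the contraction, one degree lower.\<close>

lemma slot_sum_opoly_eq_0:
  assumes P: "additive_poly P" "Factorial_Ring.prime CHAR('f)"
    and ad: "\<And>y. opoly scale P (bracket x) y = 0" and c: "c \<in> C n"
  shows "opoly (pointwise scaleM) P (slot_sum (bracket x)) c = 0"
proof -
  let ?D = "slot_sum (bracket x) :: ('a list \<Rightarrow> 'm) \<Rightarrow> _"
  define A :: "('a list \<Rightarrow> 'm) \<Rightarrow> 'a list \<Rightarrow> 'm"
    where "A c xs = (case xs of [] \<Rightarrow> 0 | y # ys \<Rightarrow> c (bracket x y # ys))" for c xs
  define B :: "('a list \<Rightarrow> 'm) \<Rightarrow> 'a list \<Rightarrow> 'm"
    where "B c xs = (case xs of [] \<Rightarrow> 0 | y # ys \<Rightarrow> ?D (contract y c) ys)" for c xs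
  have A: "Vector_Spaces.linear (pointwise scaleM) (pointwise scaleM) A"
    by (rule F.linearI') (auto simp: A_def fun_eq_iff pointwise_apply split: list.splits)
  have B: "Vector_Spaces.linear (pointwise scaleM) (pointwise scaleM) B"
    by (rule F.linearI')
      (auto simp: B_def fun_eq_iff pointwise_apply slot_sum_add linear_scaleD[OF slot_sum_linear]
        split: list.splits)
  have cA: "contract y (A c) = contract (bracket x y) c" and cB: "contract y (B c) = ?D (contract y c)"
    for y c by (simp_all add: A_def B_def contract_def)
  have sum: "?D = (\<lambda>c. A c + B c)"
  proof
    show "?D c = A c + B c" for c
      by (rule list_fun_eqI) (simp_all add: contract_slot_sum cA cB, simp add: A_def B_def)
  qed
  have comm: "A (B c) = B (A c)" for c
    by (rule list_fun_eqI) (simp_all add: cA cB, simp add: A_def B_def)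
  have contract_lin: "Vector_Spaces.linear (pointwise scaleM) (pointwise scaleM)
      (contract y :: ('a list \<Rightarrow> 'm) \<Rightarrow> _)" for y by (rule F.linearI') simp_all
  \<comment> \<open>The derivation is zero at the empty list, so only a constant term of
    \<open>P\<close> could contribute there.\<close>
  have nil: "opoly (pointwise scaleM) P ?D c [] = 0" for c
  proof -
    have "scaleM (coeff P i) ((?D ^^ i) c []) = 0" for i
      by (rule additive_poly_cases[OF P, of i]) (auto simp: gr0_conv_Suc)
    then show ?thesis by (simp add: opoly_def sum_apply pointwise_apply del: M.scale_eq_0_iff)
  qed
  have step: "contract y (opoly (pointwise scaleM) P ?D c) = opoly (pointwise scaleM) P ?D (contract y c)"
    if c: "c \<in> C n" for y c n
  proof -
    have lin: "Vector_Spaces.linear scale (pointwise scaleM) (\<lambda>z. contract z c)"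
      by (simp add: Vector_Spaces.linear_iff vector_space_axioms F.vector_space_axioms
          contract_add_left[OF c] contract_scale_left[OF c])
    have iter: "contract y ((A ^^ i) c) = contract ((bracket x ^^ i) y) c" for i
      by (induction i arbitrary: y) (simp_all add: cA funpow_swap1[of "bracket x"])
    have "contract y (opoly (pointwise scaleM) P A c) = contract (opoly scale P (bracket x) y) c"
      by (simp add: opoly_def linear_sumD[OF contract_lin] linear_scaleD[OF contract_lin] iter
          linear_sumD[OF lin] linear_scaleD[OF lin])
    also have "\<dots> = 0" by (simp add: ad contract_zero_left[OF c])
    finally have "contract y (opoly (pointwise scaleM) P A c) = 0" .
    moreover have "contract y (opoly (pointwise scaleM) P B c) =
      opoly (pointwise scaleM) P ?D (contract y c)"
      by (rule opoly_intertwine[OF contract_lin, where V = UNIV]) (simp_all add: cB)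
    ultimately show ?thesis
      unfolding sum F.opoly_additive[OF A B comm P] by (simp add: sum[symmetric])
  qed
  show ?thesis using c
  proof (induction n arbitrary: c)
    case 0
    then have "contract y c = 0" for y by (simp add: cochains_0)
    then show "opoly (pointwise scaleM) P ?D c = 0"
      using linear_zeroD[OF F.opoly_linear[OF slot_sum_linear]] nil step[OF 0]
      by - (rule list_fun_eqI[of _ 0]; simp)
  next
    case (Suc n)
    have "contract y (opoly (pointwise scaleM) P ?D c) = 0" for y
      unfolding step[OF Suc.prems] by (rule Suc.IH) (rule cochains_SucD(2)[OF Suc.prems])
    then show "opoly (pointwise scaleM) P ?D c = 0"
      using nil by - (rule list_fun_eqI[of _ 0]; simp)
  qed
qed

text \<open>The operator on the values is the sum of the Lie derivative and the induced derivation,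
  which commute; \<open>slot_sum_opoly_eq_0\<close> removes the second summand.\<close>

lemma opoly_lie_deriv:
  assumes P: "additive_poly P" "Factorial_Ring.prime CHAR('f)"
    and ad: "\<And>y. opoly scale P (bracket x) y = 0" and c: "c \<in> C n"
  shows "opoly (pointwise scaleM) P (lie_deriv x) c xs = opoly scaleM P (act x) (c xs)"
proof -
  have comm: "post x (slot_sum T c) = slot_sum T (post x c)" for c T
  proof
    fix xs show "post x (slot_sum T c) xs = slot_sum T (post x c) xs"
      by (induction xs arbitrary: c) (simp_all add: contract_post, simp_all add: post_def act_simps)
  qed
  have comm': "lie_deriv x (slot_sum (bracket x) c) = slot_sum (bracket x) (lie_deriv x c)" for c
    by (simp add: lie_deriv_def comm linearD[OF slot_sum_linear])
  have "post x = (\<lambda>c. lie_deriv x c + slot_sum (bracket x) c)"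
    by (simp add: lie_deriv_def)
  then have "opoly (pointwise scaleM) P (post x) c = opoly (pointwise scaleM) P (lie_deriv x) c"
    using F.opoly_additive[OF lie_deriv_linear slot_sum_linear comm' P]
      slot_sum_opoly_eq_0[OF P ad c] by simp
  moreover have "opoly (pointwise scaleM) P (post x) c xs = opoly scaleM P (act x) (c xs)"
  proof -
    have "Vector_Spaces.linear (pointwise scaleM) scaleM (\<lambda>c :: 'a list \<Rightarrow> 'm. c xs)"
      by (simp add: Vector_Spaces.linear_iff M.vector_space_axioms F.vector_space_axioms
          pointwise_apply)
    from opoly_intertwine[OF this, where V = UNIV and T = "post x" and T' = "act x"]
    show ?thesis by (simp add: post_def)
  qed
  ultimately show ?thesis by simp
qed

text \<open>In the Leibniz formula \<open>binom\<close> only the terms \<open>k = 0\<close> and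
  \<open>k = n\<close> survive at the indices that occur in \<open>P\<close>. Hence P(x) y - y P(x)
  acts as the vector P(ad x) y, which is zero.\<close>

lemma opoly_act_commute:
  assumes P: "additive_poly P" "Factorial_Ring.prime CHAR('f)"
    and ad: "\<And>y. opoly scale P (bracket x) y = 0" and f: "f \<in> M"
  shows "opoly scaleM P (act x) (act y f) = act y (opoly scaleM P (act x) f)"
proof -
  have cl: "(act x ^^ i) f \<in> M" for i by (induction i) (use f act_closed in auto)
  have binom: "(act x ^^ n) (act y f) =
     (\<Sum>k\<le>n. scaleM (of_nat (n choose k)) (act ((bracket x ^^ k) y) ((act x ^^ (n - k)) f)))" for n
  proof (induction n)
    case (Suc n)
    have *: "act x (act z g) = act (bracket x z) g + act z (act x g)" if "g \<in> M" for z g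
      using act_bracket[OF that] by simp
    have "(act x ^^ Suc n) (act y f) =
        (\<Sum>k\<le>n. scaleM (of_nat (n choose k)) (act ((bracket x ^^ Suc k) y) ((act x ^^ (n - k)) f)))
      + (\<Sum>k\<le>n. scaleM (of_nat (n choose k)) (act ((bracket x ^^ k) y) (act x ((act x ^^ (n - k)) f))))"
      by (simp add: Suc linearD[OF act_linear] *[OF cl] M.scale_right_distrib sum.distrib)
    also have "(\<Sum>k\<le>n. scaleM (of_nat (n choose k)) (act ((bracket x ^^ k) y) (act x ((act x ^^ (n - k)) f))))
      = (\<Sum>k\<le>n. scaleM (of_nat (n choose k)) (act ((bracket x ^^ k) y) ((act x ^^ (Suc n - k)) f)))"
      by (intro sum.cong refl) (simp add: Suc_diff_le)
    finally show ?case unfolding M.sum_choose_Suc by (simp add: add.commute)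
  qed simp
  have lin: "act (\<Sum>i\<in>I. scale (a i) (z i)) f = (\<Sum>i\<in>I. scaleM (a i) (act (z i) f))"
    if "finite I" for I :: "nat set" and a z
    using that by (induction I) (use f act_scale_left[of f 0 0] in \<open>simp_all add: act_add_left act_scale_left\<close>)
  have "scaleM (coeff P i) ((act x ^^ i) (act y f)) = scaleM (coeff P i) (act y ((act x ^^ i) f))
      + scaleM (coeff P i) (act ((bracket x ^^ i) y) f)" for i
  proof (rule additive_poly_cases[OF P, of i])
    assume i: "i > 0" "\<And>k. 0 < k \<Longrightarrow> k < i \<Longrightarrow> of_nat (i choose k) = (0 :: 'f)"
    show ?thesis
      using M.sum_choose_additive[OF i, of "\<lambda>k. act ((bracket x ^^ k) y) ((act x ^^ (i - k)) f)"]
      by (simp add: binom M.scale_right_distrib)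
  qed simp
  then have "opoly scaleM P (act x) (act y f) = act y (opoly scaleM P (act x) f) +
      act (opoly scale P (bracket x) y) f"
    by (simp add: opoly_def sum.distrib lin linearD[OF act_linear])
  moreover have "act 0 f = 0" using act_scale_left[OF f, of 0 0] by simp
  ultimately show ?thesis by (simp add: ad)
qed

text \<open>With P = X Q the cochain Q(L) c is again a cocycle. On cocycles L is the differential of
  the contraction, so contracting Q(L) c gives the required \<open>e\<close>.\<close>

lemma lie_deriv_cocycle_exact:
  assumes "c \<in> C (Suc n)" "dd c = 0" "coeff P 0 = 0"
  shows "\<exists>e\<in>C n. opoly (pointwise scaleM) P (lie_deriv x) c = dd e"
proof -
  obtain Q where Q: "P = pCons 0 Q" using assms(3) by (cases P) auto
  let ?c = "opoly (pointwise scaleM) Q (lie_deriv x) c"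
  have c: "?c \<in> C (Suc n)"
    by (rule F.opoly_closed[OF subspace_C]) (use assms lie_deriv_closed in auto)
  have "dd ?c = opoly (pointwise scaleM) Q (lie_deriv x) (dd c)"
    by (rule opoly_intertwine[OF dd_linear, where V = "C (Suc n)"])
      (use assms lie_deriv_closed dd_lie_deriv in auto)
  then have "dd ?c = 0"
    by (simp add: assms(2) linear_zeroD[OF F.opoly_linear[OF lie_deriv_linear]])
  then have "lie_deriv x ?c = dd (contract x ?c)"
    using contract_dd[of x ?c] by simp
  then show ?thesis
    using cochains_SucD(2)[OF c] by (auto simp: Q F.opoly_pCons[OF lie_deriv_linear])
qed

section \<open>Vanishing through a chain of kernels\<close>

lemma cochains_range: "c \<in> C n \<Longrightarrow> c xs \<in> M"
  by (cases "length xs = n") (simp_all add: cochains_def M_simps)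

lemma cochains_comp:
  assumes "Vector_Spaces.linear scaleM scaleM T" "\<And>f. f \<in> M \<Longrightarrow> T f \<in> N" "c \<in> C n"
  shows "(\<lambda>xs. T (c xs)) \<in> cochains scale scaleM N n"
  using assms(2,3) unfolding cochains_def by (auto simp: linearD[OF assms(1)])

lemma dd_comp:
  assumes T: "Vector_Spaces.linear scaleM scaleM T"
    and comm: "\<And>f y. f \<in> M \<Longrightarrow> T (act y f) = act y (T f)" and c: "c \<in> C n"
  shows "dd (\<lambda>xs. T (c xs)) = (\<lambda>xs. T (dd c xs))"
proof
  have slot: "slot_sum S (\<lambda>xs. T (c xs)) xs = T (slot_sum S c xs)" for S and c :: "'a list \<Rightarrow> 'm" and xs
    by (induction xs arbitrary: c) (simp_all add: linearD[OF T], simp add: contract_def)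
  fix xs show "dd (\<lambda>xs. T (c xs)) xs = T (dd c xs)"
    using c
  proof (induction xs arbitrary: c n)
    case (Cons x xs)
    have "contract x (\<lambda>xs. T (c xs)) = (\<lambda>xs. T (contract x c xs))" by (simp add: contract_def)
    then show ?case
      using Cons.IH[OF contract_closed[OF Cons.prems]] comm[OF cochains_range[OF Cons.prems]]
      by (simp add: lie_deriv_def post_def slot linearD[OF T])
  qed (simp add: linearD[OF T])
qed

text \<open>The long exact sequence is run on elements. For a cocycle c in K_k choose c' with z_k c'
  = c. Then d c' takes values in K_(k+1), so it equals d b by induction, and c' - b is a cocycle
  with z_k (c' - b) = c; but z_k turns cocycles into coboundaries.\<close>

theorem cocycle_exact:
  fixes e :: "nat \<Rightarrow> 'a" and P :: "nat \<Rightarrow> 'f poly" and m :: nat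
  defines "Z \<equiv> \<lambda>k. opoly scaleM (P k) (act (e k))"
  assumes p: "Factorial_Ring.prime CHAR('f)" and e: "span (e ` {..<m}) = UNIV"
    and P: "\<And>k. k < m \<Longrightarrow> additive_poly (P k)"
    and ad: "\<And>k y. k < m \<Longrightarrow> opoly scale (P k) (bracket (e k)) y = 0"
    and surj: "\<And>k f. k < m \<Longrightarrow> f \<in> M \<Longrightarrow> \<forall>j<k. Z j f = 0 \<Longrightarrow>
      \<exists>g\<in>M. (\<forall>j<k. Z j g = 0) \<and> Z k g = f"
    and c: "c \<in> C (Suc n)" "dd c = 0"
  shows "\<exists>b\<in>C n. c = dd b"
proof -
  define K where "K k = {f \<in> M. \<forall>j<k. Z j f = 0}" for k
  have Z_linear: "Vector_Spaces.linear scaleM scaleM (Z k)" for k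
    unfolding Z_def by (rule M.opoly_linear[OF act_linear])
  have Z_closed: "f \<in> M \<Longrightarrow> Z k f \<in> M" for f k
    unfolding Z_def by (rule M.opoly_closed[OF subspace_M]) (simp_all add: act_closed)
  have Z_act: "Z k (act y f) = act y (Z k f)" if "k < m" "f \<in> M" for k y f
    unfolding Z_def by (rule opoly_act_commute[OF P[OF that(1)] p ad[OF that(1)] that(2)])
  have K_module: "lie_module scale bracket scaleM (K k) act" if "k \<le> m" for k
  proof unfold_locales
    show "M.subspace (K k)"
      by (rule M.subspaceI) (auto simp: K_def M_simps linearD[OF Z_linear])
    fix x y f a assume f: "f \<in> K k"
    then have fM: "f \<in> M" by (simp add: K_def)
    show "act x f \<in> K k"
      using f that by (auto simp: K_def act_closed Z_act act_simps)
    show "act (x + y) f = act x f + act y f" "act (scale a x) f = scaleM a (act x f)"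
      "act (bracket x y) f = act x (act y f) - act y (act x f)"
      using fM by (simp_all add: act_add_left act_scale_left act_bracket)
  qed (simp_all add: act_simps)
  \<comment> \<open>At \<open>k = m\<close> the bound puts the degree \<open>Suc n\<close> above the
    number of spanning vectors; at \<open>k = 0\<close> it is void.\<close>
  have "\<forall>n c. k \<le> n \<longrightarrow> c \<in> cochains scale scaleM (K k) (Suc n) \<longrightarrow> dd c = 0 \<longrightarrow>
      (\<exists>b\<in>cochains scale scaleM (K k) n. c = dd b)" if "k \<le> m" for k
    using that
  proof (induction rule: inc_induct)
    case base
    interpret K: lie_module scale bracket scaleM "K m" act by (rule K_module) simp
    show ?case
    proof (intro allI impI)
      fix n c assume n: "m \<le> n" and c: "c \<in> K.C (Suc n)"
      have "card (e ` {..<m}) < Suc n" using card_image_le[of "{..<m}" e] n by simp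
      then have "c = 0" by (intro K.cochains_eq_0I[OF _ e _ c]) auto
      then show "\<exists>b\<in>K.C n. c = dd b" by (intro bexI[of _ 0]) (simp_all add: dd_simps K.C_simps)
    qed
  next
    case (step k)
    interpret K: lie_module scale bracket scaleM "K k" act by (rule K_module) (use step in simp)
    interpret K': lie_module scale bracket scaleM "K (Suc k)" act by (rule K_module) (use step in simp)
    interpret MM: vector_space_pair scaleM scaleM ..
    have K_Suc: "f \<in> K (Suc k) \<longleftrightarrow> f \<in> K k \<and> Z k f = 0" for f
      by (auto simp: K_def less_Suc_eq)
    have C_Suc: "b \<in> K'.C i \<longleftrightarrow> b \<in> K.C i \<and> (\<forall>xs. Z k (b xs) = 0)" for b i
    proof
      assume b: "b \<in> K'.C i"
      then show "b \<in> K.C i \<and> (\<forall>xs. Z k (b xs) = 0)"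
        using K'.cochains_range[OF b] unfolding cochains_def K_Suc by blast
    next
      assume b: "b \<in> K.C i \<and> (\<forall>xs. Z k (b xs) = 0)"
      then show "b \<in> K'.C i"
        using K.cochains_range[of b] unfolding cochains_def K_Suc by blast
    qed
    \<comment> \<open>The section has to be linear for its composition with \<open>c\<close> to be
      multilinear. In general it does not respect the action, whence \<open>dd c'\<close> may be
      non-zero.\<close>
    obtain s where s: "range s \<subseteq> K k" "Vector_Spaces.linear scaleM scaleM s"
      "\<And>v. v \<in> Z k ` K k \<Longrightarrow> Z k (s v) = v"
      using MM.linear_exists_right_inverse_on[OF Z_linear K.subspace_M] by blast
    have Zs: "Z k (s f) = f" if f: "f \<in> K k" for f
    proof -
      obtain g where "g \<in> M" "\<forall>j<k. Z j g = 0" "Z k g = f"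
        using surj[of k f] f step(2) by (auto simp: K_def)
      then have "f \<in> Z k ` K k" by (auto simp: K_def)
      then show ?thesis by (rule s(3))
    qed
    show ?case
    proof (intro allI impI)
      fix n c assume n: "k \<le> n" and c: "c \<in> K.C (Suc n)" and dc: "dd c = 0"
      define c' where "c' = (\<lambda>xs. s (c xs))"
      have c': "c' \<in> K.C (Suc n)"
        unfolding c'_def by (rule K.cochains_comp[OF s(2) _ c]) (use s(1) in auto)
      have Zc': "(\<lambda>xs. Z k (c' xs)) = c"
        unfolding c'_def using K.cochains_range[OF c] by (simp add: Zs)
      \<comment> \<open>z_k commutes with the differential, so z_k d c' = d c = 0.\<close>
      have Zdc': "Z k (dd c' xs) = 0" for xs
        using fun_cong[OF K.dd_comp[OF Z_linear[of k] _ c'], of xs] Z_act[of k] step(2) dc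
        by (simp add: Zc' K_def)
      then have "dd c' \<in> K'.C (Suc (Suc n))"
        using K.dd_closed[OF c'] by (simp add: C_Suc)
      then obtain b where b: "b \<in> K'.C (Suc n)" "dd c' = dd b"
        using step(3) n K.dd_dd[OF c'] by (metis Suc_le_mono)
      define c'' where "c'' = c' - b"
      have c'': "c'' \<in> K.C (Suc n)"
        unfolding c''_def using c' b(1) by (simp add: C_Suc K.C_simps)
      have dc'': "dd c'' = 0" by (simp add: c''_def dd_simps b(2))
      have Zc'': "Z k (c'' xs) = c xs" for xs
        using b(1) fun_cong[OF Zc', of xs] by (simp add: c''_def linearD[OF Z_linear] C_Suc)
      have "coeff (P k) 0 = 0"
        by (rule additive_poly_cases[OF P[OF step(2)] p, of 0]) auto
      from K.lie_deriv_cocycle_exact[OF c'' dc'' this, of "e k"]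
      obtain b' where b': "b' \<in> K.C n"
        "opoly (pointwise scaleM) (P k) (lie_deriv (e k)) c'' = dd b'" by blast
      have "opoly (pointwise scaleM) (P k) (lie_deriv (e k)) c'' xs = c xs" for xs
        using K.opoly_lie_deriv[OF P[OF step(2)] p ad[OF step(2)] c''] Zc''
        by (simp add: Z_def)
      with b' show "\<exists>b\<in>K.C n. c = dd b" by (metis ext)
    qed
  qed
  from this[of 0] c show ?thesis by (simp add: K_def)
qed

end

section \<open>Linear forms on words and the Poincare--Birkhoff--Witt theorem\<close>

fun inversions :: "nat list \<Rightarrow> nat" where
  "inversions [] = 0"
| "inversions (x # xs) = length (filter (\<lambda>y. y < x) xs) + inversions xs"

lemma inversions_swap: "j < i \<Longrightarrow> inversions (u @ j # i # v) < inversions (u @ i # j # v)"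
  by (induction u) auto

lemma not_sorted_descent:
  "\<not> sorted w \<Longrightarrow> \<exists>u i j v. w = u @ i # j # v \<and> j < (i :: nat)"
proof (induction w)
  case (Cons x w)
  show ?case
  proof (cases "sorted w")
    case True
    then obtain y ys where "w = y # ys" "y < x"
      using Cons.prems by (cases w) (auto simp: not_le intro: le_less_trans)
    then show ?thesis by (intro exI[of _ "[]"]) auto
  next
    case False
    then show ?thesis using Cons.IH by (metis append_Cons)
  qed
qed simp

lemma fun_scale_apply: "fun_scale c f x = c * f x"
  by (simp add: fun_scale_def)

text \<open>Numbering the basis turns basis words into lists of naturals, for which sortedness and
  inversions make sense. The vectors \<open>e k\<close> with \<open>k \<ge> m\<close> are
  arbitrary.\<close>

locale based_lie_algebra = lie_algebra scale bracket
  for scale :: "'f::field \<Rightarrow> 'a::ab_group_add \<Rightarrow> 'a" and bracket +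
  fixes e :: "nat \<Rightarrow> 'a" and coord :: "'a \<Rightarrow> nat \<Rightarrow> 'f" and m :: nat
  assumes expand: "(\<Sum>k<m. scale (coord x k) (e k)) = x"
    and coord_add: "coord (x + y) k = coord x k + coord y k"
    and coord_scale: "coord (scale a x) k = a * coord x k"
    and coord_e: "i < m \<Longrightarrow> j < m \<Longrightarrow> coord (e i) j = (if i = j then 1 else 0)"
begin

text \<open>
  A linear form on the enveloping algebra is encoded by its values on products of elements of the
  Lie algebra.
\<close>

definition forms :: "('a list \<Rightarrow> 'f) set" where
  "forms = {\<phi>. (\<forall>u v x y. \<phi> (u @ (x + y) # v) = \<phi> (u @ x # v) + \<phi> (u @ y # v)) \<and>
     (\<forall>u v a x. \<phi> (u @ scale a x # v) = a * \<phi> (u @ x # v)) \<and>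
     (\<forall>u v x y. \<phi> (u @ x # y # v) = \<phi> (u @ y # x # v) + \<phi> (u @ bracket x y # v))}"

lemma formsD:
  assumes "\<phi> \<in> forms"
  shows "\<phi> (u @ (x + y) # v) = \<phi> (u @ x # v) + \<phi> (u @ y # v)"
    "\<phi> (u @ scale a x # v) = a * \<phi> (u @ x # v)"
    "\<phi> (u @ x # y # v) = \<phi> (u @ y # x # v) + \<phi> (u @ bracket x y # v)"
  using assms unfolding forms_def by blast+

lemma formsI:
  assumes "\<And>u v x y. \<phi> (u @ (x + y) # v) = \<phi> (u @ x # v) + \<phi> (u @ y # v)"
    "\<And>u v a x. \<phi> (u @ scale a x # v) = a * \<phi> (u @ x # v)"
    "\<And>u v x y. \<phi> (u @ x # y # v) = \<phi> (u @ y # x # v) + \<phi> (u @ bracket x y # v)"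
  shows "\<phi> \<in> forms"
  using assms unfolding forms_def by blast

lemma forms_sum:
  assumes "\<phi> \<in> forms" "finite I"
  shows "\<phi> (u @ (\<Sum>k\<in>I. scale (a k) (x k)) # v) = (\<Sum>k\<in>I. a k * \<phi> (u @ x k # v))"
  using assms(2)
proof (induction I)
  case empty
  show ?case using formsD(2)[OF assms(1), of u 0 0 v] by simp
qed (simp add: formsD[OF assms(1)])

lemma forms_expand:
  assumes "\<phi> \<in> forms"
  shows "\<phi> (u @ x # v) = (\<Sum>k<m. coord x k * \<phi> (u @ e k # v))"
  using forms_sum[OF assms finite_lessThan, of u "coord x" e m v] by (simp add: expand)

lemma coord_simps: "coord 0 k = 0" "coord (x - y) k = coord x k - coord y k" "coord (- x) k = - coord x k"
proof -
  have z: "coord 0 k = 0" for k using coord_scale[of 0 0 k] by simp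
  then show "coord 0 k = 0" .
  have "coord (- x) k + coord x k = 0" for x using coord_add[of "- x" x k] z by simp
  then have n: "coord (- x) k = - coord x k" for x by (simp add: eq_neg_iff_add_eq_0)
  then show "coord (- x) k = - coord x k" .
  show "coord (x - y) k = coord x k - coord y k" using coord_add[of x "- y" k] n by simp
qed

lemma coord_sum: "coord (\<Sum>k\<in>I. x k) r = (\<Sum>k\<in>I. coord (x k) r)"
  by (induction I rule: infinite_finite_induct) (simp_all add: coord_simps coord_add)

lemma forms_eq_0_wordsI:
  assumes \<phi>: "\<phi> \<in> forms" and words: "\<And>w. set w \<subseteq> {..<m} \<Longrightarrow> \<phi> (map e w) = 0"
  shows "\<phi> = 0"
proof
  have "\<phi> (map e w @ xs) = 0" if "set w \<subseteq> {..<m}" for w xs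
    using that
  proof (induction xs arbitrary: w)
    case (Cons x xs)
    have "\<phi> (map e w @ e k # xs) = 0" if "k < m" for k
      using Cons.IH[of "w @ [k]"] Cons.prems that by simp
    then show ?case by (simp add: forms_expand[OF \<phi>, of _ x])
  qed (simp add: words)
  from this[of "[]"] show "\<phi> xs = 0 xs" for xs by simp
qed

text \<open>The spanning half of the Poincare--Birkhoff--Witt theorem in dual form. Rewriting at a
  descent gives a word of the same length with fewer inversions, and shorter words.\<close>

lemma forms_eq_0_sortedI:
  assumes \<phi>: "\<phi> \<in> forms" and sorted: "\<And>w. sorted w \<Longrightarrow> set w \<subseteq> {..<m} \<Longrightarrow> \<phi> (map e w) = 0"
  shows "\<phi> = 0"
proof (rule forms_eq_0_wordsI[OF \<phi>])
  show "\<phi> (map e w) = 0" if "set w \<subseteq> {..<m}" for w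
    using that
  proof (induction w rule: wf_induct[OF wf_measures[of "[length, inversions]"]])
    case (1 w)
    show ?case
    proof (cases "sorted w")
      case False
      then obtain u i j v where w: "w = u @ i # j # v" "j < i" using not_sorted_descent by blast
      have "\<phi> (map e (u @ j # i # v)) = 0"
        using 1(1)[rule_format, of "u @ j # i # v"] 1(2) w inversions_swap[OF w(2), of u v] by auto
      moreover have "\<phi> (map e (u @ k # v)) = 0" if "k < m" for k
        using 1(1)[rule_format, of "u @ k # v"] 1(2) w that by auto
      then have "\<phi> (map e u @ bracket (e i) (e j) # map e v) = 0"
        by (subst forms_expand[OF \<phi>]) simp
      ultimately show ?thesis by (simp add: w(1) formsD(3)[OF \<phi>, of _ "e i"])
    qed (use 1 sorted in auto)
  qed
qed

text \<open>The value on \<open>u\<close>, \<open>x\<close>, \<open>v\<close> that multilinearity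
  forces when only the values on basis words are given.\<close>

definition subst_sum :: "(nat list \<Rightarrow> 'f) \<Rightarrow> nat list \<Rightarrow> 'a \<Rightarrow> nat list \<Rightarrow> 'f" where
  "subst_sum \<psi> u x v = (\<Sum>k<m. coord x k * \<psi> (u @ k # v))"

lemma subst_sum_linear:
  "subst_sum \<psi> u (x + y) v = subst_sum \<psi> u x v + subst_sum \<psi> u y v"
  "subst_sum \<psi> u (x - y) v = subst_sum \<psi> u x v - subst_sum \<psi> u y v"
  "subst_sum \<psi> u (- x) v = - subst_sum \<psi> u x v"
  "subst_sum \<psi> u (scale a x) v = a * subst_sum \<psi> u x v"
  "subst_sum \<psi> u 0 v = 0"
  by (simp_all add: subst_sum_def coord_simps coord_add coord_scale sum.distrib sum_subtractf sum_negf
      sum_distrib_left algebra_simps)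

definition straight_at :: "(nat list \<Rightarrow> 'f) \<Rightarrow> nat list \<Rightarrow> nat \<Rightarrow> nat \<Rightarrow> nat list \<Rightarrow> bool" where
  "straight_at \<psi> u i j v \<longleftrightarrow>
     \<psi> (u @ i # j # v) = \<psi> (u @ j # i # v) + subst_sum \<psi> u (bracket (e i) (e j)) v"

section \<open>Straightening words in the basis\<close>

definition descent :: "nat list \<Rightarrow> nat list \<times> nat \<times> nat \<times> nat list" where
  "descent w = (SOME (u, i, j, v). w = u @ i # j # v \<and> j < i)"

lemma descent:
  assumes "\<not> sorted w" "descent w = (u, i, j, v)"
  shows "w = u @ i # j # v" "j < i"
proof -
  have "\<exists>t. case t of (u, i, j, v) \<Rightarrow> w = u @ i # j # v \<and> j < i"
    using not_sorted_descent[OF assms(1)] by auto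
  from someI_ex[OF this] show "w = u @ i # j # v" "j < i"
    using assms(2) by (simp_all add: descent_def)
qed

text \<open>One chosen descent is rewritten at a time. That every other choice gives the same value
  is the content of \<open>straight_at_straighten\<close>.\<close>

function straighten :: "(nat list \<Rightarrow> 'f) \<Rightarrow> nat list \<Rightarrow> 'f" where
  "straighten \<psi> w = (if sorted w then \<psi> w else
     case descent w of (u, i, j, v) \<Rightarrow> straighten \<psi> (u @ j # i # v) +
       (\<Sum>k<m. coord (bracket (e i) (e j)) k * straighten \<psi> (u @ k # v)))"
  by pat_completeness auto
termination
proof (relation "measures [length \<circ> snd, inversions \<circ> snd]", goal_cases)
  case (2 \<psi> w u p i q j v)
  then have "w = u @ i # j # v" "j < i" using descent[of w u i j v] by simp_all
  then show ?case by (simp add: inversions_swap)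
next
  case (3 \<psi> w u p i q j v)
  then have "w = u @ i # j # v" using descent(1)[of w u i j v] by simp
  then show ?case by simp
qed simp

declare straighten.simps [simp del]

lemma straighten_sorted: "sorted w \<Longrightarrow> straighten \<psi> w = \<psi> w"
  by (simp add: straighten.simps)

lemma straighten_descent:
  assumes "\<not> sorted w"
  obtains u i j v where "w = u @ i # j # v" "j < i" "straight_at (straighten \<psi>) u i j v"
proof -
  obtain u i j v where d: "descent w = (u, i, j, v)" by (metis prod.exhaust)
  note uv = descent[OF assms d]
  have "straight_at (straighten \<psi>) u i j v"
    unfolding straight_at_def subst_sum_def uv(1)[symmetric]
    by (subst straighten.simps) (simp add: d assms)
  with uv that show ?thesis by blast
qed

context
  fixes \<psi> :: "nat list \<Rightarrow> 'f" and n :: nat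
  assumes shorter: "\<And>u i j v. length (u @ i # j # v) < n \<Longrightarrow> straight_at \<psi> u i j v"
begin

text \<open>Linearity in \<open>x\<close> extends the relation from basis letters to vectors. The
  words to be rewritten have length \<open>length u + length v + 2\<close>, for which the relation
  is available.\<close>

lemma subst_sum_commute:
  assumes "length u + length v + 2 < n"
  shows "subst_sum \<psi> u x (c # v) = subst_sum \<psi> (u @ [c]) x v + subst_sum \<psi> u (bracket x (e c)) v"
proof -
  have "subst_sum \<psi> u x (c # v) =
     (\<Sum>k<m. coord x k * (\<psi> (u @ c # k # v) + subst_sum \<psi> u (bracket (e k) (e c)) v))"
    using shorter[of u _ c v] assms by (simp add: subst_sum_def[of _ _ x] straight_at_def)
  also have "\<dots> = subst_sum \<psi> (u @ [c]) x v
      + (\<Sum>k<m. coord x k * subst_sum \<psi> u (bracket (e k) (e c)) v)"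
    by (simp add: subst_sum_def[of _ _ x] sum.distrib distrib_left)
  also have "(\<Sum>k<m. coord x k * subst_sum \<psi> u (bracket (e k) (e c)) v) =
      subst_sum \<psi> u (bracket (\<Sum>k<m. scale (coord x k) (e k)) (e c)) v"
  proof -
    have "subst_sum \<psi> u (\<Sum>k\<in>I. y k) v = (\<Sum>k\<in>I. subst_sum \<psi> u (y k) v)" for y and I :: "nat set"
      by (induction I rule: infinite_finite_induct) (simp_all add: subst_sum_linear)
    then show ?thesis
      by (simp add: linear_sumD[OF linear_left] linear_scaleD[OF linear_left] subst_sum_linear)
  qed
  finally show ?thesis by (simp add: expand)
qed

text \<open>
  Confluence, as in Bergman's diamond lemma: the result of straightening does not depend on the
  chosen descent. Two overlapping descents are resolved by the Jacobi identity.
\<close>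

lemma straight_overlap:
  assumes len: "length (u @ i # j # v) = n" and "u @ i # j # v = u' @ i' # j' # v'" "length u < length u'"
    and "j < i" "j' < i'"
    and fewer: "\<And>w i j v. length (w @ i # j # v) = n \<Longrightarrow>
      inversions (w @ i # j # v) < inversions (u' @ i' # j' # v') \<Longrightarrow> j < i \<Longrightarrow> straight_at \<psi> w i j v"
  shows "\<psi> (u @ j # i # v) + subst_sum \<psi> u (bracket (e i) (e j)) v =
    \<psi> (u' @ j' # i' # v') + subst_sum \<psi> u' (bracket (e i') (e j')) v'"
proof -
  obtain s where s: "u' = u @ s" "i # j # v = s @ i' # j' # v'" "s \<noteq> []"
    using assms(2,3) by (auto simp: append_eq_append_conv2)
  consider "s = [i]" "i' = j" "v = j' # v'" | t where "s = i # j # t" "v = t @ i' # j' # v'"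
    using s by (auto simp: Cons_eq_append_conv)
  then show ?thesis
  proof cases
    case 1
    \<comment> \<open>The descents share their middle letter: with \<open>i > j > c\<close> both
      reductions are carried on to the word \<open>u @ c # j # i # v'\<close>. The remaining terms
      are shorter, and after \<open>comm\<close> they cancel by the Jacobi identity.\<close>
    define c where "c = j'"
    have cj: "c < j" "j < i" using assms(4,5) 1 by (simp_all add: c_def)
    have w: "u' @ i' # j' # v' = u @ i # j # c # v'" using 1 s by (simp add: c_def)
    have n: "n = length u + length v' + 3" using len 1 by simp
    have inv: "inversions (u @ j # i # c # v') < inversions (u @ i # j # c # v')"
      "inversions (u @ j # c # i # v') < inversions (u @ j # i # c # v')"
      "inversions (u @ i # c # j # v') < inversions (u @ i # j # c # v')"
      "inversions (u @ c # i # j # v') < inversions (u @ i # c # j # v')"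
      using inversions_swap[of j i u "c # v'"] inversions_swap[of c i "u @ [j]" v']
        inversions_swap[of c j "u @ [i]" v'] inversions_swap[of c i u "j # v'"] cj by simp_all
    have s1: "\<psi> (u @ j # i # c # v') = \<psi> (u @ j # c # i # v') + subst_sum \<psi> (u @ [j]) (bracket (e i) (e c)) v'"
      using fewer[of "u @ [j]" i c v'] inv cj n by (simp add: straight_at_def w)
    have s2: "\<psi> (u @ j # c # i # v') = \<psi> (u @ c # j # i # v') + subst_sum \<psi> u (bracket (e j) (e c)) (i # v')"
      using fewer[of u j c "i # v'"] inv cj n by (simp add: straight_at_def w)
    have s3: "\<psi> (u @ i # c # j # v') = \<psi> (u @ c # i # j # v') + subst_sum \<psi> u (bracket (e i) (e c)) (j # v')"
      using fewer[of u i c "j # v'"] inv cj n by (simp add: straight_at_def w)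
    have s4: "\<psi> (u @ c # i # j # v') = \<psi> (u @ c # j # i # v') + subst_sum \<psi> (u @ [c]) (bracket (e i) (e j)) v'"
      using fewer[of "u @ [c]" i j v'] inv cj n by (simp add: straight_at_def w)
    have comm: "subst_sum \<psi> u x (d # v') = subst_sum \<psi> (u @ [d]) x v' + subst_sum \<psi> u (bracket x (e d)) v'" for x d
      by (rule subst_sum_commute) (simp add: n)
    have "bracket (bracket (e i) (e j)) (e c) + bracket (bracket (e j) (e c)) (e i)
        - bracket (bracket (e i) (e c)) (e j) = 0"
      using bracket_bracket[of "e i" "e j" "e c"] bracket_antisym[of "bracket (e j) (e c)" "e i"]
        bracket_antisym[of "bracket (e i) (e c)" "e j"] by simp
    then have "subst_sum \<psi> u (bracket (bracket (e i) (e j)) (e c)) v' + subst_sum \<psi> u (bracket (bracket (e j) (e c)) (e i)) v'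
        - subst_sum \<psi> u (bracket (bracket (e i) (e c)) (e j)) v' = 0"
      by (simp add: subst_sum_linear[symmetric])
    then show ?thesis
      using 1 s by (simp add: c_def[symmetric] s1 s2 s3 s4 comm algebra_simps)
  next
    case 2
    \<comment> \<open>The descents are disjoint. Performing both, in either order, leaves the same
      double sum over the two brackets.\<close>
    let ?x = "bracket (e i) (e j)" and ?y = "bracket (e i') (e j')"
    have w: "u' @ i' # j' # v' = u @ i # j # t @ i' # j' # v'" using 2 s by simp
    have n: "n = length u + length t + length v' + 4" using len 2 by simp
    have inv: "inversions (u @ j # i # t @ i' # j' # v') < inversions (u @ i # j # t @ i' # j' # v')"
      "inversions (u @ i # j # t @ j' # i' # v') < inversions (u @ i # j # t @ i' # j' # v')"
      using inversions_swap[of j i u "t @ i' # j' # v'"] inversions_swap[of j' i' "u @ i # j # t" v'] assms(4,5)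
      by simp_all
    have s1: "\<psi> (u @ j # i # t @ i' # j' # v') =
        \<psi> (u @ j # i # t @ j' # i' # v') + subst_sum \<psi> (u @ j # i # t) ?y v'"
      using fewer[of "u @ j # i # t" i' j' v'] inv assms(5) n by (simp add: straight_at_def w)
    have s2: "\<psi> (u @ i # j # t @ j' # i' # v') =
        \<psi> (u @ j # i # t @ j' # i' # v') + subst_sum \<psi> u ?x (t @ j' # i' # v')"
      using fewer[of u i j "t @ j' # i' # v'"] inv assms(4) n by (simp add: straight_at_def w)
    have s3: "subst_sum \<psi> u ?x (t @ i' # j' # v') = subst_sum \<psi> u ?x (t @ j' # i' # v')
        + (\<Sum>k<m. coord ?x k * subst_sum \<psi> (u @ k # t) ?y v')"
      using shorter[of "u @ _ # t" i' j' v'] n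
      by (simp add: subst_sum_def[of _ _ ?x] straight_at_def distrib_left sum.distrib)
    have s4: "subst_sum \<psi> (u @ i # j # t) ?y v' = subst_sum \<psi> (u @ j # i # t) ?y v'
        + (\<Sum>l<m. coord ?y l * subst_sum \<psi> u ?x (t @ l # v'))"
      using shorter[of u i j "t @ _ # v'"] n
      by (simp add: subst_sum_def[of _ _ ?y] straight_at_def distrib_left sum.distrib)
    have "(\<Sum>k<m. coord ?x k * subst_sum \<psi> (u @ k # t) ?y v') =
        (\<Sum>l<m. coord ?y l * subst_sum \<psi> u ?x (t @ l # v'))"
      unfolding subst_sum_def sum_distrib_left by (subst sum.swap) (simp add: mult.left_commute)
    then show ?thesis using 2 s by (simp add: s1 s2 s3 s4)
  qed
qed

end

lemma straight_at_sym:
  assumes "straight_at \<psi> u i j v"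
  shows "straight_at \<psi> u j i v"
proof -
  have "bracket (e j) (e i) = - bracket (e i) (e j)" by (rule bracket_antisym)
  then show ?thesis using assms by (simp add: straight_at_def subst_sum_linear)
qed

text \<open>The outer induction is on length, the inner one on inversions. A descent other than the
  chosen one is compared with it by \<open>straight_overlap\<close>; an ascent reduces to a descent
  by antisymmetry of the bracket, and for equal letters the bracket vanishes.\<close>

lemma straight_at_straighten: "straight_at (straighten \<psi>) u i j v"
proof (induction "length (u @ i # j # v)" arbitrary: u i j v rule: less_induct)
  case less
  let ?s = "straighten \<psi>" and ?n = "length (u @ i # j # v)"
  have shorter: "straight_at ?s u' i' j' v'" if "length (u' @ i' # j' # v') < ?n" for u' i' j' v'
    using less that by blast
  have desc: "straight_at ?s u i j v" if "length (u @ i # j # v) = ?n" "j < i" for u i j v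
    using that
  proof (induction "inversions (u @ i # j # v)" arbitrary: u i j v rule: less_induct)
    case (less u i j v)
    let ?w = "u @ i # j # v"
    have fewer: "straight_at ?s w i' j' v'"
      if "length (w @ i' # j' # v') = ?n" "inversions (w @ i' # j' # v') < inversions ?w" "j' < i'"
      for w i' j' v' using less(1) that by blast
    have "\<not> sorted ?w" using less(3) by (auto simp: sorted_append)
    from straighten_descent[OF this] obtain u' i' j' v'
      where d: "?w = u' @ i' # j' # v'" "j' < i'" "straight_at ?s u' i' j' v'" .
    consider "length u < length u'" | "length u' < length u" | "length u = length u'" by linarith
    then show ?case
    proof cases
      case 1
      have "?s (u @ j # i # v) + subst_sum ?s u (bracket (e i) (e j)) v =
        ?s (u' @ j' # i' # v') + subst_sum ?s u' (bracket (e i') (e j')) v'"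
        by (rule straight_overlap[OF shorter less(2) d(1) 1 less(3) d(2)])
          (use fewer d(1) in auto)
      then show ?thesis using d(1,3) by (simp add: straight_at_def)
    next
      case 2
      have "?s (u' @ j' # i' # v') + subst_sum ?s u' (bracket (e i') (e j')) v' =
          ?s (u @ j # i # v) + subst_sum ?s u (bracket (e i) (e j)) v"
        by (rule straight_overlap[OF shorter _ d(1)[symmetric] 2 d(2) less(3)])
          (use fewer d(1) less(2) in auto)
      then show ?thesis using d(1,3) by (simp add: straight_at_def)
    next
      case 3
      then show ?thesis using d by simp
    qed
  qed
  consider "j < i" | "i < j" | "i = j" by linarith
  then show ?case
  proof cases
    case 1
    then show ?thesis by (rule desc[OF refl])
  next
    case 2
    then show ?thesis by (intro straight_at_sym[OF desc]) simp_all
  next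
    case 3
    then show ?thesis by (simp add: straight_at_def bracket_self subst_sum_linear)
  qed
qed

section \<open>Multilinear extension of straightened functions\<close>

fun multilinear_ext :: "(nat list \<Rightarrow> 'f) \<Rightarrow> 'a list \<Rightarrow> 'f" where
  "multilinear_ext \<psi> [] = \<psi> []"
| "multilinear_ext \<psi> (x # xs) = (\<Sum>k<m. coord x k * multilinear_ext (\<lambda>w. \<psi> (k # w)) xs)"

lemma multilinear_ext_map: "set w \<subseteq> {..<m} \<Longrightarrow> multilinear_ext \<psi> (map e w) = \<psi> w"
proof (induction w arbitrary: \<psi>)
  case (Cons i w)
  then show ?case by (simp add: coord_e if_distrib[of "\<lambda>x. x * _"] cong: if_cong)
qed simp

lemma multilinear_ext_add:
  "multilinear_ext (\<lambda>w. \<psi> w + \<psi>' w) xs = multilinear_ext \<psi> xs + multilinear_ext \<psi>' xs"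
  by (induction xs arbitrary: \<psi> \<psi>') (simp_all add: distrib_left sum.distrib)

lemma multilinear_ext_scale: "multilinear_ext (\<lambda>w. a * \<psi> w) xs = a * multilinear_ext \<psi> xs"
  by (induction xs arbitrary: \<psi>) (simp_all add: sum_distrib_left mult.left_commute)

lemma multilinear_ext_zero: "multilinear_ext (\<lambda>w. 0) xs = 0"
  using multilinear_ext_scale[of 0] by simp

lemma multilinear_ext_sum:
  "multilinear_ext (\<lambda>w. \<Sum>r\<in>I. a r * \<psi> r w) xs = (\<Sum>r\<in>I. a r * multilinear_ext (\<psi> r) xs)"
  by (induction I rule: infinite_finite_induct)
    (simp_all add: multilinear_ext_zero multilinear_ext_add multilinear_ext_scale)

lemma coord_bracket:
  "coord (bracket x y) r = (\<Sum>k<m. \<Sum>l<m. coord x k * coord y l * coord (bracket (e k) (e l)) r)"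
proof -
  have "bracket x y = bracket (\<Sum>k<m. scale (coord x k) (e k)) (\<Sum>l<m. scale (coord y l) (e l))"
    by (simp add: expand)
  also have "\<dots> = (\<Sum>l<m. \<Sum>k<m. scale (coord y l * coord x k) (bracket (e k) (e l)))"
    by (simp add: linear_sumD[OF linear_left] linear_sumD[OF linear_right] bracket_simps
        scale_sum_right)
  also have "\<dots> = (\<Sum>k<m. \<Sum>l<m. scale (coord x k * coord y l) (bracket (e k) (e l)))"
    by (subst sum.swap) (simp add: mult.commute)
  finally show ?thesis by (simp add: coord_sum coord_scale)
qed

lemma multilinear_ext_forms:
  assumes "\<And>u i j v. straight_at \<psi> u i j v"
  shows "multilinear_ext \<psi> \<in> forms"
proof -
  let ?E = multilinear_ext
  have bracket: "?E \<psi> (u @ x # y # v) = ?E \<psi> (u @ y # x # v) + ?E \<psi> (u @ bracket x y # v)"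
    if "\<And>u i j v. straight_at \<psi> u i j v" for \<psi> u v x y
    using that
  proof (induction u arbitrary: \<psi>)
    case Nil
    let ?E2 = "\<lambda>k l. ?E (\<lambda>w. \<psi> (k # l # w)) v"
    have swap: "?E2 k l = ?E2 l k + (\<Sum>r<m. coord (bracket (e k) (e l)) r * ?E (\<lambda>w. \<psi> (r # w)) v)" for k l
    proof -
      have "(\<lambda>w. \<psi> (k # l # w)) =
          (\<lambda>w. \<psi> (l # k # w) + (\<Sum>r<m. coord (bracket (e k) (e l)) r * \<psi> (r # w)))"
        using Nil[of "[]" k l] by (simp add: straight_at_def subst_sum_def)
      then show ?thesis by (simp add: multilinear_ext_add multilinear_ext_sum)
    qed
    have "?E \<psi> (x # y # v) = (\<Sum>k<m. \<Sum>l<m. coord x k * (coord y l * ?E2 k l))"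
      by (simp add: sum_distrib_left)
    also have "\<dots> = (\<Sum>k<m. \<Sum>l<m. coord x k * (coord y l *
        (?E2 l k + (\<Sum>r<m. coord (bracket (e k) (e l)) r * ?E (\<lambda>w. \<psi> (r # w)) v))))"
      by (subst swap) (rule refl)
    also have "\<dots> = (\<Sum>k<m. \<Sum>l<m. coord x k * (coord y l * ?E2 l k)) +
        (\<Sum>k<m. \<Sum>l<m. \<Sum>r<m. coord x k * coord y l * coord (bracket (e k) (e l)) r * ?E (\<lambda>w. \<psi> (r # w)) v)"
      by (simp add: sum_distrib_left distrib_left sum.distrib mult.assoc)
    also have "(\<Sum>k<m. \<Sum>l<m. coord x k * (coord y l * ?E2 l k)) = ?E \<psi> (y # x # v)"
      by (subst sum.swap) (simp add: sum_distrib_left mult.left_commute)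
    \<comment> \<open>The summation over \<open>r\<close> is moved outermost so that
      \<open>coord_bracket\<close> can collapse the inner double sum.\<close>
    also have "(\<Sum>k<m. \<Sum>l<m. \<Sum>r<m. coord x k * coord y l * coord (bracket (e k) (e l)) r * ?E (\<lambda>w. \<psi> (r # w)) v) =
        (\<Sum>k<m. \<Sum>r<m. \<Sum>l<m. coord x k * coord y l * coord (bracket (e k) (e l)) r * ?E (\<lambda>w. \<psi> (r # w)) v)"
      by (intro sum.cong refl sum.swap)
    also have "\<dots> = (\<Sum>r<m. \<Sum>k<m. \<Sum>l<m. coord x k * coord y l * coord (bracket (e k) (e l)) r * ?E (\<lambda>w. \<psi> (r # w)) v)"
      by (rule sum.swap)
    also have "\<dots> = ?E \<psi> (bracket x y # v)"
      by (simp add: coord_bracket[of x y] sum_distrib_right)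
    finally show ?case by simp
  next
    case (Cons z u)
    have "straight_at (\<lambda>w. \<psi> (k # w)) u' i j v'" for k u' i j v'
      using Cons.prems[of "k # u'" i j v'] by (simp add: straight_at_def subst_sum_def)
    from Cons.IH[OF this] show ?case by (simp add: distrib_left sum.distrib)
  qed
  have "?E \<psi> (u @ (x + y) # v) = ?E \<psi> (u @ x # v) + ?E \<psi> (u @ y # v)" for \<psi> u v x y
    by (induction u arbitrary: \<psi>) (simp_all add: coord_add distrib_left distrib_right sum.distrib)
  moreover have "?E \<psi> (u @ scale a x # v) = a * ?E \<psi> (u @ x # v)" for \<psi> u v x a
    by (induction u arbitrary: \<psi>) (simp_all add: coord_scale sum_distrib_left mult.assoc mult.left_commute)
  ultimately show ?thesis using bracket[OF assms] by (intro formsI)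
qed

text \<open>The independence half, again in dual form: values on the ordered monomials can be
  prescribed freely because these are linearly independent in the enveloping algebra.\<close>

theorem poincare_birkhoff_witt:
  obtains \<phi> where "\<phi> \<in> forms" "\<And>w. sorted w \<Longrightarrow> set w \<subseteq> {..<m} \<Longrightarrow> \<phi> (map e w) = \<psi> w"
proof
  show "multilinear_ext (straighten \<psi>) \<in> forms"
    by (rule multilinear_ext_forms) (rule straight_at_straighten)
qed (simp add: multilinear_ext_map straighten_sorted)

subsection \<open>Ordered monomials\<close>

text \<open>Segments allow the block of one basis vector to be cut out of an ordered monomial and
  changed on its own.\<close>

definition monomial_segment :: "(nat \<Rightarrow> nat) \<Rightarrow> nat \<Rightarrow> nat \<Rightarrow> nat list" where
  "monomial_segment \<alpha> a b = concat (map (\<lambda>j. replicate (\<alpha> j) j) [a..<b])"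

abbreviation monomial :: "(nat \<Rightarrow> nat) \<Rightarrow> nat list" where
  "monomial \<alpha> \<equiv> monomial_segment \<alpha> 0 m"

lemma monomial_segment_cong:
  "(\<And>j. a \<le> j \<Longrightarrow> j < b \<Longrightarrow> \<alpha> j = \<beta> j) \<Longrightarrow> monomial_segment \<alpha> a b = monomial_segment \<beta> a b"
  unfolding monomial_segment_def by (rule arg_cong[of _ _ concat]) auto

lemma monomial_split:
  assumes "i < m"
  shows "monomial \<alpha> = monomial_segment \<alpha> 0 i @ replicate (\<alpha> i) i @ monomial_segment \<alpha> (Suc i) m"
proof -
  have "[0..<m] = [0..<i] @ i # [Suc i..<m]"
    using assms upt_add_eq_append[of 0 i "m - i"] by (simp add: upt_conv_Cons)
  then show ?thesis by (simp add: monomial_segment_def)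
qed

lemma monomial_update:
  assumes "i < m"
  shows "monomial (\<alpha>(i := k)) = monomial_segment \<alpha> 0 i @ replicate k i @ monomial_segment \<alpha> (Suc i) m"
  unfolding monomial_split[OF assms]
  using monomial_segment_cong[of 0 i "\<alpha>(i := k)" \<alpha>] monomial_segment_cong[of "Suc i" m "\<alpha>(i := k)" \<alpha>]
  by simp

lemma sorted_monomial: "sorted (monomial_segment \<alpha> 0 n)"
proof (induction n)
  case (Suc n)
  have "x < n" if "x \<in> set (monomial_segment \<alpha> 0 n)" for x
    using that by (auto simp: monomial_segment_def)
  then show ?case using Suc by (auto simp: monomial_segment_def sorted_append less_imp_le)
qed (simp add: monomial_segment_def)

lemma set_monomial: "set (monomial \<alpha>) \<subseteq> {..<m}"
  by (auto simp: monomial_segment_def)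

lemma count_monomial: "count_list (monomial_segment \<alpha> 0 n) j = (if j < n then \<alpha> j else 0)"
proof (induction n)
  case (Suc n)
  have "count_list (replicate k i) j = (if i = j then k else 0)" for k i
    by (induction k) auto
  then show ?case using Suc by (auto simp: monomial_segment_def)
qed (simp add: monomial_segment_def)

lemma sorted_eq_monomial:
  assumes "sorted w" "set w \<subseteq> {..<m}"
  shows "w = monomial (count_list w)"
proof -
  have "mset (monomial (count_list w)) = mset w"
    by (rule multiset_eqI) (use assms(2) in \<open>auto simp: count_mset count_monomial count_list_0_iff\<close>)
  then show ?thesis
    using properties_for_sort[OF _ sorted_monomial] properties_for_sort[OF _ assms(1)] by metis
qed

lemma forms_eq_0_monomialI:
  assumes "\<phi> \<in> forms" "\<And>\<alpha>. \<phi> (map e (monomial \<alpha>)) = 0"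
  shows "\<phi> = 0"
  using assms sorted_eq_monomial by (intro forms_eq_0_sortedI) metis+

text \<open>\<open>G\<close> may depend only on the exponents below \<open>m\<close>, since the
  monomial does not see the others.\<close>

lemma forms_monomial_exists:
  assumes "\<And>\<alpha> \<beta>. (\<And>j. j < m \<Longrightarrow> \<alpha> j = \<beta> j) \<Longrightarrow> G \<alpha> = G \<beta>"
  obtains \<phi> where "\<phi> \<in> forms" "\<And>\<alpha>. \<phi> (map e (monomial \<alpha>)) = G \<alpha>"
proof -
  obtain \<phi> where \<phi>: "\<phi> \<in> forms"
    "\<And>w. sorted w \<Longrightarrow> set w \<subseteq> {..<m} \<Longrightarrow> \<phi> (map e w) = G (count_list w)"
    by (rule poincare_birkhoff_witt[of "\<lambda>w. G (count_list w)"]) blast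
  have "\<phi> (map e (monomial \<alpha>)) = G \<alpha>" for \<alpha>
    unfolding \<phi>(2)[OF sorted_monomial set_monomial]
    by (rule assms) (simp add: count_monomial)
  with \<phi>(1) show ?thesis by (rule that)
qed

section \<open>Central polynomials acting on forms\<close>

text \<open>The left coregular action (x . f)(v) = f(v x) on encoded forms, hence the new letter
  comes last.\<close>

definition snoc_op :: "'a \<Rightarrow> ('a list \<Rightarrow> 'f) \<Rightarrow> 'a list \<Rightarrow> 'f" where
  "snoc_op x \<phi> = (\<lambda>w. \<phi> (w @ [x]))"

sublocale forms: lie_module scale bracket "fun_scale :: 'f \<Rightarrow> ('a list \<Rightarrow> 'f) \<Rightarrow> _" forms snoc_op
proof (rule lie_module.intro[OF lie_algebra_axioms fun_vs.vector_space_axioms], unfold_locales)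
  show "fun_vs.subspace forms"
  proof (rule fun_vs.subspaceI)
    fix \<phi> \<chi> :: "'a list \<Rightarrow> 'f" and c assume \<phi>: "\<phi> \<in> forms"
    show "fun_scale c \<phi> \<in> forms"
    proof (rule formsI)
      fix u v x y
      show "fun_scale c \<phi> (u @ x # y # v) = fun_scale c \<phi> (u @ y # x # v)
          + fun_scale c \<phi> (u @ bracket x y # v)"
        using formsD(3)[OF \<phi>, of u x y v] by (simp only: fun_scale_apply distrib_left)
    qed (simp_all add: fun_scale_apply formsD(1,2)[OF \<phi>] distrib_left mult.left_commute)
    assume \<chi>: "\<chi> \<in> forms"
    show "\<phi> + \<chi> \<in> forms"
    proof (rule formsI)
      fix u v x y
      show "(\<phi> + \<chi>) (u @ x # y # v) = (\<phi> + \<chi>) (u @ y # x # v) + (\<phi> + \<chi>) (u @ bracket x y # v)"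
        using formsD(3)[OF \<phi>, of u x y v] formsD(3)[OF \<chi>, of u x y v] by simp
    qed (simp_all add: formsD(1,2)[OF \<phi>] formsD(1,2)[OF \<chi>] distrib_left)
  qed (simp add: forms_def)
  fix \<phi> :: "'a list \<Rightarrow> 'f" and x y a assume \<phi>: "\<phi> \<in> forms"
  show "snoc_op x \<phi> \<in> forms"
  proof (rule formsI)
    fix u v y z
    show "snoc_op x \<phi> (u @ y # z # v) = snoc_op x \<phi> (u @ z # y # v) + snoc_op x \<phi> (u @ bracket y z # v)"
      using formsD(3)[OF \<phi>, of u y z "v @ [x]"] by (simp add: snoc_op_def)
  qed (simp_all add: snoc_op_def formsD(1,2)[OF \<phi>])
  show "snoc_op (x + y) \<phi> = snoc_op x \<phi> + snoc_op y \<phi>"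
    "snoc_op (scale a x) \<phi> = fun_scale a (snoc_op x \<phi>)"
    by (simp_all add: snoc_op_def fun_eq_iff fun_scale_apply formsD(1,2)[OF \<phi>])
  show "snoc_op (bracket x y) \<phi> = snoc_op x (snoc_op y \<phi>) - snoc_op y (snoc_op x \<phi>)"
  proof
    show "snoc_op (bracket x y) \<phi> w = (snoc_op x (snoc_op y \<phi>) - snoc_op y (snoc_op x \<phi>)) w" for w
      using formsD(3)[OF \<phi>, of w x y "[]"] by (simp add: snoc_op_def)
  qed
qed (auto simp: snoc_op_def fun_eq_iff fun_scale_apply)

definition op :: "'f poly \<Rightarrow> nat \<Rightarrow> ('a list \<Rightarrow> 'f) \<Rightarrow> 'a list \<Rightarrow> 'f" where
  "op H i = opoly fun_scale H (snoc_op (e i))"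

text \<open>The dual form of H(e_i) x = x H(e_i).\<close>

definition central :: "'f poly \<Rightarrow> nat \<Rightarrow> bool" where
  "central H i \<longleftrightarrow> (\<forall>\<phi>\<in>forms. \<forall>x. op H i (snoc_op x \<phi>) = snoc_op x (op H i \<phi>))"

lemma op_linear: "Vector_Spaces.linear fun_scale fun_scale (op H i)"
  unfolding op_def by (rule fun_vs.opoly_linear[OF forms.act_linear])

lemma op_closed: "\<phi> \<in> forms \<Longrightarrow> op H i \<phi> \<in> forms"
  unfolding op_def by (rule fun_vs.opoly_closed[OF forms.subspace_M]) (auto simp: forms.act_closed)

lemma op_apply: "op H i \<phi> w = (\<Sum>k\<le>degree H. coeff H k * \<phi> (w @ replicate k (e i)))"
proof -
  have "(snoc_op (e i) ^^ k) \<phi> w = \<phi> (w @ replicate k (e i))" for k w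
    by (induction k arbitrary: w) (simp_all add: snoc_op_def replicate_append_same[symmetric])
  then show ?thesis by (simp add: op_def opoly_def sum_apply fun_scale_apply)
qed

text \<open>\<open>op\<close> places H(e_i) at the end of the word, and a central element can be
  moved to any place. The induction moves it across \<open>v\<close> letter by letter.\<close>

lemma central_shift:
  assumes "central H i" "\<phi> \<in> forms"
  shows "op H i \<phi> (u @ v) = (\<Sum>k\<le>degree H. coeff H k * \<phi> (u @ replicate k (e i) @ v))"
  using assms(2)
proof (induction v arbitrary: \<phi> rule: rev_induct)
  case (snoc x v)
  have "op H i \<phi> (u @ v @ [x]) = op H i (snoc_op x \<phi>) (u @ v)"
    using assms(1) snoc.prems by (simp add: central_def) (simp add: snoc_op_def)
  also have "\<dots> = (\<Sum>k\<le>degree H. coeff H k * snoc_op x \<phi> (u @ replicate k (e i) @ v))"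
    by (rule snoc.IH) (rule forms.act_closed[OF snoc.prems])
  finally show ?case by (simp add: snoc_op_def)
qed (simp add: op_apply)

text \<open>Placed beside the block of \<open>e i\<close>, powers of \<open>e i\<close> only raise
  its exponent. Hence on ordered monomials \<open>op\<close> is a recurrence operator in a single
  exponent.\<close>

lemma op_monomial:
  assumes "central H i" "\<phi> \<in> forms" "i < m"
  shows "op H i \<phi> (map e (monomial (\<alpha>(i := n)))) =
    (\<Sum>k\<le>degree H. coeff H k * \<phi> (map e (monomial (\<alpha>(i := n + k)))))"
  using central_shift[OF assms(1,2), of "map e (monomial_segment \<alpha> 0 i) @ replicate n (e i)"
      "map e (monomial_segment \<alpha> (Suc i) m)"]
  by (simp add: monomial_update[OF assms(3)] replicate_add)

lemma op_commute:
  assumes "central H i" "\<phi> \<in> forms"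
  shows "op H i (op H' j \<phi>) = op H' j (op H i \<phi>)"
  unfolding op_def[of H' j]
  by (rule opoly_intertwine[OF op_linear, where V = forms])
    (use assms in \<open>auto simp: central_def forms.act_closed\<close>)

text \<open>The dual of dividing a polynomial by the monic polynomial \<open>P\<close>.\<close>

lemma recurrence_solution:
  fixes s :: "nat \<Rightarrow> 'f" and P :: "'f poly"
  assumes "lead_coeff P = 1"
  shows "\<exists>t. (\<forall>n<degree P. t n = 0) \<and> (\<forall>n. (\<Sum>k\<le>degree P. coeff P k * t (n + k)) = s n)"
proof -
  let ?q = "degree P"
  \<comment> \<open>The equation with index \<open>n - ?q\<close> is solved for its top unknown
    \<open>t n\<close>, whose coefficient is one.\<close>
  define F where "F = (\<lambda>t n. if n < ?q then 0 else s (n - ?q) - (\<Sum>k<?q. coeff P k * t (n - ?q + k)))"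
  define t where "t = wfrec less_than (\<lambda>t n. F t n)"
  have t: "t n = F t n" for n
  proof -
    have "t n = F (cut t less_than n) n"
      unfolding t_def by (rule wfrec[OF wf_less_than])
    also have "\<dots> = F t n"
      by (auto simp: F_def cut_apply intro!: sum.cong)
    finally show ?thesis .
  qed
  have "(\<Sum>k\<le>?q. coeff P k * t (n + k)) = s n" for n
  proof -
    have "t (n + ?q) = s n - (\<Sum>k<?q. coeff P k * t (n + k))"
      by (subst t) (simp add: F_def)
    then show ?thesis using assms by (simp add: lessThan_Suc_atMost[symmetric])
  qed
  moreover have "t n = 0" if "n < ?q" for n
    using that by (subst t) (simp add: F_def)
  ultimately show ?thesis by blast
qed

text \<open>Along each line of exponents that varies only in \<open>i\<close> the equation is a
  recurrence, and \<open>forms_monomial_exists\<close> assembles the solutions into a form. The zero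
  initial values are the normalisation that \<open>op_eq_0_transfer\<close> exploits.\<close>

lemma op_surjective:
  assumes "central P i" "lead_coeff P = 1" "i < m" "\<phi> \<in> forms"
  obtains \<chi> where "\<chi> \<in> forms" "op P i \<chi> = \<phi>"
    "\<And>\<alpha>. \<alpha> i < degree P \<Longrightarrow> \<chi> (map e (monomial \<alpha>)) = 0"
proof -
  \<comment> \<open>Choosing \<open>t\<close> as a function of the sequence alone gives exponent
    functions on the same line the same solution.\<close>
  define t where "t s = (SOME t. (\<forall>n<degree P. t n = 0) \<and>
      (\<forall>n. (\<Sum>k\<le>degree P. coeff P k * t (n + k)) = s n))" for s :: "nat \<Rightarrow> 'f"
  have t: "n < degree P \<Longrightarrow> t s n = 0" "(\<Sum>k\<le>degree P. coeff P k * t s (n + k)) = s n" for s n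
    using someI_ex[OF recurrence_solution[OF assms(2), of s]] unfolding t_def by blast+
  define line where "line \<alpha> = (\<lambda>n. \<phi> (map e (monomial (\<alpha>(i := n)))))" for \<alpha>
  have line_cong: "line \<alpha> = line \<beta>" if "\<And>j. j < m \<Longrightarrow> j \<noteq> i \<Longrightarrow> \<alpha> j = \<beta> j" for \<alpha> \<beta>
  proof -
    have "monomial (\<alpha>(i := n)) = monomial (\<beta>(i := n))" for n
      by (rule monomial_segment_cong) (use that in simp)
    then show ?thesis by (simp add: line_def)
  qed
  obtain \<chi> where \<chi>: "\<chi> \<in> forms" "\<And>\<alpha>. \<chi> (map e (monomial \<alpha>)) = t (line \<alpha>) (\<alpha> i)"
  proof (rule forms_monomial_exists[of "\<lambda>\<alpha>. t (line \<alpha>) (\<alpha> i)"])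
    fix \<alpha> \<beta> :: "nat \<Rightarrow> nat" assume "\<And>j. j < m \<Longrightarrow> \<alpha> j = \<beta> j"
    then show "t (line \<alpha>) (\<alpha> i) = t (line \<beta>) (\<beta> i)" using line_cong[of \<alpha> \<beta>] assms(3) by simp
  qed blast
  have "op P i \<chi> - \<phi> = 0"
  proof (rule forms_eq_0_monomialI)
    show "op P i \<chi> - \<phi> \<in> forms" using op_closed \<chi>(1) assms(4) by (simp add: forms.M_simps)
    fix \<alpha> :: "nat \<Rightarrow> nat"
    have "op P i \<chi> (map e (monomial (\<alpha>(i := \<alpha> i)))) = line \<alpha> (\<alpha> i)"
      unfolding op_monomial[OF assms(1) \<chi>(1) assms(3)] \<chi>(2)
      using line_cong[of "\<alpha>(i := _)" \<alpha>] by (simp add: t(2))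
    then show "(op P i \<chi> - \<phi>) (map e (monomial \<alpha>)) = 0" by (simp add: line_def)
  qed
  with \<chi> t(1) that show ?thesis by simp
qed

text \<open>Since \<open>op H j\<close> leaves the exponent of \<open>e i\<close> alone,
  \<open>op H j \<chi>\<close> inherits the zero initial values. It is also killed by
  \<open>op P i\<close>, and a monic recurrence with zero initial values has only the zero
  solution.\<close>

lemma op_eq_0_transfer:
  assumes P: "central P i" "lead_coeff P = 1" and H: "central H j" and ij: "i < m" "j < m" "i \<noteq> j"
    and \<chi>: "\<chi> \<in> forms" "\<And>\<alpha>. \<alpha> i < degree P \<Longrightarrow> \<chi> (map e (monomial \<alpha>)) = 0"
    and zero: "op H j (op P i \<chi>) = 0"
  shows "op H j \<chi> = 0"
proof (rule forms_eq_0_monomialI[OF op_closed[OF \<chi>(1)]])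
  let ?\<chi> = "op H j \<chi>" and ?q = "degree P"
  have "op P i ?\<chi> = 0" using op_commute[OF P(1) \<chi>(1)] zero by simp
  then have rec: "(\<Sum>k\<le>?q. coeff P k * ?\<chi> (map e (monomial (\<alpha>(i := n + k))))) = 0" for \<alpha> n
    using op_monomial[OF P(1) op_closed[OF \<chi>(1)] ij(1)] by (metis zero_fun_apply)
  have low: "?\<chi> (map e (monomial \<alpha>)) = 0" if "\<alpha> i < ?q" for \<alpha>
    using op_monomial[OF H \<chi>(1) ij(2), of \<alpha> "\<alpha> j"] \<chi>(2)[of "\<alpha>(j := _)"] that ij(3) by simp
  have "?\<chi> (map e (monomial (\<alpha>(i := n)))) = 0" for \<alpha> n
  proof (induction n rule: less_induct)
    case (less n)
    show ?case
    proof (cases "n < ?q")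
      case False
      then have "n - ?q + k < n" if "k < ?q" for k using that by simp
      then have "?\<chi> (map e (monomial (\<alpha>(i := n - ?q + k)))) = 0" if "k < ?q" for k
        using less that by blast
      then have "?\<chi> (map e (monomial (\<alpha>(i := n)))) = 0"
        using rec[of \<alpha> "n - ?q"] P(2) False by (simp add: lessThan_Suc_atMost[symmetric])
      then show ?thesis .
    qed (simp add: low)
  qed
  from this[of \<alpha> "\<alpha> i" for \<alpha>] show "?\<chi> (map e (monomial \<alpha>)) = 0" for \<alpha> by simp
qed

text \<open>This is the source of finite dimension: monic central relations bring every exponent
  below the degree of its polynomial, so finitely many monomials determine the form.\<close>

lemma op_annihilated_eq_0I:
  assumes H: "\<And>j. j < m \<Longrightarrow> central (H j) j \<and> lead_coeff (H j) = 1 \<and> op (H j) j \<phi> = 0"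
    and \<phi>: "\<phi> \<in> forms" "\<And>\<alpha>. (\<And>j. j < m \<Longrightarrow> \<alpha> j < degree (H j)) \<Longrightarrow> \<phi> (map e (monomial \<alpha>)) = 0"
  shows "\<phi> = 0"
proof (rule forms_eq_0_monomialI[OF \<phi>(1)])
  \<comment> \<open>Exponents at positions below \<open>r\<close> are unrestricted. The step from
    \<open>r\<close> to \<open>Suc r\<close> frees position \<open>r\<close> by induction on its
    exponent.\<close>
  have "\<phi> (map e (monomial \<alpha>)) = 0"
    if "r \<le> m" "\<And>j. r \<le> j \<Longrightarrow> j < m \<Longrightarrow> \<alpha> j < degree (H j)" for \<alpha> r
    using that
  proof (induction r arbitrary: \<alpha>)
    case (Suc r)
    then have r: "r < m" by simp
    let ?d = "degree (H r)"
    note Hr = H[OF r]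
    have "\<phi> (map e (monomial (\<alpha>(r := n)))) = 0" for n
    proof (induction n rule: less_induct)
      case (less n)
      show ?case
      proof (cases "n < ?d")
        case True
        show ?thesis by (rule Suc.IH) (use Suc.prems r True in auto)
      next
        case False
        have "n - ?d + k < n" if "k < ?d" for k using that False by simp
        then have low: "\<phi> (map e (monomial (\<alpha>(r := n - ?d + k)))) = 0" if "k < ?d" for k
          using less that by blast
        have "(\<Sum>k\<le>?d. coeff (H r) k * \<phi> (map e (monomial (\<alpha>(r := n - ?d + k))))) = 0"
          using op_monomial[of "H r" r \<phi> \<alpha> "n - ?d"] Hr \<phi>(1) r by simp
        then have "\<phi> (map e (monomial (\<alpha>(r := n)))) = 0"
          using Hr low False by (simp add: lessThan_Suc_atMost[symmetric])
        then show ?thesis .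
      qed
    qed
    from this[of "\<alpha> r"] show ?case by simp
  qed (use \<phi>(2) in auto)
  from this[of m] show "\<phi> (map e (monomial \<alpha>)) = 0" for \<alpha> by simp
qed

end

section \<open>The dual of the enveloping algebra as forms on words\<close>

definition word :: "'a list \<Rightarrow> ('a, 'f::field) free_alg" where
  "word xs = Poly_Mapping.single (Word xs) 1"

lemma word_Nil: "word [] = 1"
  by (simp add: word_def zero_word_def[symmetric])

lemma word_append: "word (xs @ ys) = word xs * word ys"
  by (simp add: word_def mult_single plus_word_def)

lemma alg_const_1: "alg_const 1 = 1"
  by (simp add: alg_const_def)

lemma gen_eq_word: "gen x = word [x]"
  by (simp add: gen_def word_def)

lemma alg_const_mult: "alg_const c * Poly_Mapping.single w a = Poly_Mapping.single w (c * a)"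
  by (simp add: alg_const_def mult_single)

lemma single_eq_word: "Poly_Mapping.single w c = alg_const c * word (letters w)"
  by (cases w) (simp add: alg_const_mult word_def)

lemma alg_const_commute: "alg_const c * a = a * alg_const c" for a :: "('a, 'f::field) free_alg"
proof (induction a rule: Poly_Mapping.update_induct)
  case (update f k v)
  have "Poly_Mapping.update k v f = f + Poly_Mapping.single k v"
    using update by (intro poly_mapping_eqI)
      (auto simp: lookup_update lookup_add lookup_single in_keys_iff when_def)
  then show ?case using update by (simp add: algebra_simps alg_const_def mult_single)
qed simp

lemma free_alg_sum: "a = (\<Sum>w\<in>Poly_Mapping.keys a. alg_const (Poly_Mapping.lookup a w) * word (letters w))"
  for a :: "('a, 'f::field) free_alg"
proof (rule poly_mapping_eqI)
  fix w
  have "Poly_Mapping.lookup (\<Sum>w\<in>Poly_Mapping.keys a. Poly_Mapping.single w (Poly_Mapping.lookup a w)) w =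
      (\<Sum>v\<in>Poly_Mapping.keys a. if v = w then Poly_Mapping.lookup a v else 0)"
    by (simp add: lookup_sum lookup_single when_def)
  also have "\<dots> = Poly_Mapping.lookup a w" by (simp add: in_keys_iff)
  finally show "Poly_Mapping.lookup a w =
      Poly_Mapping.lookup (\<Sum>w\<in>Poly_Mapping.keys a. alg_const (Poly_Mapping.lookup a w) * word (letters w)) w"
    by (simp add: single_eq_word)
qed

lemma free_alg_induct [case_names zero word add]:
  fixes a :: "('a, 'f::field) free_alg"
  assumes "Q 0" "\<And>c w. Q (alg_const c * word w)" "\<And>a b. Q a \<Longrightarrow> Q b \<Longrightarrow> Q (a + b)"
  shows "Q a"
proof -
  have "Q (\<Sum>w\<in>I. alg_const (c w) * word (f w))" if "finite I" for I :: "'a word set" and c f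
    using that by (induction I) (auto intro: assms)
  then show ?thesis by (subst free_alg_sum) simp
qed

definition word_sum :: "('a list \<Rightarrow> 'f::field) \<Rightarrow> ('a, 'f) free_alg \<Rightarrow> 'f" where
  "word_sum \<phi> a = (\<Sum>w\<in>Poly_Mapping.keys a. Poly_Mapping.lookup a w * \<phi> (letters w))"

lemma word_sum_0: "word_sum \<phi> 0 = 0"
  by (simp add: word_sum_def)

lemma word_sum_superset:
  assumes "finite S" "Poly_Mapping.keys a \<subseteq> S"
  shows "word_sum \<phi> a = (\<Sum>w\<in>S. Poly_Mapping.lookup a w * \<phi> (letters w))"
  unfolding word_sum_def
  by (rule sum.mono_neutral_left) (use assms in \<open>auto simp: in_keys_iff\<close>)

lemma word_sum_add: "word_sum \<phi> (a + b) = word_sum \<phi> a + word_sum \<phi> b"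
proof -
  let ?S = "Poly_Mapping.keys a \<union> Poly_Mapping.keys b"
  have "word_sum \<phi> (a + b) = (\<Sum>w\<in>?S. Poly_Mapping.lookup (a + b) w * \<phi> (letters w))"
    by (rule word_sum_superset) (use Poly_Mapping.keys_add[of a b] in auto)
  also have "\<dots> = word_sum \<phi> a + word_sum \<phi> b"
    using word_sum_superset[of ?S a \<phi>] word_sum_superset[of ?S b \<phi>]
    by (simp add: lookup_add distrib_right sum.distrib)
  finally show ?thesis .
qed

lemma word_sum_word: "word_sum \<phi> (alg_const c * word w) = c * \<phi> w"
  by (simp add: word_sum_def word_def alg_const_mult)

lemma word_sum_alg_const: "word_sum \<phi> (alg_const c * a) = c * word_sum \<phi> a"
proof (induction a rule: free_alg_induct)
  case (word d w)
  have "alg_const c * (alg_const d * word w) = alg_const (c * d) * word w"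
    by (simp add: alg_const_def mult_single mult.assoc[symmetric])
  then show ?case by (simp add: word_sum_word)
qed (simp_all add: word_sum_add distrib_left word_sum_0)

lemma word_sum_diff: "word_sum \<phi> (a - b) = word_sum \<phi> a - word_sum \<phi> b"
  using word_sum_add[of \<phi> "a - b" b] by simp

section \<open>Classes in the enveloping algebra and forms on words\<close>

definition ue_class ::
  "('f::field \<Rightarrow> 'a::ab_group_add \<Rightarrow> 'a) \<Rightarrow> ('a \<Rightarrow> 'a \<Rightarrow> 'a) \<Rightarrow> ('a, 'f) free_alg \<Rightarrow> ('a, 'f) free_alg set"
  where "ue_class scale bracket a = ue_ideal scale bracket +>\<^bsub>free_alg_ring\<^esub> a"

lemma free_alg_ring_simps [simp]:
  "carrier free_alg_ring = UNIV" "a \<otimes>\<^bsub>free_alg_ring\<^esub> b = a * b" "a \<oplus>\<^bsub>free_alg_ring\<^esub> b = a + b"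
  "\<zero>\<^bsub>free_alg_ring\<^esub> = 0"
  by (simp_all add: free_alg_ring_def)

lemma free_alg_idealI:
  fixes J :: "('a, 'f::field) free_alg set"
  assumes "0 \<in> J" "\<And>a b. a \<in> J \<Longrightarrow> b \<in> J \<Longrightarrow> a + b \<in> J"
    and mult: "\<And>a b. a \<in> J \<Longrightarrow> b * a \<in> J" "\<And>a b. a \<in> J \<Longrightarrow> a * b \<in> J"
  shows "ideal J free_alg_ring"
proof (rule idealI[OF ring_free_alg_ring])
  interpret ring "free_alg_ring :: ('a, 'f) free_alg ring" by (rule ring_free_alg_ring)
  show "subgroup J (add_monoid free_alg_ring)"
  proof (rule add.subgroupI)
    fix a assume a: "a \<in> J"
    have "\<ominus>\<^bsub>free_alg_ring\<^esub> a = - a" using minus_equality[of "- a" a] by simp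
    moreover have "- a \<in> J" using mult(1)[OF a, of "- 1"] by simp
    ultimately show "\<ominus>\<^bsub>free_alg_ring\<^esub> a \<in> J" by simp
  qed (use assms in auto)
qed (use mult in auto)

lemma ue_class_simps:
  "carrier (ue_ring scale bracket) = range (ue_class scale bracket)"
  "ue_class scale bracket a \<otimes>\<^bsub>ue_ring scale bracket\<^esub> ue_class scale bracket b = ue_class scale bracket (a * b)"
  "ue_class scale bracket a \<oplus>\<^bsub>ue_ring scale bracket\<^esub> ue_class scale bracket b = ue_class scale bracket (a + b)"
  "ue_const scale bracket c = ue_class scale bracket (alg_const c)"
  "ue_gen scale bracket x = ue_class scale bracket (gen x)"
proof -
  interpret I: ideal "ue_ideal scale bracket" free_alg_ring by (rule ideal_ue_ideal)
  show "carrier (ue_ring scale bracket) = range (ue_class scale bracket)"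
    by (auto simp: ue_ring_def FactRing_def A_RCOSETS_def' ue_class_def)
  show "ue_class scale bracket a \<otimes>\<^bsub>ue_ring scale bracket\<^esub> ue_class scale bracket b = ue_class scale bracket (a * b)"
    by (simp add: ue_ring_def FactRing_def ue_class_def I.rcoset_mult_add)
  show "ue_class scale bracket a \<oplus>\<^bsub>ue_ring scale bracket\<^esub> ue_class scale bracket b = ue_class scale bracket (a + b)"
    by (simp add: ue_ring_def FactRing_def ue_class_def I.a_rcos_sum)
qed (simp_all add: ue_const_def ue_gen_def ue_class_def)

lemma ue_class_eq_iff:
  fixes scale :: "'f::field \<Rightarrow> 'a::ab_group_add \<Rightarrow> 'a"
  shows
  "ue_class scale bracket a = ue_class scale bracket b \<longleftrightarrow> a - b \<in> ue_ideal scale bracket"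
proof -
  interpret I: ideal "ue_ideal scale bracket" "free_alg_ring :: ('a, 'f) free_alg ring"
    by (rule ideal_ue_ideal)
  have "a \<ominus>\<^bsub>free_alg_ring\<^esub> b = a - b" for a b :: "('a, 'f) free_alg"
  proof -
    have "\<ominus>\<^bsub>free_alg_ring\<^esub> b = - b"
      using I.minus_equality[of "- b" b] by simp
    then show ?thesis by (simp add: a_minus_def)
  qed
  then show ?thesis
    unfolding ue_class_def using I.quotient_eq_iff_same_a_r_cos[OF ideal_ue_ideal, of a b] by simp
qed

lemma ue_relation_class_eq:
  fixes scale :: "'f::field \<Rightarrow> 'a::ab_group_add \<Rightarrow> 'a"
  shows
  "ue_class scale bracket (a * gen (x + y) * b) =
     ue_class scale bracket (a * gen x * b + a * gen y * b)"
  "ue_class scale bracket (a * gen (scale c x) * b) =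
     ue_class scale bracket (alg_const c * (a * gen x * b))"
  "ue_class scale bracket (a * (gen x * gen y) * b) =
     ue_class scale bracket (a * (gen y * gen x) * b + a * gen (bracket x y) * b)"
proof -
  interpret I: ideal "ue_ideal scale bracket" "free_alg_ring :: ('a, 'f) free_alg ring"
    by (rule ideal_ue_ideal)
  have rel: "a * r * b \<in> ue_ideal scale bracket" if "r \<in> ue_relations scale bracket" for r
  proof -
    have "r \<in> ue_ideal scale bracket"
      using that I.genideal_self[of "ue_relations scale bracket"] by (auto simp: ue_ideal_def)
    then show ?thesis using I.I_l_closed[of r a] I.I_r_closed[of "a * r" b] by simp
  qed
  show "ue_class scale bracket (a * gen (x + y) * b) =
     ue_class scale bracket (a * gen x * b + a * gen y * b)"
  proof -
    have "gen (x + y) - gen x - gen y \<in> ue_relations scale bracket"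
      unfolding ue_relations_def by blast
    from rel[OF this] show ?thesis by (simp add: ue_class_eq_iff algebra_simps)
  qed
  show "ue_class scale bracket (a * gen (scale c x) * b) =
     ue_class scale bracket (alg_const c * (a * gen x * b))"
  proof -
    have eq: "alg_const c * (a * gen x * b) = a * (alg_const c * gen x) * b"
      using alg_const_commute[of c a] by (simp add: mult.assoc[symmetric])
    have "gen (scale c x) - alg_const c * gen x \<in> ue_relations scale bracket"
      unfolding ue_relations_def by blast
    from rel[OF this] show ?thesis
      by (simp add: ue_class_eq_iff eq right_diff_distrib left_diff_distrib)
  qed
  show "ue_class scale bracket (a * (gen x * gen y) * b) =
     ue_class scale bracket (a * (gen y * gen x) * b + a * gen (bracket x y) * b)"
  proof -
    have "gen x * gen y - gen y * gen x - gen (bracket x y) \<in> ue_relations scale bracket"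
      unfolding ue_relations_def by blast
    from rel[OF this] show ?thesis by (simp add: ue_class_eq_iff algebra_simps)
  qed
qed

lemma ue_dualD:
  assumes "f \<in> ue_dual scale bracket"
  shows "f (ue_class scale bracket (a + b)) = f (ue_class scale bracket a) + f (ue_class scale bracket b)"
    "f (ue_class scale bracket (alg_const c * a)) = c * f (ue_class scale bracket a)"
    "Y \<notin> range (ue_class scale bracket) \<Longrightarrow> f Y = 0"
  using assms unfolding ue_dual_def Let_def
  by (force simp: ue_class_simps)+

context based_lie_algebra
begin

definition to_form :: "(('a, 'f) free_alg set \<Rightarrow> 'f) \<Rightarrow> 'a list \<Rightarrow> 'f" where
  "to_form f = (\<lambda>xs. f (ue_class scale bracket (word xs)))"

lemma to_form_linear: "Vector_Spaces.linear fun_scale fun_scale to_form"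
  by (simp add: Vector_Spaces.linear_iff fun_vs.vector_space_axioms to_form_def fun_eq_iff
      fun_scale_apply)

lemma ue_dual_eq_word_sum:
  assumes "f \<in> ue_dual scale bracket"
  shows "f (ue_class scale bracket a) = word_sum (to_form f) a"
proof (induction a rule: free_alg_induct)
  case zero
  show ?case using ue_dualD(2)[OF assms, of 0 0] by (simp add: word_sum_def)
qed (simp_all add: ue_dualD[OF assms] word_sum_add word_sum_word to_form_def)

lemma to_form_forms:
  assumes "f \<in> ue_dual scale bracket"
  shows "to_form f \<in> forms"
proof (rule formsI)
  fix u v :: "'a list" and x y :: 'a and c :: 'f
  have w: "word (u @ z # v) = word u * gen z * word v" for z
    by (simp only: gen_eq_word word_append[symmetric]) simp
  have w2: "word (u @ y # z # v) = word u * (gen y * gen z) * word v" for y z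
    by (simp only: gen_eq_word word_append[symmetric]) simp
  show "to_form f (u @ (x + y) # v) = to_form f (u @ x # v) + to_form f (u @ y # v)"
    "to_form f (u @ scale c x # v) = c * to_form f (u @ x # v)"
    unfolding to_form_def w by (simp_all add: ue_relation_class_eq(1,2) ue_dualD[OF assms])
  show "to_form f (u @ x # y # v) = to_form f (u @ y # x # v) + to_form f (u @ bracket x y # v)"
    unfolding to_form_def w w2 by (simp only: ue_relation_class_eq(3)[where x = x and y = y] ue_dualD[OF assms])
qed

lemma to_form_inj:
  assumes "f \<in> ue_dual scale bracket" "g \<in> ue_dual scale bracket" "to_form f = to_form g"
  shows "f = g"
proof
  fix Y show "f Y = g Y"
    using ue_dualD(3)[OF assms(1), of Y] ue_dualD(3)[OF assms(2), of Y]
      ue_dual_eq_word_sum[OF assms(1)] ue_dual_eq_word_sum[OF assms(2)] assms(3)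
    by (cases "Y \<in> range (ue_class scale bracket)") auto
qed

text \<open>The elements that \<phi> kills in every context of words form a two-sided ideal. It
  contains the relations because \<phi> is a form, hence also the ideal that they generate.\<close>

lemma word_sum_eq_0_on_ideal:
  assumes \<phi>: "\<phi> \<in> forms" and a: "a \<in> ue_ideal scale bracket"
  shows "word_sum \<phi> a = 0"
proof -
  define J where "J = {a. \<forall>u v. word_sum \<phi> (word u * a * word v) = 0}"
  have mult: "b * a \<in> J" "a * b \<in> J" if "a \<in> J" for a b
  proof -
    have "word_sum \<phi> (word u * (b * a) * word v) = 0 \<and> word_sum \<phi> (word u * (a * b) * word v) = 0" for u v
    proof (induction b rule: free_alg_induct)
      case (word c w)
      have "word u * (alg_const c * word w * a) * word v = alg_const c * (word (u @ w) * a * word v)"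
        "word u * (a * (alg_const c * word w)) * word v = alg_const c * (word u * a * word (w @ v))"
        using alg_const_commute[of c "word u"] alg_const_commute[of c "word u * a"]
        by (simp_all add: word_append mult.assoc[symmetric])
      then show ?case using that by (simp add: J_def word_sum_alg_const)
    qed (simp_all add: word_sum_add distrib_left distrib_right word_sum_0)
    then show "b * a \<in> J" "a * b \<in> J" by (simp_all add: J_def)
  qed
  have "ideal J free_alg_ring"
    by (rule free_alg_idealI)
      (use mult in \<open>auto simp: J_def word_sum_0 word_sum_add distrib_left distrib_right\<close>)
  moreover have "ue_relations scale bracket \<subseteq> J"
  proof
    fix r assume "r \<in> ue_relations scale bracket"
    have w: "word_sum \<phi> (word u * gen z * word v) = \<phi> (u @ z # v)"
      "word_sum \<phi> (word u * (alg_const c * gen z) * word v) = c * \<phi> (u @ z # v)"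
      "word_sum \<phi> (word u * (gen y * gen z) * word v) = \<phi> (u @ y # z # v)" for u v c y z
    proof -
      have eq: "word u * gen z * word v = alg_const 1 * word (u @ z # v)"
        "word u * (gen y * gen z) * word v = alg_const 1 * word (u @ y # z # v)" for z
        by (simp_all only: gen_eq_word word_append[symmetric] alg_const_1) simp_all
      have "word u * (alg_const c * gen z) * word v = alg_const c * (word u * gen z * word v)"
        using alg_const_commute[of c "word u"] by (simp add: mult.assoc[symmetric])
      then have eq_const: "word u * (alg_const c * gen z) * word v = alg_const c * word (u @ z # v)"
        by (simp add: eq(1) alg_const_1)
      show "word_sum \<phi> (word u * gen z * word v) = \<phi> (u @ z # v)"
        "word_sum \<phi> (word u * (alg_const c * gen z) * word v) = c * \<phi> (u @ z # v)"
        "word_sum \<phi> (word u * (gen y * gen z) * word v) = \<phi> (u @ y # z # v)"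
        unfolding eq eq_const word_sum_word by simp_all
    qed
    note simps = J_def right_diff_distrib left_diff_distrib word_sum_diff w
    from \<open>r \<in> _\<close> consider
      x y where "r = gen (x + y) - gen x - gen y"
      | x c where "r = gen (scale c x) - alg_const c * gen x"
      | x y where "r = gen x * gen y - gen y * gen x - gen (bracket x y)"
      unfolding ue_relations_def by blast
    then show "r \<in> J"
    proof cases
      case 1
      then show ?thesis by (simp add: simps formsD(1)[OF \<phi>])
    next
      case 2
      then show ?thesis by (simp add: simps formsD(2)[OF \<phi>])
    next
      case (3 x y)
      then show ?thesis by (simp add: simps formsD(3)[OF \<phi>, of _ x y])
    qed
  qed
  ultimately have "ue_ideal scale bracket \<subseteq> J"
    unfolding ue_ideal_def by (rule ring.genideal_minimal[OF ring_free_alg_ring])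
  then have "word_sum \<phi> (word [] * a * word []) = 0" using a unfolding J_def by blast
  then show ?thesis by (simp add: word_Nil)
qed

lemma to_form_surj:
  assumes "\<phi> \<in> forms"
  obtains f where "f \<in> ue_dual scale bracket" "to_form f = \<phi>"
proof -
  let ?cl = "ue_class scale bracket"
  \<comment> \<open>Any representative serves, because two of them differ by an element of the
    ideal, where \<open>word_sum \<phi>\<close> vanishes.\<close>
  define f where "f Y = (if Y \<in> range ?cl then word_sum \<phi> (SOME a. ?cl a = Y) else 0)" for Y
  have f: "f (?cl a) = word_sum \<phi> a" for a
  proof -
    have "?cl (SOME b. ?cl b = ?cl a) = ?cl a" by (rule someI) (rule refl)
    then have "word_sum \<phi> ((SOME b. ?cl b = ?cl a) - a) = 0"
      by (intro word_sum_eq_0_on_ideal[OF assms]) (simp add: ue_class_eq_iff)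
    then show ?thesis by (simp add: f_def word_sum_diff)
  qed
  have "f \<in> ue_dual scale bracket"
    unfolding ue_dual_def Let_def
    by (auto simp: ue_class_simps f word_sum_add word_sum_alg_const) (auto simp: f_def)
  moreover have "to_form f = \<phi>"
    using word_sum_word[of \<phi> 1] by (simp add: to_form_def f alg_const_def fun_eq_iff)
  ultimately show ?thesis by (rule that)
qed

lemma to_form_coregular: "to_form (coregular scale bracket x f) = snoc_op x (to_form f)"
  by (simp add: to_form_def snoc_op_def coregular_def left_act_def Let_def ue_class_simps
      gen_eq_word word_append[symmetric])

lemma to_form_act:
  assumes "f \<in> ue_dual scale bracket"
  shows "to_form (left_act scale bracket (ue_class scale bracket a) f) =
      (\<Sum>w\<in>Poly_Mapping.keys a. fun_scale (Poly_Mapping.lookup a w) (\<lambda>xs. to_form f (xs @ letters w)))"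
    "to_form (right_act scale bracket f (ue_class scale bracket a)) =
      (\<Sum>w\<in>Poly_Mapping.keys a. fun_scale (Poly_Mapping.lookup a w) (\<lambda>xs. to_form f (letters w @ xs)))"
proof -
  have "word_sum \<phi> (word xs * a) = word_sum (\<lambda>ys. \<phi> (xs @ ys)) a \<and>
      word_sum \<phi> (a * word xs) = word_sum (\<lambda>ys. \<phi> (ys @ xs)) a" for \<phi> xs
  proof (induction a rule: free_alg_induct)
    case (word c w)
    have "word xs * (alg_const c * word w) = alg_const c * word (xs @ w)"
      "alg_const c * word w * word xs = alg_const c * word (w @ xs)"
      using alg_const_commute[of c "word xs"]
      by (simp_all add: word_append mult.assoc[symmetric])
    then show ?case by (simp add: word_sum_word)
  qed (simp_all add: word_sum_add distrib_left distrib_right word_sum_0)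
  moreover have "to_form (left_act scale bracket (ue_class scale bracket a) f) xs =
      word_sum (to_form f) (word xs * a)"
    "to_form (right_act scale bracket f (ue_class scale bracket a)) xs =
      word_sum (to_form f) (a * word xs)" for xs
    using ue_dual_eq_word_sum[OF assms, of "word xs * a"] ue_dual_eq_word_sum[OF assms, of "a * word xs"]
    by (simp_all add: to_form_def left_act_def right_act_def Let_def ue_class_simps)
  ultimately show "to_form (left_act scale bracket (ue_class scale bracket a) f) =
      (\<Sum>w\<in>Poly_Mapping.keys a. fun_scale (Poly_Mapping.lookup a w) (\<lambda>xs. to_form f (xs @ letters w)))"
    "to_form (right_act scale bracket f (ue_class scale bracket a)) =
      (\<Sum>w\<in>Poly_Mapping.keys a. fun_scale (Poly_Mapping.lookup a w) (\<lambda>xs. to_form f (letters w @ xs)))"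
    by (simp_all add: fun_eq_iff sum_apply fun_scale_apply word_sum_def[of _ a])
qed

text \<open>The enveloping algebra is generated by the Lie algebra, so stability under one letter at
  either end is enough; \<open>contract\<close> is the right coregular action of a letter.\<close>

lemma sub_bimodule_vimage:
  assumes N: "fun_vs.subspace N" "N \<subseteq> forms"
    and snoc: "\<And>x \<phi>. \<phi> \<in> N \<Longrightarrow> snoc_op x \<phi> \<in> N"
    and cons: "\<And>x \<phi>. \<phi> \<in> N \<Longrightarrow> contract x \<phi> \<in> N"
  shows "sub_bimodule scale bracket {f \<in> ue_dual scale bracket. to_form f \<in> N}"
proof -
  note D = ue_dual_sub_bimodule[of scale bracket]
  then have D_sub: "fun_vs.subspace (ue_dual scale bracket)" by (simp add: sub_bimodule_def)
  have app: "(\<lambda>xs. \<phi> (xs @ w)) \<in> N" "(\<lambda>xs. \<phi> (w @ xs)) \<in> N" if "\<phi> \<in> N" for \<phi> w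
  proof -
    show "(\<lambda>xs. \<phi> (xs @ w)) \<in> N"
    proof (induction w)
      case (Cons x w)
      show ?case using snoc[OF Cons, of x] by (simp add: snoc_op_def)
    qed (use that in simp)
    show "(\<lambda>xs. \<phi> (w @ xs)) \<in> N"
      using that
    proof (induction w arbitrary: \<phi>)
      case (Cons x w)
      show ?case using Cons.IH[OF cons[OF Cons.prems, of x]] by (simp add: contract_def)
    qed simp
  qed
  show ?thesis
    unfolding sub_bimodule_def
  proof (intro conjI ballI)
    show "fun_vs.subspace {f \<in> ue_dual scale bracket. to_form f \<in> N}"
      using fun_vs.subspace_0[OF N(1)] fun_vs.subspace_0[OF D_sub]
      by (intro fun_vs.subspaceI)
        (auto simp: linearD[OF to_form_linear] intro: fun_vs.subspace_add fun_vs.subspace_scale N D_sub)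
    fix u f assume u: "u \<in> carrier (ue_ring scale bracket)"
      and f: "f \<in> {f \<in> ue_dual scale bracket. to_form f \<in> N}"
    then obtain a where a: "u = ue_class scale bracket a" by (auto simp: ue_class_simps)
    have f: "f \<in> ue_dual scale bracket" "to_form f \<in> N" using f by auto
    have "left_act scale bracket u f \<in> ue_dual scale bracket"
      "right_act scale bracket f u \<in> ue_dual scale bracket"
      using D u f unfolding sub_bimodule_def by blast+
    moreover have "to_form (left_act scale bracket u f) \<in> N" "to_form (right_act scale bracket f u) \<in> N"
      unfolding a to_form_act[OF f(1)]
      by (intro fun_vs.subspace_sum[OF N(1)] fun_vs.subspace_scale[OF N(1)] app f)+
    ultimately show "left_act scale bracket u f \<in> {f \<in> ue_dual scale bracket. to_form f \<in> N}"
      "right_act scale bracket f u \<in> {f \<in> ue_dual scale bracket. to_form f \<in> N}" by auto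
  qed auto
qed

end

section \<open>The continuous dual\<close>

text \<open>Each point \<open>s\<close> of \<open>S\<close> accounts for at most one dimension: a
  function of \<open>V\<close> not vanishing at \<open>s\<close> spans a complement of the kernel of
  evaluation at \<open>s\<close>.\<close>

lemma finite_dim_if_separated:
  assumes "finite S" "fun_vs.subspace V" "\<And>f. f \<in> V \<Longrightarrow> (\<And>s. s \<in> S \<Longrightarrow> f s = 0) \<Longrightarrow> f = 0"
  shows "finite_dim fun_scale V"
  using assms
proof (induction S arbitrary: V)
  case empty
  have "f = 0" if "f \<in> V" for f by (rule empty.prems(2)[OF that]) simp
  then have "V = fun_vs.span {}" using fun_vs.subspace_0[OF empty.prems(1)] by auto
  then show ?case unfolding finite_dim_def by blast
next
  case (insert s S)
  let ?W = "{f \<in> V. f s = 0}"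
  have "finite_dim fun_scale ?W"
  proof (rule insert.IH)
    show "fun_vs.subspace ?W"
      by (rule fun_vs.subspaceI)
        (simp_all add: fun_vs.subspace_0 fun_vs.subspace_add fun_vs.subspace_scale insert.prems(1)
          fun_scale_apply)
    show "f = 0" if "f \<in> ?W" "\<And>t. t \<in> S \<Longrightarrow> f t = 0" for f
      by (rule insert.prems(2)) (use that in auto)
  qed
  then obtain B where B: "finite B" "?W = fun_vs.span B" by (auto simp: finite_dim_def)
  show ?case
  proof (cases "\<exists>g\<in>V. g s \<noteq> 0")
    case False
    then have "V = ?W" by auto
    then show ?thesis using B unfolding finite_dim_def by metis
  next
    case True
    then obtain g where g: "g \<in> V" "g s \<noteq> 0" by blast
    have "V \<subseteq> fun_vs.span (insert g B)"
    proof
      fix f assume f: "f \<in> V"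
      have "f - fun_scale (f s / g s) g \<in> ?W"
        using g f by (simp add: fun_vs.subspace_diff fun_vs.subspace_scale insert.prems(1) fun_scale_apply)
      then have "f - fun_scale (f s / g s) g \<in> fun_vs.span (insert g B)"
        unfolding B(2) using fun_vs.span_mono[of B "insert g B"] by blast
      then have "(f - fun_scale (f s / g s) g) + fun_scale (f s / g s) g \<in> fun_vs.span (insert g B)"
        by (rule fun_vs.span_add) (intro fun_vs.span_scale fun_vs.span_base, simp)
      then show "f \<in> fun_vs.span (insert g B)" by simp
    qed
    moreover have "fun_vs.span (insert g B) \<subseteq> V"
      by (rule fun_vs.span_minimal[OF _ insert.prems(1)])
        (use g fun_vs.span_superset[of B] B(2) in auto)
    ultimately show ?thesis using B(1) unfolding finite_dim_def by (metis antisym finite.insertI)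
  qed
qed

context based_lie_algebra
begin

text \<open>The operators (ad x)^(p^j) all lie in the span of finitely many elementary operators, so
  one of them is a combination of its predecessors. That relation, read as a polynomial, is additive
  and monic.\<close>

lemma additive_annihilator_exists:
  assumes p: "Factorial_Ring.prime CHAR('f)"
  obtains P where "additive_poly P" "lead_coeff P = 1" "degree P > 0"
    "\<And>y. opoly scale P (bracket x) y = 0"
proof -
  let ?p = "CHAR('f)" and ?T = "\<lambda>j. bracket x ^^ (CHAR('f) ^ j)"
  interpret L: vector_space "pointwise scale :: 'f \<Rightarrow> ('a \<Rightarrow> 'a) \<Rightarrow> _"
    by (rule vector_space_pointwise) (rule vector_space_axioms)
  \<comment> \<open>The matrix units of the basis.\<close>
  define E where "E = (\<lambda>(k, l) y. scale (coord y k) (e l))"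
  have "?T j \<in> L.span (E ` ({..<m} \<times> {..<m}))" for j
  proof -
    let ?A = "?T j"
    have A: "Vector_Spaces.linear scale scale ?A" by (rule funpow_linear[OF linear_right])
    have eq: "?A y = (\<Sum>k<m. \<Sum>l<m. pointwise scale (coord (?A (e k)) l) (E (k, l)) y)" for y
    proof -
      have "?A y = ?A (\<Sum>k<m. scale (coord y k) (e k))" by (simp add: expand)
      also have "\<dots> = (\<Sum>k<m. scale (coord y k) (?A (e k)))"
        by (simp only: linear_sumD[OF A] linear_scaleD[OF A])
      also have "\<dots> = (\<Sum>k<m. scale (coord y k) (\<Sum>l<m. scale (coord (?A (e k)) l) (e l)))"
        by (simp only: expand)
      finally show ?thesis
        by (simp add: scale_sum_right E_def pointwise_apply mult.commute)
    qed
    have "?A = (\<Sum>k<m. \<Sum>l<m. pointwise scale (coord (?A (e k)) l) (E (k, l)))"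
      by (intro ext, simp only: sum_apply, rule eq)
    moreover have "(\<Sum>k<m. \<Sum>l<m. pointwise scale (coord (?A (e k)) l) (E (k, l)))
        \<in> L.span (E ` ({..<m} \<times> {..<m}))"
      by (intro L.span_sum L.span_scale L.span_base) auto
    ultimately show ?thesis by simp
  qed
  moreover have "finite_dim (pointwise scale) (L.span (E ` ({..<m} \<times> {..<m})))"
    unfolding finite_dim_def
    by (intro exI[of _ "E ` ({..<m} \<times> {..<m})"] conjI refl finite_imageI
        finite_cartesian_product finite_lessThan)
  ultimately obtain J c where J: "?T J = (\<Sum>j<J. pointwise scale (c j) (?T j))"
    using L.finite_dim_sequence_dependent[where v = ?T] by blast
  define P where "P = Polynomial.monom 1 (?p ^ J) - (\<Sum>j<J. Polynomial.monom (c j) (?p ^ j))"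
  have coeff: "coeff P i = (if ?p ^ J = i then 1 else 0) - (\<Sum>j<J. if ?p ^ j = i then c j else 0)" for i
    by (simp add: P_def coeff_sum)
  have p1: "1 < ?p" using prime_gt_1_nat[OF p] .
  have top: "coeff P (?p ^ J) = 1"
  proof -
    have "(\<Sum>j<J. if ?p ^ j = ?p ^ J then c j else 0) = 0"
      by (rule sum.neutral) (use p1 in auto)
    then show ?thesis by (simp add: coeff)
  qed
  have above: "coeff P i = 0" if "?p ^ J < i" for i
  proof -
    have "?p ^ j \<noteq> i" if "j < J" for j
      using that \<open>?p ^ J < i\<close> power_strict_increasing[OF that p1] by simp
    then have "(\<Sum>j<J. if ?p ^ j = i then c j else 0) = 0" by (intro sum.neutral) auto
    then show ?thesis using that by (simp add: coeff)
  qed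
  have deg: "degree P = ?p ^ J"
    by (rule antisym) (use top above in \<open>auto intro!: degree_le le_degree\<close>)
  have additive: "additive_poly P"
    unfolding additive_poly_def
  proof (intro allI impI, rule ccontr)
    fix i assume "coeff P i \<noteq> 0" and none: "\<nexists>j. i = ?p ^ j"
    then have "?p ^ j \<noteq> i" for j by metis
    then show False using \<open>coeff P i \<noteq> 0\<close> by (simp add: coeff)
  qed
  have zero: "opoly scale P (bracket x) y = 0" for y
    using fun_cong[OF J, of y]
    by (simp add: P_def opoly_diff opoly_sum opoly_monom sum_apply pointwise_apply)
  \<comment> \<open>The degree is a power of p, hence positive even for \<open>J = 0\<close>;
    \<open>lead_coeff_comp\<close> will rely on this.\<close>
  show ?thesis
    by (rule that[OF additive _ _ zero]) (use deg p1 in \<open>simp_all add: top\<close>)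
qed

lemma coregular_linear: "Vector_Spaces.linear fun_scale fun_scale (coregular scale bracket x)"
  by (rule fun_vs.linearI')
    (auto simp: coregular_def left_act_def Let_def fun_eq_iff fun_scale_def)

lemma continuous_dual_subset: "continuous_dual scale bracket \<subseteq> ue_dual scale bracket"
  using continuous_dual_greatest(1)[of scale bracket] by (simp add: sub_bimodule_def)

lemma coregular_closed:
  assumes "sub_bimodule scale bracket N" "f \<in> N"
  shows "coregular scale bracket x f \<in> N"
  using assms by (simp add: sub_bimodule_def coregular_def ue_class_simps)

lemma lie_module_continuous_dual:
  "lie_module scale bracket fun_scale (continuous_dual scale bracket) (coregular scale bracket)"
proof (rule lie_module.intro[OF lie_algebra_axioms fun_vs.vector_space_axioms], unfold_locales)
  show "fun_vs.subspace (continuous_dual scale bracket)"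
    using continuous_dual_greatest(1)[of scale bracket] by (simp add: sub_bimodule_def)
  fix f x y a assume f: "f \<in> continuous_dual scale bracket"
  show closed: "coregular scale bracket x f \<in> continuous_dual scale bracket"
    by (rule coregular_closed[OF continuous_dual_greatest(1) f])
  note D = ue_dual_sub_bimodule[of scale bracket]
  have fD: "f \<in> ue_dual scale bracket" using f continuous_dual_subset by blast
  have D_sub: "fun_vs.subspace (ue_dual scale bracket)" using D by (simp add: sub_bimodule_def)
  note closed = coregular_closed[OF D] fun_vs.subspace_add[OF D_sub] fun_vs.subspace_diff[OF D_sub]
    fun_vs.subspace_scale[OF D_sub]
  note F = to_form_forms[OF fD]
  show "coregular scale bracket (x + y) f = coregular scale bracket x f + coregular scale bracket y f"
    by (rule to_form_inj)
      (simp_all add: closed fD to_form_coregular linearD[OF to_form_linear] forms.act_add_left[OF F])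
  show "coregular scale bracket (scale a x) f = fun_scale a (coregular scale bracket x f)"
    by (rule to_form_inj)
      (simp_all add: closed fD to_form_coregular linearD[OF to_form_linear] forms.act_scale_left[OF F])
  show "coregular scale bracket (bracket x y) f = coregular scale bracket x (coregular scale bracket y f)
      - coregular scale bracket y (coregular scale bracket x f)"
    by (rule to_form_inj)
      (simp_all add: closed fD to_form_coregular linearD[OF to_form_linear] forms.act_bracket[OF F])
qed (simp_all add: linearD[OF coregular_linear])

section \<open>Central annihilators and the continuous dual\<close>

lemma to_form_opoly:
  "to_form (opoly fun_scale H (coregular scale bracket (e k)) f) = op H k (to_form f)"
  unfolding op_def
  by (rule opoly_intertwine[OF to_form_linear, where V = UNIV]) (simp_all add: to_form_coregular)

lemma contract_forms: "\<phi> \<in> forms \<Longrightarrow> contract x \<phi> \<in> forms"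
proof (rule formsI)
  assume \<phi>: "\<phi> \<in> forms"
  fix u v y z a
  show "contract x \<phi> (u @ (y + z) # v) = contract x \<phi> (u @ y # v) + contract x \<phi> (u @ z # v)"
    "contract x \<phi> (u @ scale a y # v) = a * contract x \<phi> (u @ y # v)"
    "contract x \<phi> (u @ y # z # v) = contract x \<phi> (u @ z # y # v) + contract x \<phi> (u @ bracket y z # v)"
    using formsD(1,2)[OF \<phi>, of "x # u"] formsD(3)[OF \<phi>, of "x # u" y z v]
    by (simp_all add: contract_def)
qed

text \<open>By centrality all forms killed by the given polynomials make up a sub-bimodule
  \<open>N\<close>. Finitely many monomials separate its elements by
  \<open>op_annihilated_eq_0I\<close>, so \<open>N\<close> is finite-dimensional and hence locally
  finite.\<close>

lemma continuous_dualI: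
  assumes H: "\<And>j. j < m \<Longrightarrow> central (H j) j \<and> lead_coeff (H j) = 1 \<and> op (H j) j (to_form f) = 0"
    and f: "f \<in> ue_dual scale bracket"
  shows "f \<in> continuous_dual scale bracket"
proof -
  define K where "K = {\<phi> \<in> forms. \<forall>j<m. op (H j) j \<phi> = 0}"
  define N where "N = {f \<in> ue_dual scale bracket. to_form f \<in> K}"
  have N: "sub_bimodule scale bracket N"
    unfolding N_def
  proof (rule sub_bimodule_vimage)
    show "fun_vs.subspace K"
      by (rule fun_vs.subspaceI) (auto simp: K_def forms.M_simps linearD[OF op_linear])
    fix x \<phi> assume \<phi>: "\<phi> \<in> K"
    then show "snoc_op x \<phi> \<in> K"
      using H unfolding K_def central_def by (auto simp: forms.act_closed forms.act_simps)
    \<comment> \<open>Left and right coregular actions commute, as they add letters at opposite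
      ends.\<close>
    have "op (H j) j (contract x \<phi>) w = op (H j) j \<phi> (x # w)" for j w
      by (simp add: op_apply contract_def)
    with \<phi> show "contract x \<phi> \<in> K" by (auto simp: K_def contract_forms fun_eq_iff)
  qed (auto simp: K_def)
  have N_sub: "fun_vs.subspace N" using N by (simp add: sub_bimodule_def)
  let ?A = "\<Pi>\<^sub>E j\<in>{..<m}. {..<degree (H j)}"
  have "finite_dim fun_scale N"
  proof (rule finite_dim_if_separated[OF _ N_sub])
    show "finite ((\<lambda>\<alpha>. ue_class scale bracket (word (map e (monomial \<alpha>)))) ` ?A)"
      by (intro finite_imageI finite_PiE) auto
    fix g assume g: "g \<in> N"
      and zero: "\<And>s. s \<in> (\<lambda>\<alpha>. ue_class scale bracket (word (map e (monomial \<alpha>)))) ` ?A \<Longrightarrow> g s = 0"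
    have "to_form g = 0"
    proof (rule op_annihilated_eq_0I)
      show "central (H j) j \<and> lead_coeff (H j) = 1 \<and> op (H j) j (to_form g) = 0" if "j < m" for j
        using H[OF that] g that by (simp add: N_def K_def)
      show "to_form g \<in> forms" using g by (simp add: N_def K_def)
      fix \<alpha> assume "\<And>j. j < m \<Longrightarrow> \<alpha> j < degree (H j)"
      \<comment> \<open>Restriction to \<open>{..<m}\<close> puts the exponent function into a
        finite set without changing the monomial.\<close>
      then have "restrict \<alpha> {..<m} \<in> ?A" by auto
      moreover have "monomial (restrict \<alpha> {..<m}) = monomial \<alpha>"
        by (rule monomial_segment_cong) simp
      ultimately show "to_form g (map e (monomial \<alpha>)) = 0"
        using zero unfolding to_form_def by (metis image_eqI)
    qed
    moreover have "to_form 0 = 0" by (rule linear_zeroD[OF to_form_linear])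
    moreover have "0 \<in> ue_dual scale bracket"
      using N_sub fun_vs.subspace_0 by (auto simp: N_def)
    ultimately show "g = 0" using g by (intro to_form_inj) (simp_all add: N_def)
  qed
  then have "finite_dim fun_scale (sub_bimodule scale bracket hull S)" if "S \<subseteq> N" for S
  proof (rule finite_dim_subset)
    have "sub_bimodule scale bracket (sub_bimodule scale bracket hull S)"
      by (rule sub_bimodule_hull) (use that in \<open>auto simp: N_def\<close>)
    then show "fun_vs.subspace (sub_bimodule scale bracket hull S)" by (simp add: sub_bimodule_def)
    show "sub_bimodule scale bracket hull S \<subseteq> N" by (rule hull_minimal) (use that N in auto)
  qed
  then have "locally_finite scale bracket N" by (simp add: locally_finite_def)
  then have "N \<subseteq> continuous_dual scale bracket" by (rule continuous_dual_greatest(3)[OF N])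
  moreover have "f \<in> N" using f H to_form_forms[OF f] by (simp add: N_def K_def)
  ultimately show ?thesis by blast
qed

text \<open>The sub-bimodule generated by \<open>f\<close> is finite-dimensional and stable under
  P(x), so the iterates of \<open>f\<close> under P(x) satisfy a monic relation.\<close>

lemma continuous_dual_annihilator:
  assumes "f \<in> continuous_dual scale bracket"
  obtains H where "lead_coeff H = 1"
    "opoly fun_scale H (opoly fun_scale P (coregular scale bracket x)) f = 0"
proof -
  let ?V = "sub_bimodule scale bracket hull {f}"
  have V: "sub_bimodule scale bracket ?V"
    using assms continuous_dual_subset by (intro sub_bimodule_hull) auto
  then have V_sub: "fun_vs.subspace ?V" by (simp add: sub_bimodule_def)
  have "finite_dim fun_scale ?V" by (rule hull_finite_dim) (use assms in auto)
  moreover have "opoly fun_scale P (coregular scale bracket x) g \<in> ?V" if "g \<in> ?V" for g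
    by (rule fun_vs.opoly_closed[OF V_sub _ that]) (rule coregular_closed[OF V])
  moreover have "f \<in> ?V" by (simp add: hull_inc)
  ultimately show ?thesis using fun_vs.finite_dim_annihilator that by metis
qed

lemma op_pcompose: "op (pcompose H P) i \<phi> = opoly fun_scale H (op P i) \<phi>"
  unfolding op_def by (rule fun_vs.opoly_pcompose[OF forms.act_linear])

text \<open>Polynomials in a central element are central; such compositions are the witnesses later
  passed to \<open>continuous_dualI\<close>.\<close>

lemma central_pcompose:
  assumes "central P i"
  shows "central (pcompose H P) i"
  unfolding central_def op_pcompose
proof (intro ballI allI)
  fix \<phi> x assume "\<phi> \<in> forms"
  then show "opoly fun_scale H (op P i) (snoc_op x \<phi>) = snoc_op x (opoly fun_scale H (op P i) \<phi>)"
    by (intro opoly_intertwine[OF forms.act_linear, where V = forms, symmetric])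
      (use assms in \<open>simp_all add: op_closed central_def\<close>)
qed

text \<open>The work lies in the hypothesis \<open>surj\<close> of \<open>cocycle_exact\<close>: a
  preimage found in the full dual has to be placed in the kernels of the earlier z_j and in the
  continuous dual.\<close>

theorem continuous_dual_cocycle_exact:
  assumes p: "Factorial_Ring.prime CHAR('f)"
    and c: "c \<in> cochains scale fun_scale (continuous_dual scale bracket) (Suc n)"
    and dc: "ce_diff bracket fun_scale (coregular scale bracket) c = 0"
  shows "c \<in> ce_diff bracket fun_scale (coregular scale bracket) `
    cochains scale fun_scale (continuous_dual scale bracket) n"
proof -
  let ?cd = "continuous_dual scale bracket" and ?act = "coregular scale bracket"
  interpret M: lie_module scale bracket fun_scale ?cd ?act
    by (rule lie_module_continuous_dual)
  have span: "span (e ` {..<m}) = UNIV"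
  proof -
    have "(\<Sum>k<m. scale (coord x k) (e k)) \<in> span (e ` {..<m})" for x
      by (intro span_sum span_scale span_base) auto
    then show ?thesis by (auto simp: expand)
  qed
  define P where "P k = (SOME P. additive_poly P \<and> lead_coeff P = 1 \<and> degree P > 0 \<and>
      (\<forall>y. opoly scale P (bracket (e k)) y = 0))" for k
  have P: "additive_poly (P k)" "lead_coeff (P k) = 1" "degree (P k) > 0"
    "opoly scale (P k) (bracket (e k)) y = 0" for k y
  proof -
    obtain Q where "additive_poly Q \<and> lead_coeff Q = 1 \<and> degree Q > 0 \<and>
        (\<forall>y. opoly scale Q (bracket (e k)) y = 0)"
      using additive_annihilator_exists[OF p, of "e k"] by metis
    from someI[where P = "\<lambda>P. additive_poly P \<and> lead_coeff P = 1 \<and> degree P > 0 \<and>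
        (\<forall>y. opoly scale P (bracket (e k)) y = 0)", OF this]
    show "additive_poly (P k)" "lead_coeff (P k) = 1" "degree (P k) > 0"
      "opoly scale (P k) (bracket (e k)) y = 0"
      unfolding P_def by blast+
  qed
  have central: "central (P k) k" for k
    unfolding central_def op_def using forms.opoly_act_commute[OF P(1) p P(4)] by blast
  define Z where "Z k = opoly fun_scale (P k) (?act (e k))" for k
  have to_form_Z: "to_form (Z k f) = op (P k) k (to_form f)" for k f
    unfolding Z_def by (rule to_form_opoly)
  have D_sub: "fun_vs.subspace (ue_dual scale bracket)"
    using ue_dual_sub_bimodule[of scale bracket] by (simp add: sub_bimodule_def)
  have Z_dual: "Z k f \<in> ue_dual scale bracket" if "f \<in> ue_dual scale bracket" for k f
    unfolding Z_def by (rule fun_vs.opoly_closed[OF D_sub _ that])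
      (rule coregular_closed[OF ue_dual_sub_bimodule])
  have surj: "\<exists>g\<in>?cd. (\<forall>j<k. Z j g = 0) \<and> Z k g = f"
    if k: "k < m" and f: "f \<in> ?cd" and Zf: "\<forall>j<k. Z j f = 0" for k f
  proof -
    have fD: "f \<in> ue_dual scale bracket" using f continuous_dual_subset by blast
    obtain \<chi> where \<chi>: "\<chi> \<in> forms" "op (P k) k \<chi> = to_form f"
      "\<And>\<alpha>. \<alpha> k < degree (P k) \<Longrightarrow> \<chi> (map e (monomial \<alpha>)) = 0"
      using op_surjective[OF central P(2) k to_form_forms[OF fD]] by metis
    obtain g where g: "g \<in> ue_dual scale bracket" "to_form g = \<chi>"
      by (rule to_form_surj[OF \<chi>(1)])
    \<comment> \<open>Used twice: with \<open>P j\<close> it keeps the preimage in K_k, and with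
      h_j(P_j) it keeps it in the continuous dual.\<close>
    have transfer: "op H j \<chi> = 0" if "central H j" "j < m" "j \<noteq> k" "op H j (to_form f) = 0" for H j
      using op_eq_0_transfer[OF central P(2) that(1) k that(2) _ \<chi>(1,3)] that \<chi>(2) by auto
    have zero: "0 \<in> ue_dual scale bracket" "to_form 0 = 0"
      using fun_vs.subspace_0[OF D_sub] linear_zeroD[OF to_form_linear] by auto
    have "Z k g = f"
      by (rule to_form_inj[OF Z_dual[OF g(1)] fD]) (simp add: to_form_Z g(2) \<chi>(2))
    moreover have "Z j g = 0" if "j < k" for j
    proof (rule to_form_inj[OF Z_dual[OF g(1)] zero(1)])
      have "op (P j) j (to_form f) = 0" using Zf that to_form_Z[of j f] zero(2) by simp
      then show "to_form (Z j g) = to_form 0"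
        using that k transfer[OF central, of j] by (simp add: to_form_Z g(2) zero(2))
    qed
    moreover have "g \<in> ?cd"
    proof -
      have "\<exists>H. lead_coeff H = 1 \<and> opoly fun_scale H (Z j) f = 0" for j
        using continuous_dual_annihilator[OF f, of "P j" "e j"] unfolding Z_def by metis
      then obtain h where h: "\<And>j. lead_coeff (h j) = 1" "\<And>j. opoly fun_scale (h j) (Z j) f = 0"
        by metis
      have h_form: "opoly fun_scale (h j) (op (P j) j) (to_form f) = 0" for j
      proof -
        have "to_form (opoly fun_scale (h j) (Z j) f) = opoly fun_scale (h j) (op (P j) j) (to_form f)"
          by (rule opoly_intertwine[OF to_form_linear, where V = UNIV]) (simp_all add: to_form_Z)
        then show ?thesis by (simp add: h(2) zero(2))
      qed
      \<comment> \<open>For \<open>j = k\<close> one more factor z_k is needed: z_k sends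
        \<open>g\<close> to \<open>f\<close>, which h_k(z_k) kills.\<close>
      define H where "H j = pcompose (if j = k then h k * [:0, 1:] else h j) (P j)" for j
      show ?thesis
      proof (rule continuous_dualI[OF _ g(1)], intro conjI)
        fix j assume j: "j < m"
        show cen: "central (H j) j" unfolding H_def by (rule central_pcompose[OF central])
        have "lead_coeff (h k * [:0, 1:]) = 1" by (simp only: lead_coeff_mult h) simp
        then show "lead_coeff (H j) = 1"
          unfolding H_def lead_coeff_comp[OF P(3)] by (simp add: P(2) h(1))
        show "op (H j) j (to_form g) = 0"
        proof (cases "j = k")
          case True
          have "op (H k) k \<chi> = opoly fun_scale (h k) (op (P k) k) (opoly fun_scale [:0, 1:] (op (P k) k) \<chi>)"
            by (simp only: H_def op_pcompose if_True refl fun_vs.opoly_mult[OF op_linear])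
          also have "opoly fun_scale [:0, 1:] (op (P k) k) \<chi> = to_form f"
            by (simp add: fun_vs.opoly_pCons[OF op_linear] \<chi>(2) linearD[OF op_linear])
          finally have "op (H k) k \<chi> = 0" unfolding h_form .
          then show ?thesis unfolding True g(2) .
        next
          case False
          have "op (H j) j (to_form f) = 0" using False by (simp add: H_def op_pcompose h_form)
          then show ?thesis using transfer[OF cen j False] by (simp add: g(2))
        qed
      qed
    qed
    ultimately show ?thesis by blast
  qed
  have "M.dd c = 0" using M.ce_diff_eq_dd[OF c] dc by simp
  then obtain b where b: "b \<in> M.C n" "c = M.dd b"
    using M.cocycle_exact[OF p span, of P, folded Z_def] P surj c by blast
  then show ?thesis using M.ce_diff_eq_dd[OF b(1)] by (metis image_eqI)
qed

end

section \<open>Choice of a basis and passage to the cohomology group\<close>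

lemma (in finite_dimensional_lie_algebra) based_lie_algebra_exists:
  obtains e coord m where "based_lie_algebra scale bracket e coord m"
proof -
  obtain B0 where B0: "finite B0" "UNIV = span B0" using finite_dim_UNIV by (auto simp: finite_dim_def)
  obtain B where B: "independent B" "UNIV \<subseteq> span B"
    using maximal_independent_subset[of UNIV] by auto
  have fin: "finite B" using independent_span_bound[OF B0(1) B(1)] B0(2) by auto
  obtain h where h: "bij_betw h {..<card B} B"
    using ex_bij_betw_nat_finite[OF fin] by (auto simp: atLeast0LessThan)
  have span: "x \<in> span B" for x using B(2) by auto
  have "based_lie_algebra scale bracket h (\<lambda>x k. representation B x (h k)) (card B)"
  proof unfold_locales
    fix x y a k i j
    have "(\<Sum>k<card B. scale (representation B x (h k)) (h k)) = (\<Sum>b\<in>B. scale (representation B x b) b)"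
      by (rule sum.reindex_bij_betw[OF h])
    then show "(\<Sum>k<card B. scale (representation B x (h k)) (h k)) = x"
      using sum_representation_eq[OF B(1) span fin order_refl] by simp
    show "representation B (x + y) (h k) = representation B x (h k) + representation B y (h k)"
      "representation B (scale a x) (h k) = a * representation B x (h k)"
      using representation_add[OF B(1) span span] representation_scale[OF B(1) span] by auto
    assume ij: "i < card B" "j < card B"
    then have "h i \<in> B" using h by (auto simp: bij_betw_def)
    moreover have "h j = h i \<longleftrightarrow> i = j" using ij h by (auto simp: bij_betw_def inj_on_def)
    ultimately show "representation B (h i) (h j) = (if i = j then 1 else 0)"
      using representation_basis[OF B(1)] by simp
  qed
  then show ?thesis by (rule that)
qed

lemma trivial_group_Mod_carrier:
  assumes "group G"
  shows "trivial_group (G Mod carrier G)"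
proof -
  interpret group G by fact
  have "carrier G \<lhd> G" by (simp add: normal_self)
  then interpret normal "carrier G" G .
  have "H = carrier G" if "H \<in> carrier (G Mod carrier G)" for H
    using that unfolding FactGroup_def RCOSETS_def by (auto simp: coset_join2 subgroup_self split: if_splits)
  then show ?thesis
    using factorgroup_is_group group.trivial_group_subset[OF factorgroup_is_group]
    by (auto simp: FactGroup_def)
qed

context lie_module
begin

lemma group_cocycles: "group (cocycle_group scale bracket scaleM act M n)"
proof -
  define Z where "Z = {c \<in> C n. dd c = 0}"
  have "cocycle_group scale bracket scaleM act M n = \<lparr>carrier = Z, monoid.mult = (+), one = 0\<rparr>"
    unfolding cocycle_group_def Z_def using ce_diff_eq_dd by (simp cong: conj_cong)
  moreover have "group \<lparr>carrier = Z, monoid.mult = (+), one = 0\<rparr>"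
  proof (rule groupI)
    fix c assume "c \<in> carrier \<lparr>carrier = Z, monoid.mult = (+), one = 0\<rparr>"
    then have "- c \<in> Z" using dd_simps(2)[of 0 c] by (simp add: Z_def C_simps dd_simps)
    then show "\<exists>d\<in>carrier \<lparr>carrier = Z, monoid.mult = (+), one = 0\<rparr>.
        d \<otimes>\<^bsub>\<lparr>carrier = Z, monoid.mult = (+), one = 0\<rparr>\<^esub> c =
        \<one>\<^bsub>\<lparr>carrier = Z, monoid.mult = (+), one = 0\<rparr>\<^esub>"
      by (intro bexI[of _ "- c"]) simp_all
  qed (auto simp: Z_def C_simps dd_simps add.assoc)
  ultimately show ?thesis by simp
qed

lemma coboundaries_subset_cocycles:
  "ce_diff bracket scaleM act ` C n \<subseteq> carrier (cocycle_group scale bracket scaleM act M (Suc n))"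
proof
  fix c assume "c \<in> ce_diff bracket scaleM act ` C n"
  then obtain b where b: "b \<in> C n" "c = dd b" by (auto simp: ce_diff_eq_dd)
  then show "c \<in> carrier (cocycle_group scale bracket scaleM act M (Suc n))"
    using ce_diff_eq_dd[OF dd_closed[OF b(1)]] by (simp add: cocycle_group_def dd_closed dd_dd)
qed

end

theorem corollary3p5:
  fixes scale :: "'f::field \<Rightarrow> 'a::ab_group_add \<Rightarrow> 'a"
    and bracket :: "'a \<Rightarrow> 'a \<Rightarrow> 'a"
    and n :: nat
  assumes "finite_dimensional_lie_algebra scale bracket"
    and "Factorial_Ring.prime CHAR('f)"
    and "n > 0"
  shows "trivial_group
    (lie_cohomology scale bracket fun_scale (coregular scale bracket)
       (continuous_dual scale bracket) n)"
proof -
  obtain k where n: "n = Suc k" using assms(3) by (cases n) auto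
  obtain e coord m where "based_lie_algebra scale bracket e coord m"
    using finite_dimensional_lie_algebra.based_lie_algebra_exists[OF assms(1)] .
  then interpret based_lie_algebra scale bracket e coord m .
  interpret M: lie_module scale bracket fun_scale "continuous_dual scale bracket"
    "coregular scale bracket" by (rule lie_module_continuous_dual)
  let ?Z = "cocycle_group scale bracket fun_scale (coregular scale bracket) (continuous_dual scale bracket) n"
  let ?B = "coboundaries scale bracket fun_scale (coregular scale bracket) (continuous_dual scale bracket) n"
  have "?B = carrier ?Z"
  proof
    show "?B \<subseteq> carrier ?Z" unfolding n coboundaries.simps by (rule M.coboundaries_subset_cocycles)
    show "carrier ?Z \<subseteq> ?B"
      using continuous_dual_cocycle_exact[OF assms(2)] by (auto simp: n cocycle_group_def)
  qed
  then show ?thesis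
    unfolding lie_cohomology_def using trivial_group_Mod_carrier[OF M.group_cocycles] by simp
qed

end
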